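(* If $g$ is odd, then no irreducible component of $T_p(V)$ coincides with $V$ itself.
   Context: $K=\mathbb Q(\sqrt{-\Delta})$ is an imaginary quadratic field of class number $1$, $p$ is an odd prime inert in $K$, $g=\mathfrak r+\mathfrak s$, and $N$ is a level prime to $p$ all of whose prime divisors split in $K$. $X$ is (an irreducible component of) the Siegel modular variety of genus $g$ and level $N$, attached to $G=GSp_{2g}$ over $\mathbb Q$, the standard map $h_X:\mathrm{Res}_{\mathbb C/\mathbb R}G_m\to G$, and the standard level subgroup $\mathcal K=\mathcal K_N\subset G(\mathbb A_f)$ (defined as for $\Gamma_0(N)$ in genus one, with $g\times g$ blocks in place of numbers). Let $E=E_{\mathfrak r\mathfrak s}=\mathrm{diag}(1_{\mathfrak r},-1_{\mathfrak s})$ and let $G_V=GU(\mathfrak r,\mathfrak s)$ be the group over $\mathbb Q$ of matrices $\mathfrak g=h+k\sqrt{-\Delta}$ with $\mathfrak gE\bar{\mathfrak g}^t=\lambda E$, $\lambda$ an invertible scalar, embedded in $G$ by $\alpha(\mathfrak g)=\begin{pmatrix} h& kE\\ -\Delta Ek& EhE\end{pmatrix}$. $V\subset X$ is the (irreducible) Shimura subvariety attached to $G_V$, the standard $h_V:\mathrm{Res}_{\mathbb C/\mathbb R}G_m\to G_V$ and $\mathcal K_V=\mathcal K\cap\alpha(G_V(\mathbb A_f))$; its points parametrize abelian $g$-folds with multiplication by $O_K$. $T_p$ is the Hecke correspondence on $X$ of the double coset of $\mathrm{diag}(1_g,p1_g)$: for a point $t\in X$ with abelian $g$-fold $A_t$,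 $T_p(t)$ consists of the points corresponding to the quotients $A_t/W$, where $W$ runs over the $g$-dimensional $\mathbb F_p$-subspaces of the $p$-torsion $(A_t)_p$ isotropic for the Riemann (Weil) form. $T_p(V)$ is the image of $V$, a cycle on $X$. *)

theory Defs
  imports "HOL-Analysis.Analysis" "HOL-Algebra.Ideal_Product"
begin

section \<open>Imaginary quadratic fields\<close>

text \<open>The field \<open>K\<close> generated by the square root of \<open>-D\<close>, inside the complex numbers. All that is
  required of \<open>D\<close> is \<open>D > 0\<close>: it may be squarefree or the absolute value of the discriminant.\<close>

definition imag_quad_field :: "nat \<Rightarrow> complex set" where
  "imag_quad_field D = {of_rat a + of_rat b * csqrt (- of_nat D) | a b. True}"

definition ring_of_integers :: "nat \<Rightarrow> complex ring" where
  "ring_of_integers D =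
     \<lparr>carrier = {x \<in> imag_quad_field D. algebraic_int x}, mult = (*), one = 1, zero = 0, add = (+)\<rparr>"

definition nonzero_ideals :: "nat \<Rightarrow> complex set set" where
  "nonzero_ideals D = {I. ideal I (ring_of_integers D) \<and> I \<noteq> {0}}"

definition ideal_class_rel :: "nat \<Rightarrow> (complex set \<times> complex set) set" where
  "ideal_class_rel D = {(I, J). I \<in> nonzero_ideals D \<and> J \<in> nonzero_ideals D \<and>
     (\<exists>a \<in> carrier (ring_of_integers D) - {0}. \<exists>b \<in> carrier (ring_of_integers D) - {0}.
        (\<lambda>x. a * x) ` I = (\<lambda>x. b * x) ` J)}"

definition class_number :: "nat \<Rightarrow> nat" where
  "class_number D = card (nonzero_ideals D // ideal_class_rel D)"

definition inert_prime :: "nat \<Rightarrow> nat \<Rightarrow> bool" where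
  "inert_prime D q \<longleftrightarrow>
     prime q \<and> primeideal (PIdl\<^bsub>ring_of_integers D\<^esub> (of_nat q)) (ring_of_integers D)"

definition split_prime :: "nat \<Rightarrow> nat \<Rightarrow> bool" where
  "split_prime D q \<longleftrightarrow> prime q \<and>
     (\<exists>I J. primeideal I (ring_of_integers D) \<and> primeideal J (ring_of_integers D) \<and> I \<noteq> J \<and>
        PIdl\<^bsub>ring_of_integers D\<^esub> (of_nat q) = ideal_prod (ring_of_integers D) I J)"


section \<open>The finite adeles of the rationals\<close>

text \<open>The restricted product over the primes \<open>q\<close> of the \<open>q\<close>-adic fields, each being the completion of
  the rationals (Cauchy sequences modulo null sequences). An adele is represented by a family
  \<open>X q\<close> of sequences of rationals; the values at non-prime \<open>q\<close> are ignored.\<close>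

text \<open>\<open>padic_small q m x\<close>: the rational \<open>x\<close> has \<open>q\<close>-adic valuation at least \<open>m\<close>.\<close>

definition padic_small :: "nat \<Rightarrow> nat \<Rightarrow> rat \<Rightarrow> bool" where
  "padic_small q m x \<longleftrightarrow> (\<exists>a b::int. \<not> int q dvd b \<and> x * of_int b = of_int (int q ^ m * a))"

definition padic_cauchy :: "nat \<Rightarrow> (nat \<Rightarrow> rat) \<Rightarrow> bool" where
  "padic_cauchy q x \<longleftrightarrow> (\<forall>m. \<exists>M. \<forall>i\<ge>M. \<forall>j\<ge>M. padic_small q m (x i - x j))"

definition padic_null :: "nat \<Rightarrow> (nat \<Rightarrow> rat) \<Rightarrow> bool" where
  "padic_null q x \<longleftrightarrow> (\<forall>m. \<exists>M. \<forall>i\<ge>M. padic_small q m (x i))"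

text \<open>The limit of a Cauchy sequence is a \<open>q\<close>-adic integer iff the sequence eventually is
  \<open>q\<close>-integral.\<close>

definition padic_integral :: "nat \<Rightarrow> (nat \<Rightarrow> rat) \<Rightarrow> bool" where
  "padic_integral q x \<longleftrightarrow> (\<exists>M. \<forall>i\<ge>M. padic_small q 0 (x i))"

definition adelic :: "(nat \<Rightarrow> nat \<Rightarrow> rat) \<Rightarrow> bool" where
  "adelic X \<longleftrightarrow> (\<forall>q. prime q \<longrightarrow> padic_cauchy q (X q)) \<and> finite {q. prime q \<and> \<not> padic_integral q (X q)}"

definition adele_rel :: "(nat \<Rightarrow> nat \<Rightarrow> rat) \<Rightarrow> (nat \<Rightarrow> nat \<Rightarrow> rat) \<Rightarrow> bool" where
  "adele_rel X Y \<longleftrightarrow> adelic X \<and> adelic Y \<and> (\<forall>q. prime q \<longrightarrow> padic_null q (\<lambda>i. X q i - Y q i))"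

lemma padic_small_0 [simp]: "prime q \<Longrightarrow> padic_small q m 0"
  unfolding padic_small_def by (rule exI[of _ 0], rule exI[of _ 1]) (auto simp: prime_nat_iff)

lemma padic_small_uminus: "padic_small q m x \<Longrightarrow> padic_small q m (- x)"
  unfolding padic_small_def
  by (metis mult_minus_left mult_minus_right of_int_minus)

lemma padic_small_add:
  assumes "prime q" "padic_small q m x" "padic_small q m y"
  shows "padic_small q m (x + y)"
proof -
  from assms obtain a b c d where *: "\<not> int q dvd b" "x * of_int b = of_int (int q ^ m * a)"
    "\<not> int q dvd d" "y * of_int d = of_int (int q ^ m * c)"
    unfolding padic_small_def by metis
  have "\<not> int q dvd b * d"
    using * assms(1) by (simp add: prime_dvd_mult_iff)
  moreover have "(x + y) * of_int (b * d) = (x * of_int b) * of_int d + (y * of_int d) * of_int b"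
    by (simp add: algebra_simps)
  hence "(x + y) * of_int (b * d) = of_int (int q ^ m * (a * d + c * b))"
    unfolding *(2,4) by (simp add: algebra_simps)
  ultimately show ?thesis
    unfolding padic_small_def by blast
qed

lemma padic_small_diff:
  "prime q \<Longrightarrow> padic_small q m x \<Longrightarrow> padic_small q m y \<Longrightarrow> padic_small q m (x - y)"
  using padic_small_add[of q m x "- y"] padic_small_uminus by simp

lemma padic_small_mult:
  assumes "prime q" "padic_small q 0 (of_nat q ^ c * x)" "padic_small q (m + c) y"
  shows "padic_small q m (x * y)"
proof -
  from assms obtain a b a' b' where *: "\<not> int q dvd b" "of_nat q ^ c * x * of_int b = of_int a"
    "\<not> int q dvd b'" "y * of_int b' = of_int (int q ^ (m + c) * a')"
    unfolding padic_small_def by (metis power_0 mult_1)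
  have "\<not> int q dvd b * b'"
    using * assms(1) by (simp add: prime_dvd_mult_iff)
  moreover have "x * y * of_int (b * b') = x * of_int b * (y * of_int b')"
    by (simp add: algebra_simps)
  hence "x * y * of_int (b * b') = of_nat q ^ c * x * of_int b * of_int (int q ^ m * a')"
    unfolding *(4) by (simp add: algebra_simps power_add)
  hence "x * y * of_int (b * b') = of_int (int q ^ m * (a * a'))"
    unfolding *(2) by (simp add: algebra_simps)
  ultimately show ?thesis
    unfolding padic_small_def by blast
qed

lemma padic_small_mult0:
  "prime q \<Longrightarrow> padic_small q 0 x \<Longrightarrow> padic_small q 0 y \<Longrightarrow> padic_small q 0 (x * y)"
  using padic_small_mult[of q 0 x 0 y] by simp

lemma padic_small_rat_bounded:
  assumes "prime q"
  shows "\<exists>c. padic_small q 0 (of_nat q ^ c * x)"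
proof -
  obtain a b where ab: "x = Fract a b" "b > 0" by (cases x) auto
  obtain b' where b': "b = int q ^ multiplicity (int q) b * b'" "\<not> int q dvd b'"
    using multiplicity_decompose'[of b "int q"] ab(2) assms
    by (metis less_irrefl not_prime_unit prime_nat_int_transfer)
  have "x * of_int b = of_int a"
    using ab by (simp add: Fract_of_int_quotient)
  hence "of_nat q ^ multiplicity (int q) b * x * of_int b' = of_int a"
    by (subst (asm) (1) b'(1)) (simp add: algebra_simps)
  thus ?thesis
    unfolding padic_small_def using b'(2) by (metis mult_1 power_0)
qed

lemma padic_cauchy_bounded:
  assumes "prime q" "padic_cauchy q x"
  shows "\<exists>c M. \<forall>i\<ge>M. padic_small q 0 (of_nat q ^ c * x i)"
proof -
  obtain M where M: "\<forall>i\<ge>M. padic_small q 0 (x i - x M)"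
    using assms(2) unfolding padic_cauchy_def by (meson order_refl)
  obtain c where c: "padic_small q 0 (of_nat q ^ c * x M)"
    using padic_small_rat_bounded[OF assms(1)] by blast
  have one: "padic_small q 0 (of_nat q ^ c)"
    unfolding padic_small_def using assms(1)
    by (intro exI[of _ "int q ^ c"] exI[of _ 1]) (auto simp: prime_nat_iff)
  have "padic_small q 0 (of_nat q ^ c * x i)" if "i \<ge> M" for i
  proof -
    have "padic_small q 0 (x i - x M)" using M that by blast
    from padic_small_add[OF assms(1) padic_small_mult0[OF assms(1) one this] c]
    have "padic_small q 0 (of_nat q ^ c * (x i - x M) + of_nat q ^ c * x M)" .
    thus ?thesis by (simp add: algebra_simps)
  qed
  thus ?thesis by blast
qed

lemma padic_null_mult:
  assumes "prime q" "padic_cauchy q x" "padic_null q y"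
  shows "padic_null q (\<lambda>i. x i * y i)"
  unfolding padic_null_def
proof
  fix m
  obtain c M where M: "\<forall>i\<ge>M. padic_small q 0 (of_nat q ^ c * x i)"
    using padic_cauchy_bounded assms by blast
  obtain M' where M': "\<forall>i\<ge>M'. padic_small q (m + c) (y i)"
    using assms(3) unfolding padic_null_def by blast
  show "\<exists>M. \<forall>i\<ge>M. padic_small q m (x i * y i)"
    using M M' assms(1) by (intro exI[of _ "max M M'"]) (auto intro: padic_small_mult)
qed

lemma padic_null_add:
  assumes "prime q" "padic_null q x" "padic_null q y"
  shows "padic_null q (\<lambda>i. x i + y i)"
  unfolding padic_null_def
proof
  fix m
  obtain M M' where "\<forall>i\<ge>M. padic_small q m (x i)" "\<forall>i\<ge>M'. padic_small q m (y i)"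
    using assms(2,3) unfolding padic_null_def by meson
  thus "\<exists>M. \<forall>i\<ge>M. padic_small q m (x i + y i)"
    using assms(1) by (intro exI[of _ "max M M'"]) (auto intro: padic_small_add)
qed

lemma padic_null_uminus: "padic_null q x \<Longrightarrow> padic_null q (\<lambda>i. - x i)"
  unfolding padic_null_def by (meson padic_small_uminus)

lemma padic_null_const0: "prime q \<Longrightarrow> padic_null q (\<lambda>i. 0)"
  unfolding padic_null_def by simp

lemma padic_cauchy_const: "prime q \<Longrightarrow> padic_cauchy q (\<lambda>i. x)"
  unfolding padic_cauchy_def by simp

lemma padic_cauchy_add:
  assumes "prime q" "padic_cauchy q x" "padic_cauchy q y"
  shows "padic_cauchy q (\<lambda>i. x i + y i)"
  unfolding padic_cauchy_def
proof
  fix m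
  obtain M M' where *: "\<forall>i\<ge>M. \<forall>j\<ge>M. padic_small q m (x i - x j)"
    "\<forall>i\<ge>M'. \<forall>j\<ge>M'. padic_small q m (y i - y j)"
    using assms(2,3) unfolding padic_cauchy_def by meson
  have "padic_small q m ((x i - x j) + (y i - y j))" if "i \<ge> max M M'" "j \<ge> max M M'" for i j
    using * that assms(1) by (intro padic_small_add) auto
  thus "\<exists>M. \<forall>i\<ge>M. \<forall>j\<ge>M. padic_small q m (x i + y i - (x j + y j))"
    by (intro exI[of _ "max M M'"]) (auto simp: algebra_simps)
qed

lemma padic_cauchy_uminus: "padic_cauchy q x \<Longrightarrow> padic_cauchy q (\<lambda>i. - x i)"
proof -
  have "padic_small q m (- x i - - x j)" if "padic_small q m (x i - x j)" for m i j
    using padic_small_uminus[OF that] by simp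
  thus "padic_cauchy q x \<Longrightarrow> padic_cauchy q (\<lambda>i. - x i)"
    unfolding padic_cauchy_def by meson
qed

lemma padic_cauchy_mult:
  assumes "prime q" "padic_cauchy q x" "padic_cauchy q y"
  shows "padic_cauchy q (\<lambda>i. x i * y i)"
  unfolding padic_cauchy_def
proof
  fix m
  obtain c1 M1 where 1: "\<forall>i\<ge>M1. padic_small q 0 (of_nat q ^ c1 * x i)"
    using padic_cauchy_bounded assms by blast
  obtain c2 M2 where 2: "\<forall>i\<ge>M2. padic_small q 0 (of_nat q ^ c2 * y i)"
    using padic_cauchy_bounded assms by blast
  obtain M3 where 3: "\<forall>i\<ge>M3. \<forall>j\<ge>M3. padic_small q (m + c2) (x i - x j)"
    using assms(2) unfolding padic_cauchy_def by meson
  obtain M4 where 4: "\<forall>i\<ge>M4. \<forall>j\<ge>M4. padic_small q (m + c1) (y i - y j)"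
    using assms(3) unfolding padic_cauchy_def by meson
  define M where "M = max (max M1 M2) (max M3 M4)"
  have "padic_small q m (x i * y i - x j * y j)" if ij: "i \<ge> M" "j \<ge> M" for i j
  proof -
    have ge: "i \<ge> M1" "j \<ge> M2" "i \<ge> M3" "j \<ge> M3" "i \<ge> M4" "j \<ge> M4"
      using ij by (simp_all add: M_def)
    have "padic_small q m (x i * (y i - y j))"
      by (rule padic_small_mult[OF assms(1) 1[rule_format, OF ge(1)] 4[rule_format, OF ge(5,6)]])
    moreover have "padic_small q m (y j * (x i - x j))"
      by (rule padic_small_mult[OF assms(1) 2[rule_format, OF ge(2)] 3[rule_format, OF ge(3,4)]])
    ultimately have "padic_small q m (x i * (y i - y j) + y j * (x i - x j))"
      by (rule padic_small_add[OF assms(1)])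
    moreover have "x i * (y i - y j) + y j * (x i - x j) = x i * y i - x j * y j"
      by (simp add: algebra_simps)
    ultimately show ?thesis by simp
  qed
  thus "\<exists>M. \<forall>i\<ge>M. \<forall>j\<ge>M. padic_small q m (x i * y i - x j * y j)" by blast
qed

lemma padic_integral_add:
  assumes "prime q" "padic_integral q x" "padic_integral q y"
  shows "padic_integral q (\<lambda>i. x i + y i)"
proof -
  obtain M M' where "\<forall>i\<ge>M. padic_small q 0 (x i)" "\<forall>i\<ge>M'. padic_small q 0 (y i)"
    using assms(2,3) unfolding padic_integral_def by meson
  thus ?thesis
    using assms(1) unfolding padic_integral_def
    by (intro exI[of _ "max M M'"]) (auto intro: padic_small_add)
qed

lemma padic_integral_mult:
  assumes "prime q" "padic_integral q x" "padic_integral q y"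
  shows "padic_integral q (\<lambda>i. x i * y i)"
proof -
  obtain M M' where "\<forall>i\<ge>M. padic_small q 0 (x i)" "\<forall>i\<ge>M'. padic_small q 0 (y i)"
    using assms(2,3) unfolding padic_integral_def by meson
  thus ?thesis
    using assms(1) unfolding padic_integral_def
    by (intro exI[of _ "max M M'"]) (auto intro: padic_small_mult0)
qed

lemma padic_integral_uminus: "padic_integral q x \<Longrightarrow> padic_integral q (\<lambda>i. - x i)"
  unfolding padic_integral_def by (meson padic_small_uminus)

lemma adelic_const: "adelic (\<lambda>q i. x)"
proof -
  obtain a b where ab: "x = Fract a b" "b > 0" by (cases x) auto
  have "int q dvd b" if "\<not> padic_integral q (\<lambda>i. x)" for q
  proof (rule ccontr)
    assume "\<not> int q dvd b"
    moreover have "x * of_int b = of_int (int q ^ 0 * a)"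
      using ab by (simp add: Fract_of_int_quotient)
    ultimately show False
      using that unfolding padic_integral_def padic_small_def by blast
  qed
  hence "int q \<le> b" if "\<not> padic_integral q (\<lambda>i. x)" for q
    using zdvd_imp_le[OF _ ab(2)] that by blast
  hence "{q. prime q \<and> \<not> padic_integral q (\<lambda>i. x)} \<subseteq> {..nat b}"
    by (simp add: subset_iff le_nat_iff less_imp_le[OF ab(2)])
  hence "finite {q. prime q \<and> \<not> padic_integral q (\<lambda>i. x)}"
    by (rule finite_subset) simp
  thus ?thesis
    unfolding adelic_def using padic_cauchy_const by blast
qed

lemma adelic_add:
  assumes "adelic X" "adelic Y"
  shows "adelic (\<lambda>q i. X q i + Y q i)"
proof -
  let ?B = "\<lambda>Z. {q. prime q \<and> \<not> padic_integral q (Z q)}"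
  have "padic_integral q (\<lambda>i. X q i + Y q i)"
    if "prime q" "padic_integral q (X q)" "padic_integral q (Y q)" for q
    by (rule padic_integral_add[OF that])
  hence "?B (\<lambda>q i. X q i + Y q i) \<subseteq> ?B X \<union> ?B Y" by auto
  moreover have "finite (?B X \<union> ?B Y)"
    using assms unfolding adelic_def by simp
  ultimately have "finite (?B (\<lambda>q i. X q i + Y q i))"
    by (rule finite_subset)
  moreover have "padic_cauchy q (\<lambda>i. X q i + Y q i)" if "prime q" for q
    by (rule padic_cauchy_add[OF that]) (use assms that in \<open>simp_all add: adelic_def\<close>)
  ultimately show ?thesis unfolding adelic_def by simp
qed

lemma adelic_mult:
  assumes "adelic X" "adelic Y"
  shows "adelic (\<lambda>q i. X q i * Y q i)"
proof -
  let ?B = "\<lambda>Z. {q. prime q \<and> \<not> padic_integral q (Z q)}"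
  have "padic_integral q (\<lambda>i. X q i * Y q i)"
    if "prime q" "padic_integral q (X q)" "padic_integral q (Y q)" for q
    by (rule padic_integral_mult[OF that])
  hence "?B (\<lambda>q i. X q i * Y q i) \<subseteq> ?B X \<union> ?B Y" by auto
  moreover have "finite (?B X \<union> ?B Y)"
    using assms unfolding adelic_def by simp
  ultimately have "finite (?B (\<lambda>q i. X q i * Y q i))"
    by (rule finite_subset)
  moreover have "padic_cauchy q (\<lambda>i. X q i * Y q i)" if "prime q" for q
    by (rule padic_cauchy_mult[OF that]) (use assms that in \<open>simp_all add: adelic_def\<close>)
  ultimately show ?thesis unfolding adelic_def by simp
qed

lemma adelic_uminus:
  assumes "adelic X"
  shows "adelic (\<lambda>q i. - X q i)"
proof -
  let ?B = "\<lambda>Z. {q. prime q \<and> \<not> padic_integral q (Z q)}"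
  have "padic_integral q (\<lambda>i. - X q i)" if "padic_integral q (X q)" for q
    by (rule padic_integral_uminus[OF that])
  hence "?B (\<lambda>q i. - X q i) \<subseteq> ?B X" by auto
  moreover have "finite (?B X)"
    using assms unfolding adelic_def by simp
  ultimately have "finite (?B (\<lambda>q i. - X q i))"
    by (rule finite_subset)
  moreover have "padic_cauchy q (\<lambda>i. - X q i)" if "prime q" for q
    by (rule padic_cauchy_uminus) (use assms that in \<open>simp add: adelic_def\<close>)
  ultimately show ?thesis unfolding adelic_def by simp
qed

lemma adele_rel_refl: "adelic X \<Longrightarrow> adele_rel X X"
  unfolding adele_rel_def by (simp add: padic_null_const0)

lemma part_equivp_adele_rel: "part_equivp adele_rel"
proof (rule part_equivpI)
  show "\<exists>X. adele_rel X X"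
    using adele_rel_refl[OF adelic_const] by blast
  show "symp adele_rel"
  proof (rule sympI)
    fix X Y assume *: "adele_rel X Y"
    have "padic_null q (\<lambda>i. Y q i - X q i)" if "prime q" for q
      using padic_null_uminus[of q "\<lambda>i. X q i - Y q i"] * that
      unfolding adele_rel_def by simp
    thus "adele_rel Y X" using * unfolding adele_rel_def by blast
  qed
  show "transp adele_rel"
  proof (rule transpI)
    fix X Y Z assume *: "adele_rel X Y" "adele_rel Y Z"
    have "padic_null q (\<lambda>i. X q i - Z q i)" if "prime q" for q
      using padic_null_add[of q "\<lambda>i. X q i - Y q i" "\<lambda>i. Y q i - Z q i"] * that
      unfolding adele_rel_def by simp
    thus "adele_rel X Z" using * unfolding adele_rel_def by blast
  qed
qed

quotient_type adele = "nat \<Rightarrow> nat \<Rightarrow> rat" / partial: adele_rel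
  by (rule part_equivp_adele_rel)

lemma adele_cases:
  obtains X where "a = abs_adele X" "adelic X"
proof
  show "a = abs_adele (rep_adele a)"
    using Quotient_abs_rep[OF Quotient_adele] by simp
  show "adelic (rep_adele a)"
    using Quotient_rep_reflp[OF Quotient_adele] unfolding adele_rel_def by blast
qed

instantiation adele :: comm_ring_1
begin

lift_definition zero_adele :: adele is "\<lambda>q i. 0"
  by (rule adele_rel_refl[OF adelic_const])

lift_definition one_adele :: adele is "\<lambda>q i. 1"
  by (rule adele_rel_refl[OF adelic_const])

lift_definition plus_adele :: "adele \<Rightarrow> adele \<Rightarrow> adele" is "\<lambda>X Y q i. X q i + Y q i"
  subgoal premises prems for X X' Y Y'
  proof -
    have "padic_null q (\<lambda>i. X q i + Y q i - (X' q i + Y' q i))" if "prime q" for q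
      using padic_null_add[of q "\<lambda>i. X q i - X' q i" "\<lambda>i. Y q i - Y' q i"] prems that
      unfolding adele_rel_def by (simp add: algebra_simps)
    thus ?thesis
      using prems unfolding adele_rel_def by (simp add: adelic_add)
  qed
  done

lift_definition uminus_adele :: "adele \<Rightarrow> adele" is "\<lambda>X q i. - X q i"
  subgoal premises prems for X X'
  proof -
    have "padic_null q (\<lambda>i. - X q i - - X' q i)" if "prime q" for q
      using padic_null_uminus[of q "\<lambda>i. X q i - X' q i"] prems that
      unfolding adele_rel_def by (simp add: algebra_simps)
    thus ?thesis
      using prems unfolding adele_rel_def by (simp add: adelic_uminus)
  qed
  done

lift_definition times_adele :: "adele \<Rightarrow> adele \<Rightarrow> adele" is "\<lambda>X Y q i. X q i * Y q i"
  subgoal premises prems for X X' Y Y'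
  proof -
    have "padic_null q (\<lambda>i. X q i * Y q i - X' q i * Y' q i)" if "prime q" for q
    proof -
      have "padic_null q (\<lambda>i. X q i * (Y q i - Y' q i) + Y' q i * (X q i - X' q i))"
        using prems that unfolding adele_rel_def adelic_def
        by (intro padic_null_add padic_null_mult) auto
      thus ?thesis by (simp add: algebra_simps)
    qed
    thus ?thesis
      using prems unfolding adele_rel_def by (simp add: adelic_mult)
  qed
  done

definition minus_adele :: "adele \<Rightarrow> adele \<Rightarrow> adele" where
  "minus_adele x y = x + - y"

instance
proof
  note [simp] = zero_adele_def one_adele_def plus_adele.abs_eq times_adele.abs_eq uminus_adele.abs_eq
    adele_rel_refl adelic_const adelic_add adelic_mult adelic_uminus
  fix a b c :: adele
  obtain X where [simp]: "a = abs_adele X" "adelic X" by (rule adele_cases)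
  obtain Y where [simp]: "b = abs_adele Y" "adelic Y" by (rule adele_cases)
  obtain Z where [simp]: "c = abs_adele Z" "adelic Z" by (rule adele_cases)
  show "a + b + c = a + (b + c)" by (simp add: add.assoc)
  show "a + b = b + a" by (simp add: add.commute)
  show "0 + a = a" by simp
  show "- a + a = 0" by simp
  show "a - b = a + - b" by (rule minus_adele_def)
  show "a * b * c = a * (b * c)" by (simp add: mult.assoc)
  show "a * b = b * a" by (simp add: mult.commute)
  show "1 * a = a" by simp
  show "(a + b) * c = a * c + b * c" by (simp add: distrib_right)
  show "(0::adele) \<noteq> 1"
  proof
    assume "(0::adele) = 1"
    hence "adele_rel (\<lambda>q i. 0) (\<lambda>q i. 1)"
      unfolding zero_adele_def one_adele_def
      using Quotient_rel_abs2[OF Quotient_adele] Quotient_rel[OF Quotient_adele] adele_rel_refl[OF adelic_const]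
      by metis
    hence "padic_null 2 (\<lambda>i. 0 - 1)"
      unfolding adele_rel_def using two_is_prime_nat by blast
    then obtain M :: nat where "\<forall>i\<ge>M. padic_small 2 1 (0 - 1)"
      unfolding padic_null_def by blast
    hence "padic_small 2 1 (0 - 1)" by (meson order_refl)
    then obtain a b :: int where ab: "\<not> 2 dvd b" "(0 - 1) * rat_of_int b = of_int (2 * a)"
      unfolding padic_small_def by auto
    from ab(2) have "rat_of_int (- b) = of_int (2 * a)" by simp
    hence "- b = 2 * a" by (simp only: of_int_eq_iff)
    with ab(1) show False by presburger
  qed
qed

end

lift_definition adele_of_rat :: "rat \<Rightarrow> adele" is "\<lambda>x q i. x"
  by (rule adele_rel_refl[OF adelic_const])

text \<open>The finite adeles that are integral at every prime, i.e. the profinite integers.\<close>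

lift_definition adele_integral :: "adele \<Rightarrow> bool" is "\<lambda>X. \<forall>q. prime q \<longrightarrow> padic_integral q (X q)"
proof -
  have *: "padic_integral q (Y q)"
    if "adele_rel X Y" "prime q" "padic_integral q (X q)" for X Y q
  proof -
    have "padic_null q (\<lambda>i. X q i - Y q i)"
      using that(1,2) unfolding adele_rel_def by simp
    hence "padic_integral q (\<lambda>i. X q i - Y q i)"
      unfolding padic_null_def padic_integral_def by (rule spec)
    from padic_integral_add[OF that(2,3) padic_integral_uminus[OF this]] show ?thesis by simp
  qed
  fix X Y assume XY: "adele_rel X Y"
  hence YX: "adele_rel Y X"
    by (rule part_equivp_symp[OF part_equivp_adele_rel])
  show "(\<forall>q. prime q \<longrightarrow> padic_integral q (X q)) = (\<forall>q. prime q \<longrightarrow> padic_integral q (Y q))"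
    using *[OF XY] *[OF YX] by iprover
qed


section \<open>Symplectic and unitary similitude groups\<close>

text \<open>\<open>2g \<times> 2g\<close> matrices are indexed by \<open>'g + 'g\<close>, where \<open>g = CARD('g)\<close>.\<close>

definition block :: "'a^'g^'g \<Rightarrow> 'a^'g^'g \<Rightarrow> 'a^'g^'g \<Rightarrow> 'a^'g^'g \<Rightarrow> 'a^('g + 'g)^('g + 'g)" where
  "block A B C D = (\<chi> i j. case i of
      Inl i' \<Rightarrow> (case j of Inl j' \<Rightarrow> A $ i' $ j' | Inr j' \<Rightarrow> B $ i' $ j')
    | Inr i' \<Rightarrow> (case j of Inl j' \<Rightarrow> C $ i' $ j' | Inr j' \<Rightarrow> D $ i' $ j'))"

definition blockA :: "'a^('g + 'g)^('g + 'g) \<Rightarrow> 'a^'g^'g" where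
  "blockA M = (\<chi> i j. M $ Inl i $ Inl j)"

definition blockB :: "'a^('g + 'g)^('g + 'g) \<Rightarrow> 'a^'g^'g" where
  "blockB M = (\<chi> i j. M $ Inl i $ Inr j)"

definition blockC :: "'a^('g + 'g)^('g + 'g) \<Rightarrow> 'a^'g^'g" where
  "blockC M = (\<chi> i j. M $ Inr i $ Inl j)"

definition blockD :: "'a^('g + 'g)^('g + 'g) \<Rightarrow> 'a^'g^'g" where
  "blockD M = (\<chi> i j. M $ Inr i $ Inr j)"

definition sympl_form :: "'a::comm_ring_1^('g::finite + 'g)^('g + 'g)" where
  "sympl_form = block 0 (mat 1) (- mat 1) 0"

text \<open>The points of \<open>G = GSp\<close> over an arbitrary commutative ring.\<close>

definition GSp :: "('a::comm_ring_1^('g::finite + 'g)^('g + 'g)) set" where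
  "GSp = {M. \<exists>l. l dvd 1 \<and> M ** sympl_form ** transpose M = mat l ** sympl_form}"

text \<open>The diagonal matrix \<open>E\<close> with entries \<open>1\<close> on the index set \<open>P\<close> and \<open>-1\<close> off \<open>P\<close>; for
  \<open>card P = r\<close> this is \<open>diag(1_r, -1_s)\<close> up to the labelling of the indices.\<close>

definition sign_mat :: "'g::finite set \<Rightarrow> 'a::comm_ring_1^'g^'g" where
  "sign_mat P = (\<chi> i j. if i = j then (if i \<in> P then 1 else - 1) else 0)"

text \<open>The points of \<open>G_V = GU(r,s)\<close> over a commutative ring \<open>R\<close>. The pair \<open>(h, k)\<close> stands for the matrix
  \<open>h + k sqrt(-D)\<close> over the tensor product of \<open>R\<close> and \<open>K\<close>, on which conjugation is \<open>k \<mapsto> -k\<close>; the two equations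
  are the components of \<open>(h + k sqrt(-D)) E (h - k sqrt(-D))^t = l E\<close>.\<close>

definition GU :: "nat \<Rightarrow> 'g::finite set \<Rightarrow> (('a::comm_ring_1^'g^'g) \<times> ('a^'g^'g)) set" where
  "GU D P = {(h, k). \<exists>l. l dvd 1 \<and>
      h ** sign_mat P ** transpose h + mat (of_nat D) ** (k ** sign_mat P ** transpose k)
        = mat l ** sign_mat P \<and>
      k ** sign_mat P ** transpose h - h ** sign_mat P ** transpose k = 0}"

definition unitary_embed ::
    "nat \<Rightarrow> 'g::finite set \<Rightarrow> ('a::comm_ring_1^'g^'g) \<times> ('a^'g^'g) \<Rightarrow> 'a^('g + 'g)^('g + 'g)" where
  "unitary_embed D P = (\<lambda>(h, k).
     block h (k ** sign_mat P) (- (mat (of_nat D) ** sign_mat P ** k)) (sign_mat P ** h ** sign_mat P))"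

text \<open>The level subgroup of \<open>GSp\<close> over the finite adeles: invertible over the profinite integers,
  with lower left block divisible by \<open>N\<close>.\<close>

definition level_group :: "nat \<Rightarrow> (adele^('g::finite + 'g)^('g + 'g)) set" where
  "level_group N = {M \<in> GSp. (\<forall>i j. adele_integral (M $ i $ j)) \<and>
      (\<exists>M'. M ** M' = mat 1 \<and> M' ** M = mat 1 \<and> (\<forall>i j. adele_integral (M' $ i $ j))) \<and>
      (\<forall>i j. \<exists>c. adele_integral c \<and> blockC M $ i $ j = of_nat N * c)}"


section \<open>Shimura data\<close>

text \<open>The standard homomorphisms from the multiplicative group of the complex numbers; elements of the
  real points of \<open>G_V\<close> are again pairs, and \<open>z = a + b i\<close> goes to \<open>diag(z 1_r, cnj z 1_s)\<close>, which is
  \<open>a 1 + (b / sqrt D) E sqrt(-D)\<close>.\<close>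

definition h_Siegel :: "complex \<Rightarrow> real^('g::finite + 'g)^('g + 'g)" where
  "h_Siegel z = block (mat (Re z)) (mat (Im z)) (- mat (Im z)) (mat (Re z))"

definition h_unitary :: "nat \<Rightarrow> 'g::finite set \<Rightarrow> complex \<Rightarrow> (real^'g^'g) \<times> (real^'g^'g)" where
  "h_unitary D P z = (mat (Re z), mat (Im z / sqrt (of_nat D)) ** sign_mat P)"

definition conj_class ::
    "(real^('g::finite + 'g)^('g + 'g)) set \<Rightarrow> (complex \<Rightarrow> real^('g + 'g)^('g + 'g))
      \<Rightarrow> (complex \<Rightarrow> real^('g + 'g)^('g + 'g)) set" where
  "conj_class H h = {\<lambda>z. x ** h z ** matrix_inv x | x. x \<in> H}"

text \<open>A homomorphism \<open>h\<close> conjugate to \<open>h_Siegel\<close> is identified with the unique \<open>g \<times> g\<close> matrix \<open>\<tau>\<close> such that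
  the columns of \<open>(\<tau>; 1)\<close> are eigenvectors of every \<open>h z\<close> with eigenvalue \<open>cnj z\<close>. Thus \<open>h_Siegel\<close> itself
  gives \<open>\<tau> = i 1\<close>, the conjugate by \<open>x\<close> gives \<open>(A \<tau> + B) (C \<tau> + D)^-1\<close>, and the conjugacy
  class becomes the union of the Siegel upper and lower half spaces.\<close>

definition period_domain ::
    "(complex \<Rightarrow> real^('g::finite + 'g)^('g + 'g)) set \<Rightarrow> (complex^'g^'g) set" where
  "period_domain H = {\<tau>. \<exists>h\<in>H. \<forall>z. z \<noteq> 0 \<longrightarrow>
      (let M = map_matrix complex_of_real (h z) in
         blockA M ** \<tau> + blockB M = mat (cnj z) ** \<tau> \<and>
         blockC M ** \<tau> + blockD M = mat (cnj z))}"

definition siegel_domain :: "(complex^'g::finite^'g) set" where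
  "siegel_domain = period_domain (conj_class GSp h_Siegel)"

definition unitary_domain :: "nat \<Rightarrow> 'g::finite set \<Rightarrow> (complex^'g^'g) set" where
  "unitary_domain D P = period_domain
     (conj_class (unitary_embed D P ` GU D P) (\<lambda>z. unitary_embed D P (h_unitary D P z)))"

definition moebius :: "complex^('g::finite + 'g)^('g + 'g) \<Rightarrow> complex^'g^'g \<Rightarrow> complex^'g^'g" where
  "moebius M \<tau> = (blockA M ** \<tau> + blockB M) ** matrix_inv (blockC M ** \<tau> + blockD M)"

definition automorphy_factor :: "complex^('g::finite + 'g)^('g + 'g) \<Rightarrow> complex^'g^'g \<Rightarrow> complex" where
  "automorphy_factor M \<tau> = det (blockC M ** \<tau> + blockD M)"


section \<open>Shimura varieties and the Hecke correspondence\<close>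

type_synonym 'g adelic_group = "adele^('g + 'g)^('g + 'g)"
type_synonym 'g shimura_point = "((complex^'g^'g) \<times> 'g adelic_group) set"

text \<open>The double coset spaces \<open>H(\<rat>) \ \<D> \<times> H(\<A>) / U\<close> for a subgroup \<open>H\<close> of \<open>GSp\<close> with domain \<open>\<D>\<close>,
  given by its rational points \<open>HQ\<close> and its finite adelic points \<open>HA\<close>.\<close>

definition shimura_rel ::
    "(rat^('g::finite + 'g)^('g + 'g)) set \<Rightarrow> (complex^'g^'g) set \<Rightarrow> 'g adelic_group set \<Rightarrow> 'g adelic_group set
      \<Rightarrow> (((complex^'g^'g) \<times> 'g adelic_group) \<times> ((complex^'g^'g) \<times> 'g adelic_group)) set" where
  "shimura_rel HQ \<D> HA U = {((\<tau>, a), (\<tau>', a')).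
      (\<tau>, a) \<in> \<D> \<times> HA \<and> (\<tau>', a') \<in> \<D> \<times> HA \<and>
      (\<exists>x\<in>HQ. \<exists>u\<in>U. \<tau>' = moebius (map_matrix of_rat x) \<tau> \<and> a' = map_matrix adele_of_rat x ** a ** u)}"

definition shimura_variety ::
    "(rat^('g::finite + 'g)^('g + 'g)) set \<Rightarrow> (complex^'g^'g) set \<Rightarrow> 'g adelic_group set \<Rightarrow> 'g adelic_group set
      \<Rightarrow> 'g shimura_point set" where
  "shimura_variety HQ \<D> HA U = (\<D> \<times> HA) // shimura_rel HQ \<D> HA U"

definition siegel_rel ::
    "nat \<Rightarrow> (((complex^'g::finite^'g) \<times> 'g adelic_group) \<times> ((complex^'g^'g) \<times> 'g adelic_group)) set" where
  "siegel_rel N = shimura_rel GSp siegel_domain GSp (level_group N)"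

definition siegel_variety :: "nat \<Rightarrow> 'g::finite shimura_point set" where
  "siegel_variety N = shimura_variety GSp siegel_domain GSp (level_group N)"

definition unitary_shimura_variety :: "nat \<Rightarrow> 'g::finite set \<Rightarrow> nat \<Rightarrow> 'g shimura_point set" where
  "unitary_shimura_variety D P N =
     shimura_variety (unitary_embed D P ` GU D P) (unitary_domain D P) (unitary_embed D P ` GU D P)
       (level_group N \<inter> unitary_embed D P ` GU D P)"

text \<open>The image of the unitary Shimura variety in the Siegel modular variety.\<close>

definition unitary_locus :: "nat \<Rightarrow> 'g::finite set \<Rightarrow> nat \<Rightarrow> 'g shimura_point set" where
  "unitary_locus D P N = (\<lambda>t. siegel_rel N `` t) ` unitary_shimura_variety D P N"

text \<open>The Hecke correspondence of the double coset \<open>U \<delta> U\<close>, where \<open>U\<close> is the level group and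
  \<open>\<delta> = diag(1_g, p 1_g)\<close>. For \<open>p\<close> prime to \<open>N\<close> the components of \<open>\<delta>\<close> away from \<open>p\<close> lie in \<open>U\<close>, so it does
  not matter that \<open>\<delta>\<close> is embedded at all primes.\<close>

definition hecke_point :: "nat \<Rightarrow> nat \<Rightarrow> 'g::finite shimura_point \<Rightarrow> 'g shimura_point set" where
  "hecke_point N p t = {siegel_rel N `` {(\<tau>, a ** u ** block (mat 1) 0 0 (mat (of_nat p)))} | \<tau> a u.
      (\<tau>, a) \<in> t \<and> u \<in> level_group N}"

definition hecke_image :: "nat \<Rightarrow> nat \<Rightarrow> 'g::finite shimura_point set \<Rightarrow> 'g shimura_point set" where
  "hecke_image N p V = (\<Union>t\<in>V. hecke_point N p t)"


section \<open>The Zariski topology\<close>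

text \<open>Holomorphic functions on an open part of the space of symmetric complex matrices.\<close>

definition holomorphic_on_sym :: "(complex^'g::finite^'g \<Rightarrow> complex) \<Rightarrow> (complex^'g^'g) set \<Rightarrow> bool" where
  "holomorphic_on_sym f S \<longleftrightarrow> (\<forall>\<tau>\<in>S. \<exists>L.
      (f has_derivative L) (at \<tau> within {\<sigma>. transpose \<sigma> = \<sigma>}) \<and> (\<forall>c M. L (mat c ** M) = c * L M))"

text \<open>Siegel modular forms of weight \<open>w\<close>, as functions on \<open>siegel_domain \<times> GSp\<close> over the finite adeles.
  The growth condition is holomorphy at the cusps (the argument \<open>a\<close> runs through all of them); it is
  automatic for \<open>g \<ge> 2\<close>.\<close>

definition siegel_modular_form ::
    "nat \<Rightarrow> nat \<Rightarrow> (complex^'g::finite^'g \<Rightarrow> 'g adelic_group \<Rightarrow> complex) \<Rightarrow> bool" where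
  "siegel_modular_form N w f \<longleftrightarrow>
     (\<forall>a\<in>GSp. holomorphic_on_sym (\<lambda>\<tau>. f \<tau> a) siegel_domain) \<and>
     (\<forall>\<tau>\<in>siegel_domain. \<forall>a\<in>GSp. \<forall>x\<in>GSp. \<forall>u\<in>level_group N.
        f (moebius (map_matrix of_rat x) \<tau>) (map_matrix adele_of_rat x ** a ** u)
          = automorphy_factor (map_matrix of_rat x) \<tau> ^ w * f \<tau> a) \<and>
     (\<forall>a\<in>GSp. \<forall>c>0. \<exists>B. \<forall>\<tau>\<in>siegel_domain.
        (\<forall>v. c * (v \<bullet> v) \<le> v \<bullet> (map_matrix Im \<tau> *v v)) \<longrightarrow> norm (f \<tau> a) \<le> B)"

text \<open>By Baily-Borel the Siegel modular variety is Zariski open in \<open>Proj\<close> of the graded ring of modular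
  forms, so the non-vanishing loci of modular forms are a basis of its Zariski topology.\<close>

definition nonvanishing_locus ::
    "nat \<Rightarrow> (complex^'g::finite^'g \<Rightarrow> 'g adelic_group \<Rightarrow> complex) \<Rightarrow> 'g shimura_point set" where
  "nonvanishing_locus N f = {t \<in> siegel_variety N. \<forall>(\<tau>, a)\<in>t. f \<tau> a \<noteq> 0}"

definition siegel_zariski :: "nat \<Rightarrow> 'g::finite shimura_point topology" where
  "siegel_zariski N = topology_generated_by {nonvanishing_locus N f | f w. siegel_modular_form N w f}"

definition irreducible_in :: "'a topology \<Rightarrow> 'a set \<Rightarrow> bool" where
  "irreducible_in T S \<longleftrightarrow> S \<subseteq> topspace T \<and> S \<noteq> {} \<and>
     (\<forall>A B. closedin T A \<and> closedin T B \<and> S \<subseteq> A \<union> B \<longrightarrow> S \<subseteq> A \<or> S \<subseteq> B)"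

definition irreducible_components :: "'a topology \<Rightarrow> 'a set \<Rightarrow> 'a set set" where
  "irreducible_components T Y = {Z. Z \<subseteq> Y \<and> irreducible_in T Z \<and>
     (\<forall>Z'. Z' \<subseteq> Y \<and> irreducible_in T Z' \<and> Z \<subseteq> Z' \<longrightarrow> Z' = Z)}"

text \<open>The irreducible Shimura subvarieties attached to \<open>G_V\<close>. If the image of the unitary Shimura
  variety is irreducible, it is the only one. In general (for some \<open>D\<close> and \<open>N\<close>) it is a finite union of
  images of \<open>unitary_domain \<times> {x}\<close>, and the irreducible components are those pieces.\<close>

definition unitary_subvarieties :: "nat \<Rightarrow> 'g::finite set \<Rightarrow> nat \<Rightarrow> 'g shimura_point set set" where
  "unitary_subvarieties D P N = {V \<in> irreducible_components (siegel_zariski N) (unitary_locus D P N).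
     \<exists>x\<in>GU D P. \<forall>\<tau>\<in>unitary_domain D P. siegel_rel N `` {(\<tau>, unitary_embed D P x)} \<in> V}"

end

theory Submission
  imports Defs
begin

text \<open>
  Every similitude in sight, apart from \<open>diag(1, p)\<close>, has a multiplier of even valuation at \<open>p\<close>.

  Suppose that \<open>V\<close> is a component of \<open>T\<^sub>p(V)\<close>, so that \<open>V \<subseteq> T\<^sub>p(V)\<close>. The base point
  \<open>\<tau>0 = i / sqrt D\<close> of the unitary domain gives a point \<open>t0\<close> of \<open>V\<close>, and \<open>t0\<close> lies in \<open>T\<^sub>p(t)\<close> for some
  \<open>t\<close> in \<open>V\<close>. Let \<open>x\<close> and \<open>x'\<close> be the adelic components, in the unitary group, of \<open>t0\<close> and \<open>t\<close>. In the
  double coset space this means that \<open>\<gamma> x = x' u \<delta> u'\<close> with \<open>\<delta> = diag(1, p)\<close>, with \<open>u\<close> and \<open>u'\<close>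
  in the level group and with a rational symplectic similitude \<open>\<gamma>\<close> that maps \<open>\<tau>0\<close> to the period \<open>\<tau>\<close> of
  \<open>t\<close>. Compare the valuations at \<open>p\<close> of the multipliers of the two sides.

  \<^item> The multipliers of \<open>u\<close> and \<open>u'\<close> are units at \<open>p\<close> (\<open>level_group_multiplier\<close>), and that of \<open>\<delta>\<close> is \<open>p\<close>.

  \<^item> If \<open>l\<close> is the multiplier of \<open>x\<close> or \<open>x'\<close>, then \<open>l\<^sup>g\<close> is the norm of the determinant of a \<open>g \<times> g\<close>
  matrix over the quadratic extension (\<open>unitary_multiplier_norm\<close>). As \<open>p\<close> is inert, norms have even valuation
  (\<open>inert_norm_val_even\<close>), and as \<open>g\<close> is odd, so does \<open>l\<close>.

  \<^item> The abelian variety of \<open>t0\<close> is, up to isogeny, a power of an elliptic curve with complex multiplication by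
  \<open>K\<close>, so \<open>\<tau>\<close> has entries in \<open>K\<close>, and \<open>\<gamma>\<close> is a similitude between two hermitian forms over \<open>K\<close>: the
  standard one, which belongs to \<open>\<tau>0\<close>, and the form \<open>H\<close> of \<open>\<tau>\<close>. If \<open>l\<close> is its multiplier, then \<open>l\<^sup>g\<close>
  is \<open>det H\<close> times a norm. There are now two commuting actions of \<open>K\<close> at \<open>\<tau>\<close>: one from the complex structure,
  with form \<open>H\<close>, and one from the multiplication by \<open>O\<^sub>K\<close>, with form \<open>E\<close>. The space is the orthogonal sum of
  the part where they agree and the part where they are conjugate, and passing from one to the other changes the
  determinant of the form only by a sign and by norms (\<open>hermitian_determinant_norm\<close>). So \<open>\<plusminus> l\<^sup>g\<close> is a norm,
  and \<open>l\<close> has even valuation (\<open>isogeny_multiplier_val_even\<close>).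

  The valuation of the multiplier is thus even on the left and odd on the right.
\<close>

section \<open>Block matrices and similitudes\<close>

lemma sum_UNIV_Plus:
  fixes f :: "'a::finite + 'b::finite \<Rightarrow> 'c::comm_monoid_add"
  shows "sum f UNIV = (\<Sum>i\<in>UNIV. f (Inl i)) + (\<Sum>i\<in>UNIV. f (Inr i))"
  unfolding UNIV_Plus_UNIV[symmetric] by (subst sum.Plus) simp_all

lemma forall_Plus: "(\<forall>i. Q i) \<longleftrightarrow> (\<forall>i. Q (Inl i)) \<and> (\<forall>i. Q (Inr i))"
  by (metis sum.exhaust)

definition stack :: "'a^'n^'g \<Rightarrow> 'a^'n^'g \<Rightarrow> 'a^'n^('g + 'g)" where
  "stack X Y = (\<chi> i. case i of Inl i' \<Rightarrow> X $ i' | Inr i' \<Rightarrow> Y $ i')"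

lemma stack_nth [simp]: "stack X Y $ Inl i = X $ i" "stack X Y $ Inr i = Y $ i"
  by (simp_all add: stack_def)

lemma block_nth [simp]:
  "block A B C D $ Inl i $ Inl j = A $ i $ j" "block A B C D $ Inl i $ Inr j = B $ i $ j"
  "block A B C D $ Inr i $ Inl j = C $ i $ j" "block A B C D $ Inr i $ Inr j = D $ i $ j"
  by (simp_all add: block_def)

lemma block_eq_iff: "block A B C D = block A' B' C' D' \<longleftrightarrow> A = A' \<and> B = B' \<and> C = C' \<and> D = D'"
  by (auto simp: vec_eq_iff forall_Plus)

lemma stack_eq_iff: "stack X Y = stack X' Y' \<longleftrightarrow> X = X' \<and> Y = Y'"
  by (auto simp: vec_eq_iff forall_Plus)

lemma block_collapse: "block (blockA M) (blockB M) (blockC M) (blockD M) = M"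
  by (simp add: vec_eq_iff forall_Plus blockA_def blockB_def blockC_def blockD_def)

lemma blocks_block [simp]:
  "blockA (block A B C D) = A" "blockB (block A B C D) = B"
  "blockC (block A B C D) = C" "blockD (block A B C D) = D"
  by (simp_all add: vec_eq_iff blockA_def blockB_def blockC_def blockD_def)

lemma matrix_uminus_mult:
  fixes A :: "'a::comm_ring_1^'n::finite^'m" and B :: "'a^'k^'n"
  shows "(- A) ** B = - (A ** B)" "A ** (- B) = - (A ** B)"
  by (simp_all add: vec_eq_iff matrix_matrix_mult_def sum_negf)

lemma mat_mult_nth [simp]:
  fixes A :: "'a::comm_ring_1^'n^'m::finite"
  shows "(mat l ** A) $ i $ j = l * A $ i $ j"
  by (simp add: matrix_matrix_mult_def mat_def if_distrib[of "\<lambda>x. x * _"] cong: if_cong)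

lemma mult_mat_nth [simp]:
  fixes A :: "'a::comm_ring_1^'n::finite^'m"
  shows "(A ** mat l) $ i $ j = l * A $ i $ j"
  by (simp add: matrix_matrix_mult_def mat_def if_distrib[of "\<lambda>x. _ * x"] mult.commute cong: if_cong)

lemma mat_mult_assoc:
  fixes A :: "'a::comm_ring_1^'n::finite^'m::finite" and B :: "'a^'k^'n"
  shows "A ** (mat l ** B) = mat l ** (A ** B)" "(mat l ** A) ** B = mat l ** (A ** B)"
  by (simp_all add: vec_eq_iff matrix_matrix_mult_def[of A] matrix_matrix_mult_def[of "mat l ** A"]
      sum_distrib_left algebra_simps)

lemma mat_mult_mat:
  fixes A :: "'a::comm_ring_1^'n::finite^'m::finite"
  shows "mat l ** (mat l' ** A) = mat (l * l') ** A" "A ** mat l = mat l ** A" "mat 1 ** A = A"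
  by (simp_all add: vec_eq_iff algebra_simps)

lemma mat_arith:
  "mat 0 = (0 :: 'a::comm_ring_1^'n^'n::finite)"
  "mat (- a) = (- mat a :: 'a::comm_ring_1^'n^'n::finite)"
  by (simp_all add: vec_eq_iff mat_def)

lemma mat_mult_mat_mat: "mat a ** mat b = (mat (a * b) :: 'a::comm_ring_1^'n^'n::finite)"
  by (simp add: vec_eq_iff) (simp add: mat_def)

lemma matrix_inv_inverse:
  fixes A :: "'a::field^'n::finite^'n"
  assumes "invertible A"
  shows "A ** matrix_inv A = mat 1" "matrix_inv A ** A = mat 1"
proof -
  have "A ** matrix_inv A = mat 1 \<and> matrix_inv A ** A = mat 1"
    using assms unfolding matrix_inv_def invertible_def by (rule someI_ex)
  thus "A ** matrix_inv A = mat 1" "matrix_inv A ** A = mat 1" by auto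
qed

lemma matrix_inv_one: "matrix_inv (mat 1) = (mat 1 :: 'a::field^'n::finite^'n)"
proof -
  have "invertible (mat 1 :: 'a^'n^'n)" by (auto simp: invertible_def)
  from matrix_inv_inverse(1)[OF this] show ?thesis by simp
qed

lemma block_mult:
  fixes A :: "'a::comm_ring_1^'g::finite^'g"
  shows "block A B C D ** block A' B' C' D' =
    block (A ** A' + B ** C') (A ** B' + B ** D') (C ** A' + D ** C') (C ** B' + D ** D')"
  by (simp add: vec_eq_iff forall_Plus) (simp add: matrix_matrix_mult_def sum_UNIV_Plus)

lemma block_mult_stack:
  fixes A :: "'a::comm_ring_1^'g::finite^'g" and X :: "'a^'n^'g"
  shows "block A B C D ** stack X Y = stack (A ** X + B ** Y) (C ** X + D ** Y)"
  by (simp add: vec_eq_iff forall_Plus) (simp add: matrix_matrix_mult_def sum_UNIV_Plus)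

lemma matrix_mult_stack:
  fixes M :: "'a::comm_ring_1^('g::finite + 'g)^('g + 'g)" and X :: "'a^'n^'g"
  shows "M ** stack X Y = stack (blockA M ** X + blockB M ** Y) (blockC M ** X + blockD M ** Y)"
  by (subst block_collapse[symmetric, of M]) (rule block_mult_stack)

lemma stack_mult:
  fixes X :: "'a::comm_ring_1^'n::finite^'g::finite" and Z :: "'a^'k^'n"
  shows "stack X Y ** Z = stack (X ** Z) (Y ** Z)"
  by (simp add: vec_eq_iff forall_Plus matrix_matrix_mult_def)

lemma mat_mult_stack:
  fixes X :: "'a::comm_ring_1^'n::finite^'g::finite"
  shows "mat l ** stack X Y = stack (mat l ** X) (mat l ** Y)"
  by (simp add: vec_eq_iff forall_Plus)

lemma mat_mult_block:
  fixes A :: "'a::comm_ring_1^'g::finite^'g"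
  shows "mat l ** block A B C D = block (mat l ** A) (mat l ** B) (mat l ** C) (mat l ** D)"
  by (simp add: vec_eq_iff forall_Plus)

lemma transpose_block:
  "transpose (block A B C D) = block (transpose A) (transpose C) (transpose B) (transpose D)"
  by (simp add: vec_eq_iff forall_Plus transpose_def)

lemma transpose_stack_mult_stack:
  fixes X :: "'a::comm_ring_1^'n::finite^'g::finite"
  shows "transpose (stack X Y) ** stack Z W = transpose X ** Z + transpose Y ** W"
  by (simp add: vec_eq_iff matrix_matrix_mult_def transpose_def sum_UNIV_Plus)

lemma mat_block: "mat c = block (mat c) 0 0 (mat c)"
  by (simp add: vec_eq_iff forall_Plus mat_def)

lemma transpose_zero: "transpose 0 = 0"
  and transpose_uminus: "transpose (- A) = - transpose (A :: 'a::ab_group_add^'n^'m)"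
  by (simp_all add: vec_eq_iff transpose_def)

lemma map_matrix_nth [simp]: "map_matrix f A $ i $ j = f (A $ i $ j)"
  by (simp add: map_matrix_def)

lemma map_matrix_block:
  "map_matrix f (block A B C D) = block (map_matrix f A) (map_matrix f B) (map_matrix f C) (map_matrix f D)"
  by (simp add: vec_eq_iff forall_Plus)

lemma map_matrix_stack: "map_matrix f (stack X Y) = stack (map_matrix f X) (map_matrix f Y)"
  by (simp add: vec_eq_iff forall_Plus)

lemma sign_mat_nth: "sign_mat P $ i $ j = (if i = j then (if i \<in> P then 1 else - 1) else 0)"
  by (simp add: sign_mat_def)

lemma sign_mat_square: "sign_mat P ** sign_mat P = (mat 1 :: 'a::comm_ring_1^'g::finite^'g)"
  by (simp add: vec_eq_iff matrix_matrix_mult_def sign_mat_nth mat_def if_distrib[of "\<lambda>x. x * _"] cong: if_cong)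

lemma transpose_sign_mat: "transpose (sign_mat P) = sign_mat P"
  by (auto simp: vec_eq_iff transpose_def sign_mat_nth)

lemma sympl_form_mult_stack:
  fixes X :: "'a::comm_ring_1^'n::finite^'g::finite"
  shows "sympl_form ** stack X Y = stack Y (- X)"
  by (simp add: sympl_form_def block_mult_stack matrix_uminus_mult)

lemma sympl_form_square:
  "sympl_form ** sympl_form = (- mat 1 :: 'a::comm_ring_1^('g::finite + 'g)^('g + 'g))"
proof -
  have "sympl_form ** sympl_form = block (- mat 1) 0 0 (- mat 1 :: 'a^'g^'g)"
    by (simp add: sympl_form_def block_mult matrix_uminus_mult)
  also have "\<dots> = mat (- 1)"
    unfolding mat_block[of "- 1 :: 'a"] by (simp add: mat_arith)
  finally show ?thesis by (simp add: mat_arith)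
qed

text \<open>The multiplier is an argument of its own, because the whole proof consists in comparing multipliers.\<close>

definition similitude :: "'a::comm_ring_1^('g::finite + 'g)^('g + 'g) \<Rightarrow> 'a \<Rightarrow> bool" where
  "similitude M l \<longleftrightarrow> M ** sympl_form ** transpose M = mat l ** sympl_form"

lemma GSp_iff: "M \<in> GSp \<longleftrightarrow> (\<exists>l. l dvd 1 \<and> similitude M l)"
  by (simp add: GSp_def similitude_def)

lemma similitude_mult:
  assumes "similitude M l" "similitude N m"
  shows "similitude (M ** N) (l * m)"
proof -
  have "(M ** N) ** sympl_form ** transpose (M ** N)
      = M ** (N ** sympl_form ** transpose N) ** transpose M"
    by (simp add: matrix_transpose_mul matrix_mul_assoc)
  also have "\<dots> = mat m ** (M ** sympl_form ** transpose M)"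
    using assms(2) by (simp add: similitude_def mat_mult_assoc)
  also have "\<dots> = mat (l * m) ** sympl_form"
    using assms(1) by (simp add: similitude_def mat_mult_mat mult.commute)
  finally show ?thesis by (simp add: similitude_def)
qed

lemma sympl_form_nth: "sympl_form $ Inl i $ Inr i = 1"
  by (simp add: sympl_form_def mat_def)

lemma similitude_unique: "similitude M l \<Longrightarrow> similitude M m \<Longrightarrow> l = m"
  unfolding similitude_def by (metis mat_mult_nth mult_1_right sympl_form_nth)

lemma similitude_one: "similitude (mat 1) 1"
  by (simp add: similitude_def mat_mult_mat)

lemma similitude_diag: "similitude (block (mat 1) 0 0 (mat c)) c"
  unfolding similitude_def sympl_form_def transpose_block
  by (simp add: block_mult mat_mult_block matrix_uminus_mult mat_mult_mat_mat mat_arith transpose_zero)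

text \<open>A homomorphism between the rings formed by two whole types. It serves for the embeddings of the
  rationals into the finite adeles and of the rationals and the reals into the complex numbers, for complex
  conjugation, and for the evaluation and the composition of polynomials.\<close>

definition ring_hom_type :: "('a::comm_ring_1 \<Rightarrow> 'b::comm_ring_1) \<Rightarrow> bool" where
  "ring_hom_type f \<longleftrightarrow> f 1 = 1 \<and> (\<forall>x y. f (x + y) = f x + f y) \<and> (\<forall>x y. f (x * y) = f x * f y)"

lemma ring_hom_typeD:
  assumes "ring_hom_type f"
  shows "f 0 = 0" "f 1 = 1" "f (x + y) = f x + f y" "f (x * y) = f x * f y" "f (- x) = - f x"
    "f (sum h A) = (\<Sum>i\<in>A. f (h i))" "f (prod h A) = (\<Prod>i\<in>A. f (h i))"
proof -
  note add = assms[unfolded ring_hom_type_def, THEN conjunct2, THEN conjunct1, rule_format]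
  show 0: "f 0 = 0" using add[of 0 0] by simp
  show "f (- x) = - f x" using add[of x "- x"] 0 by (simp add: eq_neg_iff_add_eq_0 add.commute)
  show "f (sum h A) = (\<Sum>i\<in>A. f (h i))"
    by (induction A rule: infinite_finite_induct) (use 0 add in auto)
  show "f (prod h A) = (\<Prod>i\<in>A. f (h i))"
    by (induction A rule: infinite_finite_induct) (use assms in \<open>auto simp: ring_hom_type_def\<close>)
qed (use assms in \<open>auto simp: ring_hom_type_def\<close>)

lemma map_matrix_mult:
  fixes A :: "'a::comm_ring_1^'n::finite^'m" and B :: "'a^'k^'n"
  assumes "ring_hom_type f"
  shows "map_matrix f (A ** B) = map_matrix f A ** map_matrix f B"
  by (simp add: vec_eq_iff matrix_matrix_mult_def ring_hom_typeD[OF assms])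

lemma map_matrix_simps:
  assumes "ring_hom_type f"
  shows "map_matrix f (mat c) = mat (f c)" "map_matrix f (A + B) = map_matrix f A + map_matrix f B"
    "map_matrix f (- A) = - map_matrix f A"
    "map_matrix f 0 = 0" "map_matrix f (transpose A) = transpose (map_matrix f A)"
    "map_matrix f (sign_mat P) = sign_mat P" "map_matrix f sympl_form = sympl_form"
  by (auto simp: vec_eq_iff transpose_def sign_mat_nth mat_def ring_hom_typeD[OF assms]
      sympl_form_def forall_Plus)

lemma det_map_matrix:
  fixes A :: "'a::comm_ring_1^'n::finite^'n"
  assumes "ring_hom_type f"
  shows "det (map_matrix f A) = f (det A)"
proof -
  have "f (of_int (sign q) * y) = of_int (sign q) * f y" for q :: "'n \<Rightarrow> 'n" and y
    by (cases q rule: sign_cases) (simp_all add: ring_hom_typeD[OF assms])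
  thus ?thesis
    by (simp add: det_def ring_hom_typeD(6)[OF assms] ring_hom_typeD(7)[OF assms, symmetric])
qed

lemma similitude_map_matrix:
  assumes "ring_hom_type f" "similitude M l"
  shows "similitude (map_matrix f M) (f l)"
proof -
  have "map_matrix f (M ** sympl_form ** transpose M) = map_matrix f (mat l ** sympl_form)"
    using assms(2) by (simp add: similitude_def)
  thus ?thesis
    by (simp add: similitude_def map_matrix_mult[OF assms(1)] map_matrix_simps[OF assms(1)])
qed

lemma matrix_add_distrib:
  fixes A B :: "'a::comm_ring_1^'n::finite^'m" and C D :: "'a^'k^'n"
  shows "(A + B) ** C = A ** C + B ** C" "A ** (C + D) = A ** C + A ** D"
    "(A - B) ** C = A ** C - B ** C" "A ** (C - D) = A ** C - A ** D"
  by (simp_all add: vec_eq_iff matrix_matrix_mult_def algebra_simps sum.distrib sum_subtractf)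

text \<open>With \<open>\<Omega>\<close> the symplectic form and \<open>\<alpha>\<close> the embedding, each of the four blocks of
  \<open>\<alpha> \<Omega> \<alpha>\<^sup>t = l \<Omega>\<close> is, up to factors \<open>E\<close>, \<open>D\<close> and \<open>-1\<close>, one of the two equations of the
  unitary group.\<close>

lemma similitude_unitary_embed:
  fixes h k :: "'a::comm_ring_1^'g::finite^'g"
  assumes "h ** sign_mat P ** transpose h + mat (of_nat D) ** (k ** sign_mat P ** transpose k)
      = mat l ** sign_mat P"
    and "k ** sign_mat P ** transpose h - h ** sign_mat P ** transpose k = 0"
  shows "similitude (unitary_embed D P (h, k)) l"
proof -
  define E :: "'a^'g^'g" where "E = sign_mat P"
  note assoc = matrix_mul_assoc[symmetric] mat_mult_assoc
  have EE: "E ** E = mat 1" "E ** (E ** A) = A" for A :: "'a^'g^'g"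
    by (simp_all add: E_def sign_mat_square matrix_mul_assoc mat_mult_mat)
  have tr: "transpose E = E" by (simp add: E_def transpose_sign_mat)
  have com: "k ** (E ** (transpose h ** A)) = h ** (E ** (transpose k ** A))" for A
    using arg_cong[OF assms(2), of "\<lambda>M. M ** A"] by (simp add: E_def assoc matrix_add_distrib)
  have com1: "k ** (E ** transpose h) = h ** (E ** transpose k)"
    using assms(2) by (simp add: E_def assoc)
  have mult: "h ** (E ** transpose h) + mat (of_nat D) ** (k ** (E ** transpose k)) = mat l ** E"
    using assms(1) by (simp add: E_def assoc)
  have 12: "h ** (E ** (transpose h ** E)) + mat (of_nat D) ** (k ** (E ** (transpose k ** E))) = mat l"
    using arg_cong[OF mult, of "\<lambda>M. M ** E"] by (simp add: assoc matrix_add_distrib EE)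
  have 21: "E ** (h ** (E ** transpose h)) + mat (of_nat D) ** (E ** (k ** (E ** transpose k))) = mat l"
    using arg_cong[OF mult, of "\<lambda>M. E ** M"] by (simp add: assoc matrix_add_distrib EE)
  note simps = matrix_uminus_mult matrix_transpose_mul transpose_mat tr assoc transpose_uminus
  have "- (k ** E) ** transpose h + h ** transpose (k ** E) = 0"
    by (simp add: simps com1)
  moreover have "- (k ** E) ** transpose (- (mat (of_nat D) ** E ** k))
      + h ** transpose (E ** h ** E) = mat l"
    by (simp add: simps mat_mult_mat(2) flip: 12)
  moreover have "- (E ** h ** E) ** transpose h
      + - (mat (of_nat D) ** E ** k) ** transpose (k ** E) = - mat l"
    by (simp add: simps flip: 21)
  moreover have "- (E ** h ** E) ** transpose (- (mat (of_nat D) ** E ** k))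
      + - (mat (of_nat D) ** E ** k) ** transpose (E ** h ** E) = 0"
    by (simp add: simps mat_mult_mat(2) com)
  ultimately show ?thesis
    unfolding similitude_def unitary_embed_def sympl_form_def E_def[symmetric]
    by (simp add: block_mult transpose_block mat_mult_block block_eq_iff matrix_uminus_mult
        mat_mult_mat_mat)
qed

lemma unitary_groupE:
  assumes "M \<in> unitary_embed D P ` GU D P"
  obtains h k l where "M = unitary_embed D P (h, k)" "l dvd 1"
    "h ** sign_mat P ** transpose h + mat (of_nat D) ** (k ** sign_mat P ** transpose k)
      = mat l ** sign_mat P" "k ** sign_mat P ** transpose h - h ** sign_mat P ** transpose k = 0"
  using assms unfolding GU_def by blast

lemma similitude_left_inverse:
  assumes "similitude M l" "M' ** M = mat 1"
  shows "mat l ** (M' ** sympl_form ** transpose M') = sympl_form"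
proof -
  have "M' ** (M ** sympl_form ** transpose M) ** transpose M'
      = (M' ** M) ** sympl_form ** transpose (M' ** M)"
    by (simp add: matrix_transpose_mul matrix_mul_assoc)
  thus ?thesis
    using assms by (simp add: similitude_def mat_mult_assoc(1)[of M'] mat_mult_assoc(2)
        transpose_mat mat_mult_mat(3))
qed

text \<open>The inverse is \<open>- l\<^bsup>-1\<^esup> \<Omega> M\<^sup>t \<Omega>\<close>. That it is also a left inverse is the equation
  \<open>M\<^sup>t \<Omega> M = l \<Omega>\<close>.\<close>

lemma similitude_inverse:
  fixes M :: "'a::field^('g::finite + 'g)^('g + 'g)"
  assumes "similitude M l" "l \<noteq> 0"
  obtains M' where "M ** M' = mat 1" "M' ** M = mat 1" "similitude M' (1 / l)"
    "transpose M ** sympl_form ** M = mat l ** sympl_form"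
proof -
  define M' where "M' = mat (- 1 / l) ** (sympl_form ** transpose M ** sympl_form)"
  have "M ** M' = mat (- 1 / l) ** (M ** sympl_form ** transpose M ** sympl_form)"
    unfolding M'_def mat_mult_assoc(1)[of M] by (simp only: matrix_mul_assoc)
  also have "\<dots> = mat (- 1) ** (sympl_form ** sympl_form)"
    using assms by (simp add: similitude_def mat_mult_assoc(2) mat_mult_mat(1))
  also have "\<dots> = mat 1"
    by (simp add: sympl_form_square matrix_uminus_mult mat_arith)
  finally have right: "M ** M' = mat 1" .
  hence left: "M' ** M = mat 1"
    by (simp add: matrix_left_right_inverse)
  have "mat (1 / l) ** sympl_form
      = mat (1 / l) ** (mat l ** (M' ** sympl_form ** transpose M'))"
    by (simp add: similitude_left_inverse[OF assms(1) left])
  hence sim: "similitude M' (1 / l)"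
    using assms(2) by (simp add: similitude_def mat_mult_mat(1,3))
  have "mat l ** sympl_form = mat l ** (sympl_form ** (M' ** M))"
    by (simp add: left)
  also have "\<dots> = mat (- 1) ** (sympl_form ** sympl_form ** (transpose M ** sympl_form ** M))"
    using assms(2) by (simp add: M'_def mat_mult_assoc(1)[of sympl_form] mat_mult_assoc(2)
        mat_mult_mat(1)) (simp only: matrix_mul_assoc)
  also have "\<dots> = transpose M ** sympl_form ** M"
    by (simp add: sympl_form_square matrix_uminus_mult mat_arith matrix_mul_assoc)
  finally have "transpose M ** sympl_form ** M = mat l ** sympl_form" ..
  with that right left sim show thesis by blast
qed

lemma GSp_field:
  fixes x :: "'a::field^('g::finite + 'g)^('g + 'g)"
  assumes "x \<in> GSp"
  obtains l where "similitude x l" "l \<noteq> 0"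
  using assms that unfolding GSp_iff by (metis dvd_0_left zero_neq_one)

lemma similitude_invertible:
  fixes x :: "'a::field^('g::finite + 'g)^('g + 'g)"
  shows "similitude x l \<Longrightarrow> l \<noteq> 0 \<Longrightarrow> invertible x"
  by (metis invertible_def similitude_inverse)

section \<open>The multiplier of a unitary similitude\<close>

lemma ring_hom_type_const_poly: "ring_hom_type (\<lambda>a. [:a:])"
  by (simp add: ring_hom_type_def one_pCons)

lemma ring_hom_type_pcompose: "ring_hom_type (\<lambda>f. pcompose f r)"
  by (simp add: ring_hom_type_def pcompose_add pcompose_mult pcompose_1)

lemma ring_hom_type_poly: "ring_hom_type (\<lambda>f. poly f x)"
  by (simp add: ring_hom_type_def)

lemma poly_even_odd_parts:
  fixes f :: "'a::comm_ring_1 poly"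
  obtains u v where "f = pcompose u [:0, 0, 1:] + [:0, 1:] * pcompose v [:0, 0, 1:]"
proof -
  have "\<exists>u v. f = pcompose u [:0, 0, 1:] + [:0, 1:] * pcompose v [:0, 0, 1:]"
  proof (induction f)
    case 0
    show ?case by (rule exI[of _ 0], rule exI[of _ 0]) simp
  next
    case (pCons a f)
    then obtain u v where uv: "f = pcompose u [:0, 0, 1:] + [:0, 1:] * pcompose v [:0, 0, 1:]"
      by blast
    have "pCons a f = [:a:] + [:0, 1:] * f" by simp
    also have "\<dots> = pcompose (pCons a v) [:0, 0, 1:] + [:0, 1:] * pcompose u [:0, 0, 1:]"
      by (subst uv) (simp add: pcompose_pCons algebra_simps)
    finally show ?case by blast
  qed
  thus thesis using that by blast
qed

lemma pcompose_square_eq_0: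
  fixes f :: "'a::comm_ring_1 poly"
  assumes "pcompose f [:0, 0, 1:] = 0"
  shows "f = 0"
  using assms by (induction f) (simp_all add: pcompose_pCons)

lemma det_mat: "det (mat l :: 'a::comm_ring_1^'n::finite^'n) = l ^ CARD('n)"
  by (subst det_diagonal) (simp_all add: mat_def)

lemma det_sign_mat_square: "det (sign_mat P) * det (sign_mat P) = (1 :: 'a::comm_ring_1)"
  by (simp add: det_mul[symmetric] sign_mat_square det_I)

text \<open>The determinant of \<open>(h + k sqrt(-D)) E (h - k sqrt(-D))\<^sup>t = l E\<close> says that \<open>l\<^sup>g\<close> is
  the product of \<open>det (h + k sqrt(-D))\<close> and its conjugate. As the ring need not contain a root of \<open>-D\<close>,
  the determinants are computed over the polynomial ring, with the variable \<open>X\<close> for the root: the product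
  of \<open>det (h + k X)\<close> and \<open>det (h - k X)\<close> is a polynomial in \<open>X\<^sup>2\<close>, and into this polynomial \<open>-D\<close> is
  substituted.\<close>

lemma unitary_multiplier_norm:
  fixes h k :: "'a::comm_ring_1^'g::finite^'g"
  assumes "h ** sign_mat P ** transpose h + mat (of_nat D) ** (k ** sign_mat P ** transpose k)
      = mat l ** sign_mat P"
    and "k ** sign_mat P ** transpose h - h ** sign_mat P ** transpose k = 0"
  shows "\<exists>u v. l ^ CARD('g) = u * u + of_nat D * (v * v)"
proof -
  define C :: "'a^'g^'g \<Rightarrow> 'a poly^'g^'g" where "C = map_matrix (\<lambda>a. [:a:])"
  have C_diff: "C (A - B) = C A - C B" for A B
    by (simp add: C_def vec_eq_iff)
  have C_mult: "C (A ** B) = C A ** C B" for A B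
    by (simp add: C_def map_matrix_mult[OF ring_hom_type_const_poly])
  have C_E: "C (sign_mat P) = sign_mat P"
    by (simp add: C_def map_matrix_simps[OF ring_hom_type_const_poly])
  define X X2 :: "'a poly" where "X = [:0, 1:]" and "X2 = [:0, 0, 1:]"
  define S :: "'a^'g^'g" where "S = k ** sign_mat P ** transpose k"
  define W where "W = C (mat l ** sign_mat P) - mat (X + [:of_nat D:]) ** C S"
  let ?E = "sign_mat P :: 'a poly^'g^'g"
  let ?e = "det (sign_mat P :: 'a^'g^'g)"
  obtain u v where uv: "det (C h + mat X ** C k) = pcompose u X2 + X * pcompose v X2"
    unfolding X_def X2_def using poly_even_odd_parts by blast
  \<comment> \<open>Conjugation is the substitution of \<open>- X\<close> for \<open>X\<close>.\<close>
  have X2_neg: "pcompose X2 [:0, - 1:] = X2" and X_neg: "pcompose X [:0, - 1:] = - X"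
    and X_sq: "X * X = X2" and X_X2: "pcompose X X2 = X2"
    by (simp_all add: X_def X2_def pcompose_pCons)
  have conj_det: "det (C h - mat X ** C k) = pcompose u X2 - X * pcompose v X2"
  proof -
    have const: "map_matrix (\<lambda>f. pcompose f r) (C A) = C A" for A r
      by (simp add: C_def vec_eq_iff)
    have "C h - mat X ** C k = map_matrix (\<lambda>f. pcompose f [:0, - 1:]) (C h + mat X ** C k)"
      by (simp add: map_matrix_simps[OF ring_hom_type_pcompose]
          map_matrix_mult[OF ring_hom_type_pcompose] const X_neg mat_arith matrix_uminus_mult)
    thus ?thesis
      by (simp add: det_map_matrix[OF ring_hom_type_pcompose] uv pcompose_add pcompose_mult X_neg
          pcompose_assoc[symmetric] X2_neg)
  qed
  have "(C h + mat X ** C k) ** ?E ** transpose (C h - mat X ** C k)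
      = C (h ** sign_mat P ** transpose h) + mat X ** C (k ** sign_mat P ** transpose h - h ** sign_mat P ** transpose k)
        - mat X2 ** C S"
  proof -
    have tr: "transpose (C h - mat X ** C k) = C (transpose h) - mat X ** C (transpose k)"
      by (simp add: vec_eq_iff transpose_def C_def)
    have XX: "A ** (mat X ** B) = mat X ** (A ** B)" "mat X ** (mat X ** B) = mat X2 ** B"
      "(mat X ** A) ** B = mat X ** (A ** B)"
      for A B :: "'a poly^'g^'g"
      by (fact mat_mult_assoc(1), simp only: mat_mult_mat(1) X_sq, fact mat_mult_assoc(2))
    have "(A + mat X ** B) ** ?E ** (A' - mat X ** B')
        = A ** ?E ** A' + mat X ** (B ** ?E ** A' - A ** ?E ** B') - mat X2 ** (B ** ?E ** B')"
      for A B A' B' :: "'a poly^'g^'g"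
      by (simp add: matrix_add_distrib matrix_mul_assoc[symmetric] XX(3))
        (simp add: XX(1)[of A] XX(1)[of B] XX(1)[of ?E] XX(2) matrix_add_distrib)
    thus ?thesis
      unfolding tr S_def C_diff C_mult C_E .
  qed
  also have "\<dots> = C (mat l ** sign_mat P) - mat (X2 + [:of_nat D:]) ** C S"
    unfolding assms(2) assms(1)[symmetric] S_def[symmetric]
    by (simp add: C_def vec_eq_iff X2_def algebra_simps)
  also have "\<dots> = map_matrix (\<lambda>f. pcompose f X2) W"
    by (simp add: W_def C_def vec_eq_iff pcompose_diff pcompose_smult pcompose_add X_X2)
  finally have "det ((C h + mat X ** C k) ** ?E ** transpose (C h - mat X ** C k))
      = pcompose (det W) X2"
    by (simp add: det_map_matrix[OF ring_hom_type_pcompose])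
  hence "det (C h + mat X ** C k) * det ?E * det (C h - mat X ** C k) = pcompose (det W) X2"
    by (simp add: det_mul det_transpose)
  moreover have "det ?E = [:?e:]"
    using det_map_matrix[OF ring_hom_type_const_poly, of "sign_mat P :: 'a^'g^'g"]
    by (simp add: map_matrix_simps[OF ring_hom_type_const_poly])
  ultimately have "pcompose ([:?e:] * (u * u - X * (v * v))) X2 = pcompose (det W) X2"
    unfolding uv conj_det
    by (simp add: pcompose_mult pcompose_diff pcompose_smult X_X2[folded X_sq] X_sq[symmetric] algebra_simps)
  hence "pcompose ([:?e:] * (u * u - X * (v * v)) - det W) X2 = 0"
    by (simp only: pcompose_diff diff_self)
  hence eq: "[:?e:] * (u * u - X * (v * v)) = det W"
    unfolding X2_def eq_iff_diff_eq_0[of _ "det W"] by (rule pcompose_square_eq_0)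
  have "map_matrix (\<lambda>f. poly f (- of_nat D)) W = mat l ** sign_mat P"
    by (simp add: W_def C_def X_def vec_eq_iff)
  hence "poly (det W) (- of_nat D) = l ^ CARD('g) * ?e"
    by (simp add: det_map_matrix[OF ring_hom_type_poly, symmetric] det_mul det_mat)
  hence "?e * (poly u (- of_nat D) * poly u (- of_nat D)
      + of_nat D * (poly v (- of_nat D) * poly v (- of_nat D))) = l ^ CARD('g) * ?e"
    by (simp add: eq[symmetric] X_def algebra_simps)
  from arg_cong[OF this, of "\<lambda>x. ?e * x"]
  have "?e * ?e * (poly u (- of_nat D) * poly u (- of_nat D)
      + of_nat D * (poly v (- of_nat D) * poly v (- of_nat D))) = ?e * ?e * l ^ CARD('g)"
    by (simp only: mult.assoc mult.commute mult.left_commute)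
  hence "l ^ CARD('g) = poly u (- of_nat D) * poly u (- of_nat D)
      + of_nat D * (poly v (- of_nat D) * poly v (- of_nat D))"
    unfolding det_sign_mat_square by simp
  thus ?thesis
    by blast
qed

section \<open>Valuations of rational numbers\<close>

text \<open>The value at \<open>0\<close> is the default \<open>0\<close>; the infinite valuation of \<open>0\<close> is treated as a case of its own.\<close>

definition rat_val :: "nat \<Rightarrow> rat \<Rightarrow> int" where
  "rat_val p x = int (multiplicity (int p) (fst (quotient_of x)))
     - int (multiplicity (int p) (snd (quotient_of x)))"

text \<open>The fraction need not be in lowest terms.\<close>

lemma rat_val_quotient:
  assumes "prime p" "a \<noteq> 0" "b \<noteq> 0" "x * of_int b = of_int a"
  shows "rat_val p x = int (multiplicity (int p) a) - int (multiplicity (int p) b)"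
proof -
  obtain n d where nd: "quotient_of x = (n, d)" by force
  have d: "d > 0" and x: "x = of_int n / of_int d"
    using quotient_of_denom_pos[OF nd] quotient_of_div[OF nd] by auto
  have "of_int (n * b) = (of_int (a * d) :: rat)"
    using assms(4) d by (simp add: x field_simps)
  hence eq: "n * b = a * d" by (simp only: of_int_eq_iff)
  hence "n \<noteq> 0" using assms d by auto
  have "prime_elem (int p)" using assms(1) by auto
  hence "multiplicity (int p) n + multiplicity (int p) b = multiplicity (int p) a + multiplicity (int p) d"
    using eq assms d \<open>n \<noteq> 0\<close> by (metis less_irrefl prime_elem_multiplicity_mult_distrib)
  thus ?thesis by (simp add: rat_val_def nd)
qed

lemma rat_quotientE:
  fixes x :: rat
  obtains a b :: int where "b \<noteq> 0" "x * of_int b = of_int a" "x \<noteq> 0 \<longrightarrow> a \<noteq> 0"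
proof -
  obtain n d where nd: "quotient_of x = (n, d)" by force
  have "d > 0" "x = of_int n / of_int d"
    using quotient_of_denom_pos[OF nd] quotient_of_div[OF nd] by auto
  thus thesis by (intro that[of d n]) auto
qed

lemma rat_val_mult:
  assumes "prime p" "x \<noteq> 0" "y \<noteq> 0"
  shows "rat_val p (x * y) = rat_val p x + rat_val p y"
proof -
  obtain a b where ab: "b \<noteq> 0" "x * of_int b = of_int a" "a \<noteq> 0"
    using assms(2) by (metis rat_quotientE)
  obtain c d where cd: "d \<noteq> 0" "y * of_int d = of_int c" "c \<noteq> 0"
    using assms(3) by (metis rat_quotientE)
  have "(x * y) * of_int (b * d) = (x * of_int b) * (y * of_int d)" by simp
  hence "(x * y) * of_int (b * d) = of_int (a * c)" using ab cd by simp
  moreover have "prime_elem (int p)" using assms(1) by auto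
  ultimately show ?thesis
    using ab cd assms(1)
    by (simp add: rat_val_quotient[of p "a * c" "b * d"] rat_val_quotient[of p a b]
        rat_val_quotient[of p c d] prime_elem_multiplicity_mult_distrib)
qed

lemma rat_val_of_int:
  assumes "prime p" "a \<noteq> 0"
  shows "rat_val p (of_int a) = int (multiplicity (int p) a)"
  using assms rat_val_quotient[of p a 1 "of_int a"] by simp

lemma rat_val_1: "prime p \<Longrightarrow> rat_val p 1 = 0"
  using rat_val_of_int[of p 1] by simp

lemma rat_val_uminus: "prime p \<Longrightarrow> rat_val p (- x) = rat_val p x"
  by (simp add: rat_val_def rat_uminus_code split: prod.split)
    (metis abs_minus_cancel multiplicity_normalize_right normalize_int_def)

lemma rat_val_prime: "prime p \<Longrightarrow> rat_val p (of_nat p) = 1"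
  using rat_val_of_int[of p "int p"] by (auto simp: prime_gt_0_nat prime_nat_iff)

lemma rat_val_divide:
  assumes "prime p" "x \<noteq> 0" "y \<noteq> 0"
  shows "rat_val p (x / y) = rat_val p x - rat_val p y"
  using rat_val_mult[of p "x / y" y] assms by simp

lemma rat_val_power: "prime p \<Longrightarrow> x \<noteq> 0 \<Longrightarrow> rat_val p (x ^ n) = int n * rat_val p x"
  by (induction n) (simp_all add: rat_val_1 rat_val_mult algebra_simps)

lemma padic_small_iff_rat_val:
  assumes "prime p"
  shows "padic_small p m x \<longleftrightarrow> x = 0 \<or> int m \<le> rat_val p x"
proof (cases "x = 0")
  case True
  thus ?thesis using assms by simp
next
  case False
  have pe: "prime_elem (int p)" and p0: "p > 0" using assms prime_gt_0_nat by auto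
  show ?thesis
  proof
    assume "padic_small p m x"
    then obtain a b :: int where ab: "\<not> int p dvd b" "x * of_int b = of_int (int p ^ m * a)"
      unfolding padic_small_def by blast
    have "b \<noteq> 0" "int p ^ m * a \<noteq> 0" using ab False p0 by auto
    hence "rat_val p x = int (multiplicity (int p) (int p ^ m * a)) - int (multiplicity (int p) b)"
      using assms ab \<open>b \<noteq> 0\<close> \<open>int p ^ m * a \<noteq> 0\<close>
      by (intro rat_val_quotient)
    also have "multiplicity (int p) b = 0" using ab by (simp add: not_dvd_imp_multiplicity_0)
    also have "multiplicity (int p) (int p ^ m * a) = m + multiplicity (int p) a"
      using pe \<open>int p ^ m * a \<noteq> 0\<close> by (simp add: prime_elem_multiplicity_mult_distrib multiplicity_same_power)
    finally show "x = 0 \<or> int m \<le> rat_val p x" by simp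
  next
    assume "x = 0 \<or> int m \<le> rat_val p x"
    hence le: "int m \<le> rat_val p x" using False by simp
    obtain a b where ab: "b \<noteq> 0" "x * of_int b = of_int a" "a \<noteq> 0"
      using False by (metis rat_quotientE)
    let ?i = "multiplicity (int p) a" and ?j = "multiplicity (int p) b"
    obtain a' where a': "a = int p ^ ?i * a'"
      using multiplicity_dvd by blast
    obtain b' where b': "b = int p ^ ?j * b'" "\<not> int p dvd b'"
      using multiplicity_decompose'[of b "int p"] ab(1) pe by (metis prime_elem_not_unit)
    have ij: "m + ?j \<le> ?i"
      using le rat_val_quotient[OF assms ab(3,1,2)] by simp
    have "x * of_int (int p ^ ?j * b') = of_int (int p ^ ?i * a')"
      using ab(2) a' b'(1) by metis
    also have "int p ^ ?i = int p ^ ?j * (int p ^ m * int p ^ (?i - ?j - m))"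
      using ij by (simp add: power_add[symmetric])
    finally have "of_int p ^ ?j * (x * of_int b') = of_int p ^ ?j * of_int (int p ^ m * (int p ^ (?i - ?j - m) * a'))"
      by (simp add: algebra_simps)
    hence "x * of_int b' = of_int (int p ^ m * (int p ^ (?i - ?j - m) * a'))"
      using assms by (simp add: prime_gt_0_nat)
    thus "padic_small p m x"
      unfolding padic_small_def using b'(2) by blast
  qed
qed

text \<open>The case of the ultrametric inequality in which it is an equality.\<close>

lemma rat_val_add:
  assumes "prime p" "x \<noteq> 0" "y = 0 \<or> rat_val p x < rat_val p y"
  shows "x + y \<noteq> 0" "rat_val p (x + y) = rat_val p x"
proof -
  have "padic_small p 1 (y / x)"
    using assms by (cases "y = 0") (simp_all add: padic_small_iff_rat_val rat_val_divide)
  then obtain a b :: int where ab: "\<not> int p dvd b" "y / x * of_int b = of_int (int p ^ 1 * a)"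
    unfolding padic_small_def by blast
  have nd: "\<not> int p dvd b + int p * a" using ab(1) by (simp add: dvd_add_left_iff)
  have ne: "b + int p * a \<noteq> 0" "b \<noteq> 0" using nd ab(1) by auto
  have eq: "(1 + y / x) * of_int b = of_int (b + int p * a)"
    using ab(2) by (simp add: distrib_right)
  have "rat_val p (1 + y / x) = 0"
    using rat_val_quotient[OF assms(1) ne eq] nd ab(1) by (simp add: not_dvd_imp_multiplicity_0)
  moreover have ne1: "1 + y / x \<noteq> 0"
  proof
    assume "1 + y / x = 0"
    with eq have "of_int (b + int p * a) = (0 :: rat)" by simp
    thus False using ne(1) by (simp only: of_int_eq_0_iff)
  qed
  moreover have "x + y = x * (1 + y / x)" using assms(2) by (simp add: field_simps)
  ultimately show "x + y \<noteq> 0" "rat_val p (x + y) = rat_val p x"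
    using assms(1,2) by (simp_all add: rat_val_mult)
qed

section \<open>Norms from an imaginary quadratic field\<close>

definition sqrt_neg :: "nat \<Rightarrow> complex" where
  "sqrt_neg D = csqrt (- of_nat D)"

lemma sqrt_neg_eq: "sqrt_neg D = \<i> * of_real (sqrt (of_nat D))"
  using csqrt_of_real_nonpos[of "- of_nat D"] by (simp add: sqrt_neg_def)

lemma sqrt_neg_square: "sqrt_neg D * sqrt_neg D = - of_nat D"
  unfolding sqrt_neg_def power2_eq_square[symmetric] by (rule power2_csqrt)

lemma cnj_sqrt_neg: "cnj (sqrt_neg D) = - sqrt_neg D"
  by (simp add: sqrt_neg_eq)

lemma imag_quad_fieldE:
  assumes "z \<in> imag_quad_field D"
  obtains a b where "z = of_rat a + of_rat b * sqrt_neg D"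
  using assms by (auto simp: imag_quad_field_def sqrt_neg_def)

lemma imag_quad_fieldI: "of_rat a + of_rat b * sqrt_neg D \<in> imag_quad_field D"
  by (auto simp: imag_quad_field_def sqrt_neg_def)

lemma cnj_of_rat [simp]: "cnj (of_rat a) = of_rat a"
  by (cases a) (simp add: of_rat_rat)

lemma imag_quad_field_of_rat: "of_rat a \<in> imag_quad_field D"
  using imag_quad_fieldI[of a 0 D] by simp

lemma imag_quad_field_0: "0 \<in> imag_quad_field D"
  and imag_quad_field_1: "1 \<in> imag_quad_field D"
  using imag_quad_field_of_rat[of 0 D] imag_quad_field_of_rat[of 1 D] by simp_all

lemma imag_quad_field_sqrt_neg: "sqrt_neg D \<in> imag_quad_field D"
  using imag_quad_fieldI[of 0 1 D] by simp

lemma imag_quad_field_add: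
  assumes "x \<in> imag_quad_field D" "y \<in> imag_quad_field D"
  shows "x + y \<in> imag_quad_field D"
proof -
  obtain a b c d where xy: "x = of_rat a + of_rat b * sqrt_neg D" "y = of_rat c + of_rat d * sqrt_neg D"
    using assms imag_quad_fieldE by metis
  have "x + y = of_rat (a + c) + of_rat (b + d) * sqrt_neg D"
    by (simp add: xy of_rat_add algebra_simps)
  thus ?thesis by (metis imag_quad_fieldI)
qed

lemma imag_quad_field_mult:
  assumes "x \<in> imag_quad_field D" "y \<in> imag_quad_field D"
  shows "x * y \<in> imag_quad_field D"
proof -
  obtain a b c d where xy: "x = of_rat a + of_rat b * sqrt_neg D" "y = of_rat c + of_rat d * sqrt_neg D"
    using assms imag_quad_fieldE by metis
  have "x * y = of_rat a * of_rat c + of_rat b * of_rat d * (sqrt_neg D * sqrt_neg D)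
      + (of_rat a * of_rat d + of_rat b * of_rat c) * sqrt_neg D"
    by (simp add: xy algebra_simps)
  also have "\<dots> = of_rat (a * c - of_nat D * (b * d)) + of_rat (a * d + b * c) * sqrt_neg D"
    unfolding sqrt_neg_square by (simp add: of_rat_add of_rat_diff of_rat_mult algebra_simps)
  finally show ?thesis by (metis imag_quad_fieldI)
qed

lemma imag_quad_field_cnj:
  assumes "x \<in> imag_quad_field D"
  shows "cnj x \<in> imag_quad_field D"
proof -
  obtain a b where x: "x = of_rat a + of_rat b * sqrt_neg D"
    using assms imag_quad_fieldE by metis
  have "cnj x = of_rat a + of_rat (- b) * sqrt_neg D"
    by (simp add: x cnj_sqrt_neg of_rat_minus)
  thus ?thesis by (metis imag_quad_fieldI)
qed

lemma imag_quad_field_uminus: "x \<in> imag_quad_field D \<Longrightarrow> - x \<in> imag_quad_field D"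
  using imag_quad_field_mult[of "of_rat (- 1)" D x] imag_quad_field_of_rat[of "- 1" D]
  by (simp add: of_rat_minus)

lemma imag_quad_field_norm:
  "(of_rat a + of_rat b * sqrt_neg D) * cnj (of_rat a + of_rat b * sqrt_neg D)
    = of_rat (a * a + of_nat D * (b * b))"
proof -
  have "(of_rat a + of_rat b * sqrt_neg D) * cnj (of_rat a + of_rat b * sqrt_neg D)
      = of_rat a * of_rat a - of_rat b * of_rat b * (sqrt_neg D * sqrt_neg D)"
    by (simp add: cnj_sqrt_neg algebra_simps)
  also have "\<dots> = of_rat (a * a + of_nat D * (b * b))"
    unfolding sqrt_neg_square by (simp add: of_rat_add of_rat_mult)
  finally show ?thesis .
qed

lemma imag_quad_field_inverse:
  assumes "x \<in> imag_quad_field D"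
  shows "inverse x \<in> imag_quad_field D"
proof (cases "x = 0")
  case False
  obtain a b where x: "x = of_rat a + of_rat b * sqrt_neg D"
    using assms imag_quad_fieldE by metis
  let ?n = "a * a + of_nat D * (b * b)"
  have n: "x * cnj x = of_rat ?n"
    unfolding x by (rule imag_quad_field_norm)
  hence "?n \<noteq> 0" using False by auto
  hence "x * (cnj x * of_rat (inverse ?n)) = 1"
    using n by (simp flip: mult.assoc of_rat_mult)
  hence "inverse x = cnj x * of_rat (inverse ?n)"
    by (rule inverse_unique)
  thus ?thesis
    using assms by (metis imag_quad_field_cnj imag_quad_field_mult imag_quad_field_of_rat)
qed (simp add: imag_quad_field_0)

lemma imag_quad_field_sum: "(\<And>i. i \<in> A \<Longrightarrow> f i \<in> imag_quad_field D) \<Longrightarrow> sum f A \<in> imag_quad_field D"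
  by (induction A rule: infinite_finite_induct) (auto intro: imag_quad_field_0 imag_quad_field_add)

lemma imag_quad_field_prod: "(\<And>i. i \<in> A \<Longrightarrow> f i \<in> imag_quad_field D) \<Longrightarrow> prod f A \<in> imag_quad_field D"
  by (induction A rule: infinite_finite_induct) (auto intro: imag_quad_field_1 imag_quad_field_mult)

text \<open>If \<open>w\<close> is the denominator of \<open>q\<close>, then \<open>w ^ k\<close> divides \<open>c\<close> for every \<open>k\<close>.\<close>

lemma bounded_denominator_powers_Ints:
  fixes q :: rat
  assumes "c \<noteq> 0" "\<And>k. of_int c * q ^ k \<in> \<int>"
  shows "q \<in> \<int>"
proof -
  obtain u w where uw: "quotient_of q = (u, w)" by force
  have w: "w > 0" "coprime u w" "q = of_int u / of_int w"
    using quotient_of_denom_pos[OF uw] quotient_of_coprime[OF uw] quotient_of_div[OF uw] by auto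
  have "w = 1"
  proof (rule ccontr)
    assume "w \<noteq> 1"
    define k where "k = nat \<bar>c\<bar>"
    obtain m where "of_int c * q ^ k = of_int m"
      using assms(2) by (metis Ints_cases)
    hence "of_int (c * u ^ k) = (of_int (m * w ^ k) :: rat)"
      using w by (simp add: field_simps power_divide)
    hence "w ^ k dvd c * u ^ k"
      by (simp only: of_int_eq_iff) simp
    moreover have "coprime (w ^ k) (u ^ k)" using w(2) by (simp add: coprime_commute)
    ultimately have "w ^ k dvd c" by (simp add: coprime_dvd_mult_left_iff)
    hence "w ^ k \<le> \<bar>c\<bar>" using assms(1) w(1) dvd_imp_le_int[of c "w ^ k"] by simp
    moreover have "(2 :: int) ^ k \<le> w ^ k" using w(1) \<open>w \<noteq> 1\<close> by (intro power_mono) auto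
    moreover have "int k < 2 ^ k" by (metis of_nat_less_two_power)
    ultimately show False by (simp add: k_def)
  qed
  thus ?thesis by (simp add: w(3))
qed

text \<open>The order generated by the root of \<open>-D\<close>; it may be smaller than the ring of integers.\<close>

definition quad_order :: "nat \<Rightarrow> complex set" where
  "quad_order D = {of_int u + of_int v * sqrt_neg D | u v. True}"

lemma quad_orderI: "of_int u + of_int v * sqrt_neg D \<in> quad_order D"
  by (auto simp: quad_order_def)

lemma quad_order_of_int: "of_int u \<in> quad_order D"
  using quad_orderI[of u 0 D] by simp

lemma quad_order_add: "x \<in> quad_order D \<Longrightarrow> y \<in> quad_order D \<Longrightarrow> x + y \<in> quad_order D"
proof -
  assume "x \<in> quad_order D" "y \<in> quad_order D"
  then obtain a b c d where xy: "x = of_int a + of_int b * sqrt_neg D" "y = of_int c + of_int d * sqrt_neg D"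
    by (auto simp: quad_order_def)
  have "x + y = of_int (a + c) + of_int (b + d) * sqrt_neg D"
    by (simp add: xy algebra_simps)
  thus ?thesis by (metis quad_orderI)
qed

lemma quad_order_mult:
  assumes "x \<in> quad_order D" "y \<in> quad_order D"
  shows "x * y \<in> quad_order D"
proof -
  obtain a b c d where xy: "x = of_int a + of_int b * sqrt_neg D" "y = of_int c + of_int d * sqrt_neg D"
    using assms by (auto simp: quad_order_def)
  have "x * y = of_int a * of_int c + of_int b * of_int d * (sqrt_neg D * sqrt_neg D)
      + (of_int a * of_int d + of_int b * of_int c) * sqrt_neg D"
    by (simp add: xy algebra_simps)
  also have "\<dots> = of_int (a * c - int D * (b * d)) + of_int (a * d + b * c) * sqrt_neg D"
    unfolding sqrt_neg_square by (simp add: algebra_simps)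
  finally show ?thesis by (metis quad_orderI)
qed

lemma quad_order_power: "x \<in> quad_order D \<Longrightarrow> x ^ n \<in> quad_order D"
  by (induction n) (use quad_order_of_int[of 1 D] in \<open>auto intro: quad_order_mult\<close>)

lemma quad_order_sum: "(\<And>i. i \<in> A \<Longrightarrow> f i \<in> quad_order D) \<Longrightarrow> sum f A \<in> quad_order D"
  by (induction A rule: infinite_finite_induct)
    (use quad_order_of_int[of 0 D] in \<open>auto intro: quad_order_add\<close>)

text \<open>All powers of an algebraic integer \<open>y\<close> are integral combinations of the first few, so they lie in
  a lattice \<open>C\<^bsup>-n\<^esup> \<int>[sqrt(-D)]\<close> with a fixed denominator. Hence the powers of the norm of \<open>y\<close>
  have a bounded denominator as well.\<close>

lemma algebraic_int_norm:
  assumes "algebraic_int (of_rat a + of_rat b * sqrt_neg D)"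
  shows "a * a + of_nat D * (b * b) \<in> \<int>"
proof -
  define y where "y = of_rat a + of_rat b * sqrt_neg D"
  obtain f :: "int poly" where f: "poly (map_poly of_int f) y = 0" "lead_coeff f = 1"
    using assms unfolding algebraic_int_altdef_ipoly y_def by blast
  let ?n = "degree f"
  obtain m c where mc: "c \<noteq> 0" "a * of_int c = of_int m" by (metis rat_quotientE)
  obtain n d where nd: "d \<noteq> 0" "b * of_int d = of_int n" by (metis rat_quotientE)
  define C where "C = c * d"
  have C: "C \<noteq> 0" using mc nd by (simp add: C_def)
  have "of_rat (a * of_int C) = (of_int (m * d) :: complex)" "of_rat (b * of_int C) = (of_int (n * c) :: complex)"
    using mc(2) nd(2) by (simp_all add: C_def mult.assoc[symmetric])
      (metis of_int_mult of_rat_of_int_eq mult.commute mult.left_commute)+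
  hence "of_int C * y = of_int (m * d) + of_int (n * c) * sqrt_neg D"
    by (simp add: y_def of_rat_mult algebra_simps)
  hence Cy: "of_int C * y \<in> quad_order D" by (metis quad_orderI)
  have yn: "y ^ ?n = (\<Sum>i<?n. of_int (- coeff f i) * y ^ i)"
  proof -
    have "0 = (\<Sum>i\<le>?n. of_int (coeff f i) * y ^ i)"
      using f(1) by (simp add: poly_altdef degree_map_poly coeff_map_poly)
    also have "\<dots> = (\<Sum>i<?n. of_int (coeff f i) * y ^ i) + y ^ ?n"
      using f(2) by (simp add: lessThan_Suc_atMost[symmetric])
    finally show ?thesis by (simp add: sum_negf eq_neg_iff_add_eq_0 add.commute)
  qed
  have order: "of_int (C ^ ?n) * y ^ k \<in> quad_order D" for k
  proof (induction k rule: less_induct)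
    case (less k)
    show ?case
    proof (cases "k < ?n")
      case True
      hence "of_int (C ^ ?n) * y ^ k = of_int (C ^ (?n - k)) * (of_int C * y) ^ k"
        by (simp add: power_mult_distrib mult.assoc[symmetric] power_add[symmetric])
      thus ?thesis
        by (metis Cy quad_order_mult quad_order_of_int quad_order_power)
    next
      case False
      hence "y ^ k = y ^ (k - ?n) * y ^ ?n" by (simp add: power_add[symmetric])
      also have "\<dots> = (\<Sum>i<?n. of_int (- coeff f i) * y ^ (k - ?n + i))"
        unfolding yn sum_distrib_left by (simp add: power_add algebra_simps)
      finally have "of_int (C ^ ?n) * y ^ k
          = (\<Sum>i<?n. of_int (- coeff f i) * (of_int (C ^ ?n) * y ^ (k - ?n + i)))"
        by (simp add: sum_distrib_left algebra_simps)
      also have "\<dots> \<in> quad_order D"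
        using False by (intro quad_order_sum quad_order_mult quad_order_of_int less.IH) auto
      finally show ?thesis .
    qed
  qed
  show ?thesis
  proof (rule bounded_denominator_powers_Ints)
    show "C ^ ?n * C ^ ?n \<noteq> 0" using C by simp
  next
    fix k
    let ?q = "a * a + of_nat D * (b * b)"
    obtain u v where uv: "of_int (C ^ ?n) * y ^ k = of_int u + of_int v * sqrt_neg D"
      using order[of k] by (auto simp: quad_order_def)
    have "of_rat (of_int (C ^ ?n * C ^ ?n) * ?q ^ k)
        = of_int (C ^ ?n * C ^ ?n) * (y * cnj y) ^ k"
      unfolding y_def imag_quad_field_norm by (simp add: of_rat_mult of_rat_power)
    also have "\<dots> = (of_int (C ^ ?n) * y ^ k) * cnj (of_int (C ^ ?n) * y ^ k)"
      by (simp add: power_mult_distrib algebra_simps)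
    also have "\<dots> = of_rat (of_int (u * u + int D * (v * v)))"
      unfolding uv using imag_quad_field_norm[of "of_int u" "of_int v" D] by simp
    finally show "of_int (C ^ ?n * C ^ ?n) * ?q ^ k \<in> \<int>"
      unfolding of_rat_eq_iff by (metis Ints_of_int)
  qed
qed

text \<open>Descent: if \<open>p\<close> divides \<open>x cnj(x)\<close>, then it divides \<open>x\<close> or \<open>cnj(x)\<close>, because it generates
  a prime ideal; it then divides both, and dividing \<open>x\<close> by \<open>p\<close> removes the factor \<open>p\<^sup>2\<close> from the norm.\<close>

lemma ring_of_integers_norm_even:
  assumes "inert_prime D p"
  shows "x \<in> carrier (ring_of_integers D) \<Longrightarrow> x \<noteq> 0 \<Longrightarrow> x * cnj x = of_nat n \<Longrightarrow> even (rat_val p (of_nat n))"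
proof (induction n arbitrary: x rule: less_induct)
  case (less n)
  let ?R = "ring_of_integers D"
  have p: "prime p" and PI: "primeideal (PIdl\<^bsub>?R\<^esub> (of_nat p)) ?R"
    using assms by (auto simp: inert_prime_def)
  have n: "n > 0" using less.prems by (cases n) auto
  show ?case
  proof (cases "p dvd n")
    case False
    thus ?thesis
      using rat_val_of_int[OF p, of "int n"] n by (simp add: not_dvd_imp_multiplicity_0)
  next
    case True
    then obtain k where k: "n = p * k" by blast
    have cnjR: "cnj z \<in> carrier ?R" if "z \<in> carrier ?R" for z
      using that by (auto simp: ring_of_integers_def imag_quad_field_cnj)
    have "of_nat k \<in> carrier ?R"
      using imag_quad_field_of_rat[of "of_nat k" D] by (auto simp: ring_of_integers_def)
    hence "x \<otimes>\<^bsub>?R\<^esub> cnj x \<in> PIdl\<^bsub>?R\<^esub> (of_nat p)"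
      using less.prems(3) k by (auto simp: cgenideal_def ring_of_integers_def)
    hence "x \<in> PIdl\<^bsub>?R\<^esub> (of_nat p) \<or> cnj x \<in> PIdl\<^bsub>?R\<^esub> (of_nat p)"
      using PI less.prems(1) cnjR primeideal.I_prime by metis
    then obtain z where z: "z \<in> carrier ?R" "x = z * of_nat p \<or> cnj x = z * of_nat p"
      by (auto simp: cgenideal_def ring_of_integers_def)
    obtain y where y: "y \<in> carrier ?R" "x = y * of_nat p"
    proof (cases "x = z * of_nat p")
      case False
      hence "cnj x = z * of_nat p" using z(2) by blast
      hence "x = cnj z * of_nat p" by (metis complex_cnj_cnj complex_cnj_mult complex_cnj_of_nat)
      thus thesis using that cnjR z(1) by blast
    qed (use that z in blast)
    have alg: "algebraic_int y" and "y \<in> imag_quad_field D"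
      using y(1) by (auto simp: ring_of_integers_def)
    then obtain a b where ab: "y = of_rat a + of_rat b * sqrt_neg D"
      using imag_quad_fieldE by metis
    obtain m where "a * a + of_nat D * (b * b) = of_int m"
      using algebraic_int_norm[OF alg[unfolded ab]] by (elim Ints_cases)
    hence m: "y * cnj y = of_int m"
      unfolding ab imag_quad_field_norm by simp
    have "of_nat n = (y * cnj y) * (of_nat p * of_nat p)"
      unfolding less.prems(3)[symmetric] y(2) by simp
    hence "of_int (int n) = (of_int (int p * int p * m) :: complex)"
      by (simp add: m)
    hence nm: "int n = int p * int p * m" by (simp only: of_int_eq_iff)
    hence "m > 0" using n by (metis of_nat_0_less_iff of_nat_mult zero_less_mult_pos mult_eq_0_iff
          of_nat_0_eq_iff less_irrefl gr0I)
    define k' where "k' = nat m"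
    have mk: "m = int k'" and "k' > 0"
      using \<open>m > 0\<close> by (simp_all add: k'_def)
    have "int n = int (p * p * k')"
      using nm mk by simp
    hence nk: "n = p * p * k'" by (simp only: of_nat_eq_iff)
    have "p > 1" using p by (rule prime_gt_1_nat)
    hence "p * p > 1" by (metis less_1_mult)
    hence "k' < n" using nk \<open>k' > 0\<close> by simp
    hence "even (rat_val p (of_nat k'))"
      using less.IH[of k' y] y(1) m mk less.prems(2) y(2) by auto
    moreover have "rat_val p (of_nat n) = 2 + rat_val p (of_nat k')"
      using p \<open>k' > 0\<close> \<open>p > 1\<close> by (simp add: nk rat_val_mult rat_val_prime)
    ultimately show ?thesis by simp
  qed
qed

text \<open>Clearing denominators multiplies the norm by a square.\<close>

lemma inert_norm_val_even:
  assumes "inert_prime D p" "a * a + of_nat D * (b * b) \<noteq> (0 :: rat)"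
  shows "even (rat_val p (a * a + of_nat D * (b * b)))"
proof -
  have p: "prime p" using assms(1) by (simp add: inert_prime_def)
  obtain m c where mc: "c \<noteq> 0" "a * of_int c = of_int m" by (metis rat_quotientE)
  obtain n d where nd: "d \<noteq> 0" "b * of_int d = of_int n" by (metis rat_quotientE)
  define x where "x = of_rat (of_int (m * d)) + of_rat (of_int (n * c)) * sqrt_neg D"
  define k where "k = (m * d) * (m * d) + int D * ((n * c) * (n * c))"
  let ?q = "a * a + of_nat D * (b * b)"
  have k: "of_int k = ?q * (of_int (c * d) * of_int (c * d))"
    by (simp add: k_def mc(2)[symmetric] nd(2)[symmetric] algebra_simps)
  hence "k \<noteq> 0" using assms(2) mc nd by auto
  moreover have "k \<ge> 0" by (simp add: k_def)
  ultimately have "k > 0" by simp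
  have "of_rat (of_int k) = x * cnj x"
    unfolding x_def imag_quad_field_norm by (simp add: k_def)
  hence xk: "x * cnj x = of_nat (nat k)" using \<open>k \<ge> 0\<close> by simp
  have "algebraic_int x"
    unfolding algebraic_int_altdef_ipoly
  proof (intro exI[of _ "[:k, - 2 * (m * d), 1:]"] conjI)
    have "poly (map_poly of_int [:k, - 2 * (m * d), 1:]) x
        = of_int k - 2 * of_int (m * d) * x + x * x"
      by (simp add: map_poly_pCons algebra_simps)
    also have "\<dots> = of_int k - of_int (m * d) * of_int (m * d)
        + of_int (n * c) * of_int (n * c) * (sqrt_neg D * sqrt_neg D)"
      unfolding x_def of_rat_of_int_eq by (simp add: algebra_simps)
    also have "\<dots> = 0"
      unfolding sqrt_neg_square k_def by (simp add: algebra_simps)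
    finally show "poly (map_poly of_int [:k, - 2 * (m * d), 1:]) x = 0" .
  qed simp
  hence "x \<in> carrier (ring_of_integers D)"
    using imag_quad_fieldI[of "of_int (m * d)" "of_int (n * c)" D]
    by (auto simp: ring_of_integers_def x_def simp flip: of_int_mult)
  moreover have "x \<noteq> 0" using xk \<open>k > 0\<close> by auto
  ultimately have "even (rat_val p (of_nat (nat k)))"
    using ring_of_integers_norm_even[OF assms(1) _ _ xk] by blast
  hence "even (rat_val p (of_int k))"
    using \<open>k > 0\<close> by simp
  moreover have "rat_val p (of_int k) = rat_val p ?q + 2 * rat_val p (of_int (c * d))"
    unfolding k using p assms(2) mc nd by (simp add: rat_val_mult)
  ultimately show ?thesis by simp
qed

section \<open>Valuations of finite adeles\<close>

lemma ring_hom_type_adele_of_rat: "ring_hom_type adele_of_rat"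
  unfolding ring_hom_type_def
  by (simp add: one_adele_def adele_of_rat_def plus_adele.abs_eq times_adele.abs_eq adele_rel_refl
      adelic_const)

lemma adele_of_nat: "of_nat n = adele_of_rat (of_nat n)"
  by (induction n) (simp_all add: ring_hom_typeD[OF ring_hom_type_adele_of_rat])

lemma adele_abs_eq_iff:
  assumes "adelic X" "adelic Y"
  shows "abs_adele X = abs_adele Y \<longleftrightarrow> adele_rel X Y"
  using Quotient_rel[OF Quotient_adele, of X Y] assms adele_rel_refl by blast

text \<open>A relation and not a function: adeles whose component at \<open>p\<close> vanishes have no valuation. The
  valuations along a representing sequence become constant in all other cases.\<close>

definition adele_val :: "nat \<Rightarrow> adele \<Rightarrow> int \<Rightarrow> bool" where
  "adele_val p a n \<longleftrightarrow> (\<exists>X. adelic X \<and> a = abs_adele X \<and>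
     (\<exists>M. \<forall>i\<ge>M. X p i \<noteq> 0 \<and> rat_val p (X p i) = n))"

text \<open>Two representatives differ by a null sequence, which is eventually smaller than the limit.\<close>

lemma adele_val_rep:
  assumes "prime p" "adele_val p (abs_adele Y) n" "adelic Y"
  shows "\<exists>M. \<forall>i\<ge>M. Y p i \<noteq> 0 \<and> rat_val p (Y p i) = n"
proof -
  obtain X M where X: "adelic X" "abs_adele Y = abs_adele X"
    and M: "\<And>i. i \<ge> M \<Longrightarrow> X p i \<noteq> 0 \<and> rat_val p (X p i) = n"
    using assms(2) unfolding adele_val_def by metis
  have "adele_rel Y X" using X assms(3) adele_abs_eq_iff by blast
  hence "padic_null p (\<lambda>i. Y p i - X p i)"
    using assms(1) by (simp add: adele_rel_def)
  then obtain M' where M': "\<And>i. i \<ge> M' \<Longrightarrow> padic_small p (nat \<bar>n\<bar> + 1) (Y p i - X p i)"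
    unfolding padic_null_def by meson
  have "Y p i \<noteq> 0 \<and> rat_val p (Y p i) = n" if "i \<ge> max M M'" for i
  proof -
    have "Y p i - X p i = 0 \<or> rat_val p (X p i) < rat_val p (Y p i - X p i)"
      using M'[of i] M[of i] that assms(1) by (simp add: padic_small_iff_rat_val) linarith
    from rat_val_add[OF assms(1) conjunct1[OF M] this] show ?thesis
      using M[of i] that by simp
  qed
  thus ?thesis by blast
qed

lemma adele_val_unique:
  assumes "prime p" "adele_val p a n" "adele_val p a m"
  shows "n = m"
proof -
  obtain X where X: "a = abs_adele X" "adelic X" by (rule adele_cases)
  obtain M M' where "\<forall>i\<ge>M. rat_val p (X p i) = n" "\<forall>i\<ge>M'. rat_val p (X p i) = m"
    using adele_val_rep[OF assms(1) _ X(2)] assms(2,3) unfolding X(1) by meson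
  thus ?thesis by (metis max.cobounded1 max.cobounded2)
qed

lemma adele_val_mult:
  assumes "prime p" "adele_val p a n" "adele_val p b m"
  shows "adele_val p (a * b) (n + m)"
proof -
  obtain X M where X: "adelic X" "a = abs_adele X"
    and M: "\<And>i. i \<ge> M \<Longrightarrow> X p i \<noteq> 0 \<and> rat_val p (X p i) = n"
    using assms(2) unfolding adele_val_def by metis
  obtain Y M' where Y: "adelic Y" "b = abs_adele Y"
    and M': "\<And>i. i \<ge> M' \<Longrightarrow> Y p i \<noteq> 0 \<and> rat_val p (Y p i) = m"
    using assms(3) unfolding adele_val_def by metis
  have "a * b = abs_adele (\<lambda>q i. X q i * Y q i)"
    by (simp add: X Y times_adele.abs_eq adele_rel_refl)
  moreover have "\<forall>i\<ge>max M M'. X p i * Y p i \<noteq> 0 \<and> rat_val p (X p i * Y p i) = n + m"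
    using M M' assms(1) by (simp add: rat_val_mult)
  ultimately show ?thesis
    unfolding adele_val_def using adelic_mult[OF X(1) Y(1)] by blast
qed

lemma adele_val_of_rat:
  assumes "x \<noteq> 0"
  shows "adele_val p (adele_of_rat x) (rat_val p x)"
  unfolding adele_val_def
  by (rule exI[of _ "\<lambda>q i. x"]) (use assms in \<open>simp add: adele_of_rat_def adelic_const\<close>)

lemma adele_val_power:
  assumes "prime p" "adele_val p a n"
  shows "adele_val p (a ^ k) (int k * n)"
proof (induction k)
  case 0
  show ?case
    using adele_val_of_rat[of 1 p] assms(1)
    by (simp add: ring_hom_typeD[OF ring_hom_type_adele_of_rat] rat_val_1)
next
  case (Suc k)
  from adele_val_mult[OF assms(1,2) this] show ?case by (simp add: algebra_simps)
qed

text \<open>The representatives of the inverse have bounded denominators, so the valuations along a representative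
  \<open>X\<close> of the unit are bounded above by some \<open>c\<close>. Once the differences of \<open>X\<close> have valuation above
  \<open>c\<close>, the valuation no longer changes.\<close>

lemma adele_unit_val:
  assumes "prime p" "a dvd 1"
  obtains n where "adele_val p a n"
proof -
  obtain b where ab: "a * b = 1" using assms(2) by (metis dvdE)
  obtain X where X: "a = abs_adele X" "adelic X" by (rule adele_cases)
  obtain Y where Y: "b = abs_adele Y" "adelic Y" by (rule adele_cases)
  have "abs_adele (\<lambda>q i. X q i * Y q i) = abs_adele (\<lambda>q i. 1)"
    using ab X Y by (simp add: times_adele.abs_eq adele_rel_refl one_adele_def)
  hence "adele_rel (\<lambda>q i. X q i * Y q i) (\<lambda>q i. 1)"
    by (subst (asm) adele_abs_eq_iff) (simp_all add: X Y adelic_mult adelic_const)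
  hence "padic_null p (\<lambda>i. X p i * Y p i - 1)"
    using assms(1) by (simp add: adele_rel_def)
  then obtain M1 where M1: "\<And>i. i \<ge> M1 \<Longrightarrow> padic_small p 1 (X p i * Y p i - 1)"
    unfolding padic_null_def by meson
  have prod: "X p i \<noteq> 0 \<and> Y p i \<noteq> 0 \<and> rat_val p (X p i) + rat_val p (Y p i) = 0" if "i \<ge> M1" for i
  proof -
    have "X p i * Y p i - 1 = 0 \<or> rat_val p 1 < rat_val p (X p i * Y p i - 1)"
      using M1[OF that] assms(1) by (auto simp: padic_small_iff_rat_val rat_val_1)
    from rat_val_add[OF assms(1) one_neq_zero this]
    have *: "X p i * Y p i \<noteq> 0" "rat_val p (X p i * Y p i) = 0"
      using rat_val_1[OF assms(1)] by simp_all
    thus ?thesis using rat_val_mult[OF assms(1), of "X p i" "Y p i"] by simp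
  qed
  have cauchy: "padic_cauchy p (X p)" "padic_cauchy p (Y p)"
    using X Y assms(1) by (simp_all add: adelic_def)
  obtain c M2 where M2: "\<And>i. i \<ge> M2 \<Longrightarrow> padic_small p 0 (of_nat p ^ c * Y p i)"
    using padic_cauchy_bounded[OF assms(1) cauchy(2)] by meson
  obtain M3 where M3: "\<And>i j. i \<ge> M3 \<Longrightarrow> j \<ge> M3 \<Longrightarrow> padic_small p (c + 1) (X p i - X p j)"
    using cauchy(1) unfolding padic_cauchy_def by meson
  define M where "M = max M1 (max M2 M3)"
  have p0: "of_nat p \<noteq> (0 :: rat)" using prime_gt_0_nat[OF assms(1)] by simp
  have "rat_val p (X p i) = rat_val p (X p M)" if "i \<ge> M" for i
  proof -
    have ge: "i \<ge> M3" "M \<ge> M3" "M \<ge> M2" "M \<ge> M1" using that by (simp_all add: M_def)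
    have "0 \<le> rat_val p (of_nat p ^ c * Y p M)"
      using M2[OF ge(3)] assms(1) prod[OF ge(4)] p0 by (simp add: padic_small_iff_rat_val)
    hence "rat_val p (X p M) \<le> int c"
      using prod[OF ge(4)] p0 assms(1)
      by (simp add: rat_val_mult rat_val_power rat_val_prime)
    hence "X p i - X p M = 0 \<or> rat_val p (X p M) < rat_val p (X p i - X p M)"
      using M3[OF ge(1,2)] assms(1) by (auto simp: padic_small_iff_rat_val)
    from rat_val_add(2)[OF assms(1) _ this] prod[OF ge(4)] show ?thesis
      by simp
  qed
  moreover have "X p i \<noteq> 0" if "i \<ge> M" for i
    using prod that by (simp add: M_def)
  ultimately have "adele_val p a (rat_val p (X p M))"
    unfolding adele_val_def using X by blast
  thus thesis by (rule that)
qed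

lemma adele_integral_abs:
  assumes "adelic X"
  shows "adele_integral (abs_adele X) \<longleftrightarrow> (\<forall>q. prime q \<longrightarrow> padic_integral q (X q))"
  using adele_integral.abs_eq[OF adele_rel_refl[OF assms]] .

lemma adele_integral_add: "adele_integral a \<Longrightarrow> adele_integral b \<Longrightarrow> adele_integral (a + b)"
proof -
  assume *: "adele_integral a" "adele_integral b"
  obtain X where X: "a = abs_adele X" "adelic X" by (rule adele_cases)
  obtain Y where Y: "b = abs_adele Y" "adelic Y" by (rule adele_cases)
  show ?thesis
    using * by (simp add: X Y plus_adele.abs_eq adele_rel_refl adele_integral_abs adelic_add
        padic_integral_add)
qed

lemma adele_integral_mult: "adele_integral a \<Longrightarrow> adele_integral b \<Longrightarrow> adele_integral (a * b)"
proof -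
  assume *: "adele_integral a" "adele_integral b"
  obtain X where X: "a = abs_adele X" "adelic X" by (rule adele_cases)
  obtain Y where Y: "b = abs_adele Y" "adelic Y" by (rule adele_cases)
  show ?thesis
    using * by (simp add: X Y times_adele.abs_eq adele_rel_refl adele_integral_abs adelic_mult
        padic_integral_mult)
qed

lemma adele_integral_of_int: "adele_integral (adele_of_rat (of_int n))"
proof -
  have "padic_small q 0 (of_int n)" if "prime q" for q
    unfolding padic_small_def using that
    by (intro exI[of _ n] exI[of _ 1]) (auto simp: prime_nat_iff)
  thus ?thesis
    by (simp add: adele_of_rat_def adele_integral_abs adelic_const padic_integral_def)
qed

lemma adele_integral_sum: "(\<And>i. i \<in> A \<Longrightarrow> adele_integral (f i)) \<Longrightarrow> adele_integral (sum f A)"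
  by (induction A rule: infinite_finite_induct)
    (use adele_integral_of_int[of 0] in
      \<open>auto simp: ring_hom_typeD[OF ring_hom_type_adele_of_rat] intro: adele_integral_add\<close>)

lemma adele_val_integral:
  assumes "prime p" "adele_integral a" "adele_val p a n"
  shows "n \<ge> 0"
proof -
  obtain X M where X: "adelic X" "a = abs_adele X"
    and M: "\<And>i. i \<ge> M \<Longrightarrow> X p i \<noteq> 0 \<and> rat_val p (X p i) = n"
    using assms(3) unfolding adele_val_def by metis
  have "padic_integral p (X p)"
    using assms(1,2) X by (simp add: adele_integral_abs)
  then obtain M' where "\<And>i. i \<ge> M' \<Longrightarrow> padic_small p 0 (X p i)"
    unfolding padic_integral_def by blast
  from this[of "max M M'"] show ?thesis
    using M[of "max M M'"] assms(1) by (simp add: padic_small_iff_rat_val)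
qed

lemma adele_integral_unit_val:
  assumes "prime p" "adele_integral a" "adele_integral b" "a * b = 1"
  shows "adele_val p a 0"
proof -
  obtain n where n: "adele_val p a n"
    using adele_unit_val[OF assms(1)] assms(4) by (metis dvd_triv_left)
  obtain m where m: "adele_val p b m"
    using adele_unit_val[OF assms(1)] assms(4) by (metis dvd_triv_right)
  have "adele_val p 1 (n + m)"
    using adele_val_mult[OF assms(1) n m] assms(4) by simp
  moreover have "adele_val p 1 0"
    using adele_val_of_rat[of 1 p] assms(1)
    by (simp add: ring_hom_typeD[OF ring_hom_type_adele_of_rat] rat_val_1)
  ultimately have "n + m = 0" using adele_val_unique[OF assms(1)] by blast
  moreover have "n \<ge> 0" "m \<ge> 0"
    by (rule adele_val_integral[OF assms(1,2) n], rule adele_val_integral[OF assms(1,3) m])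
  ultimately have "n = 0" by linarith
  thus ?thesis using n by simp
qed

lemma adele_norm_val_even:
  assumes "inert_prime D p" "adele_val p (u * u + of_nat D * (v * v)) n"
  shows "even n"
proof -
  have p: "prime p" using assms(1) by (simp add: inert_prime_def)
  obtain X where X: "u = abs_adele X" "adelic X" by (rule adele_cases)
  obtain Y where Y: "v = abs_adele Y" "adelic Y" by (rule adele_cases)
  let ?Z = "\<lambda>q i. X q i * X q i + of_nat D * (Y q i * Y q i)"
  have "u * u + of_nat D * (v * v) = abs_adele ?Z"
    by (simp add: X Y adele_of_nat adele_of_rat_def plus_adele.abs_eq times_adele.abs_eq
        adele_rel_refl adelic_mult adelic_add adelic_const)
  moreover have "adelic ?Z"
    by (intro adelic_add adelic_mult X Y adelic_const)
  ultimately obtain M where "?Z p M \<noteq> 0" "rat_val p (?Z p M) = n"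
    using adele_val_rep[OF p, of ?Z n] assms(2) by auto
  thus ?thesis using inert_norm_val_even[OF assms(1)] by metis
qed

text \<open>The power of the multiplier with exponent \<open>g\<close> is a norm, and \<open>g\<close> is odd.\<close>

lemma unitary_multiplier_val_even:
  fixes P :: "'g::finite set"
  assumes "inert_prime D p" "odd CARD('g)" "M \<in> unitary_embed D P ` GU D P"
  obtains l n where "similitude M l" "adele_val p l n" "even n"
proof -
  have p: "prime p" using assms(1) by (simp add: inert_prime_def)
  obtain h k l where M: "M = unitary_embed D P (h, k)" and l: "l dvd 1"
    and eqs: "h ** sign_mat P ** transpose h + mat (of_nat D) ** (k ** sign_mat P ** transpose k)
        = mat l ** sign_mat P" "k ** sign_mat P ** transpose h - h ** sign_mat P ** transpose k = 0"
    using assms(3) by (rule unitary_groupE)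
  obtain n where n: "adele_val p l n"
    using adele_unit_val[OF p l] .
  obtain u v where "l ^ CARD('g) = u * u + of_nat D * (v * v)"
    using unitary_multiplier_norm[OF eqs] by blast
  hence "even (int CARD('g) * n)"
    using adele_norm_val_even[OF assms(1)] adele_val_power[OF p n] by metis
  hence "even n" using assms(2) by simp
  with that n similitude_unitary_embed[OF eqs] show thesis unfolding M by blast
qed

text \<open>The multiplier and its inverse are entries of \<open>u \<Omega> u\<^sup>t\<close> and of the corresponding product for the
  inverse of \<open>u\<close>, so both are integral.\<close>

lemma level_group_multiplier:
  assumes "prime p" "u \<in> level_group N"
  obtains l where "similitude u l" "adele_val p l 0"
proof -
  obtain l where l: "similitude u l"
    using assms(2) by (auto simp: level_group_def GSp_iff)
  obtain u' where u': "u' ** u = mat 1" "\<And>i j. adele_integral (u' $ i $ j)"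
    using assms(2) by (auto simp: level_group_def)
  have u: "\<And>i j. adele_integral (u $ i $ j)"
    using assms(2) by (auto simp: level_group_def)
  have minus1: "adele_integral (- 1)"
    using adele_integral_of_int[of "- 1"] by (simp add: ring_hom_typeD[OF ring_hom_type_adele_of_rat])
  have const: "adele_integral 0" "adele_integral 1"
    using adele_integral_of_int[of 0] adele_integral_of_int[of 1]
    by (simp_all add: ring_hom_typeD[OF ring_hom_type_adele_of_rat])
  have form: "adele_integral (sympl_form $ i $ j)" for i j :: "'a + 'a"
    using const minus1 by (cases i; cases j) (auto simp: sympl_form_def mat_def)
  have mult: "adele_integral ((A ** sympl_form ** transpose A) $ i $ j)"
    if "\<And>i j. adele_integral (A $ i $ j)" for A :: "adele^('a + 'a)^('a + 'a)" and i j
    using that form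
    by (auto simp: matrix_matrix_mult_def transpose_def intro!: adele_integral_sum adele_integral_mult)
  fix x :: 'a
  have "l * (u' ** sympl_form ** transpose u') $ Inl x $ Inr x = 1"
    using arg_cong[OF similitude_left_inverse[OF l u'(1)], of "\<lambda>A. A $ Inl x $ Inr x"]
    by (simp add: sympl_form_nth)
  moreover have "l = (u ** sympl_form ** transpose u) $ Inl x $ Inr x"
    using l by (simp add: similitude_def sympl_form_nth)
  ultimately have "adele_val p l 0"
    using adele_integral_unit_val[OF assms(1) _ mult[OF u'(2)]] mult[OF u] by metis
  with that l show thesis by blast
qed

section \<open>Hermitian forms over an imaginary quadratic field\<close>

definition quad_field_matrix :: "nat \<Rightarrow> complex^'n^'m \<Rightarrow> bool" where
  "quad_field_matrix D A \<longleftrightarrow> (\<forall>i j. A $ i $ j \<in> imag_quad_field D)"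

lemma quad_field_matrix_mult:
  "quad_field_matrix D A \<Longrightarrow> quad_field_matrix D B \<Longrightarrow> quad_field_matrix D (A ** B)"
  by (simp add: quad_field_matrix_def matrix_matrix_mult_def imag_quad_field_sum imag_quad_field_mult)

lemma quad_field_matrix_add:
  "quad_field_matrix D A \<Longrightarrow> quad_field_matrix D B \<Longrightarrow> quad_field_matrix D (A + B)"
  by (simp add: quad_field_matrix_def imag_quad_field_add)

lemma quad_field_matrix_uminus: "quad_field_matrix D A \<Longrightarrow> quad_field_matrix D (- A)"
  by (simp add: quad_field_matrix_def imag_quad_field_uminus)

lemma quad_field_matrix_mat: "c \<in> imag_quad_field D \<Longrightarrow> quad_field_matrix D (mat c)"
  by (simp add: quad_field_matrix_def mat_def imag_quad_field_0)

lemma quad_field_matrix_sign_mat: "quad_field_matrix D (sign_mat P)"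
  using imag_quad_field_uminus[OF imag_quad_field_1]
  by (simp add: quad_field_matrix_def sign_mat_nth imag_quad_field_0 imag_quad_field_1)

lemma quad_field_matrix_of_rat: "quad_field_matrix D (map_matrix of_rat A)"
  by (simp add: quad_field_matrix_def imag_quad_field_of_rat)

lemma quad_field_matrix_stack:
  "quad_field_matrix D (stack X Y) \<longleftrightarrow> quad_field_matrix D X \<and> quad_field_matrix D Y"
  by (simp add: quad_field_matrix_def forall_Plus)

lemma det_quad_field_matrix:
  assumes "quad_field_matrix D A"
  shows "det A \<in> imag_quad_field D"
proof -
  have "of_int n \<in> imag_quad_field D" for n
    using imag_quad_field_of_rat[of "of_int n" D] by simp
  thus ?thesis
    unfolding det_def using assms
    by (intro imag_quad_field_sum imag_quad_field_mult imag_quad_field_prod)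
      (simp_all add: quad_field_matrix_def)
qed

text \<open>By Cramer's rule the entries of the inverse are quotients of determinants over the field.\<close>

lemma quad_field_matrix_right_inverse:
  fixes A :: "complex^'n::finite^'n"
  assumes "quad_field_matrix D A" "det A \<noteq> 0"
  obtains B where "quad_field_matrix D B" "A ** B = mat 1"
proof -
  define C :: "'n \<Rightarrow> 'n \<Rightarrow> complex^'n^'n" where
    "C = (\<lambda>l k. \<chi> i j. if j = k then axis l 1 $ i else A $ i $ j)"
  define B :: "complex^'n^'n" where "B = (\<chi> k l. det (C l k) / det A)"
  have "quad_field_matrix D (C l k)" for l k
    using assms(1)
    by (simp add: quad_field_matrix_def C_def axis_def imag_quad_field_0 imag_quad_field_1)
  hence "det (C l k) / det A \<in> imag_quad_field D" for l k
    using assms(1) by (simp add: divide_inverse imag_quad_field_mult imag_quad_field_inverse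
        det_quad_field_matrix)
  hence "quad_field_matrix D B"
    by (simp add: quad_field_matrix_def B_def)
  moreover have "A ** B = mat 1"
  proof -
    have "A *v (\<chi> k. B $ k $ l) = axis l 1" for l
      using cramer[OF assms(2), of "\<chi> k. B $ k $ l" "axis l 1"] by (simp add: B_def C_def)
    hence "(A ** B) $ i $ l = axis l 1 $ i" for i l
      by (metis (no_types, lifting) matrix_matrix_mult_def matrix_vector_mult_def vec_lambda_beta
          sum.cong)
    thus ?thesis by (simp add: vec_eq_iff mat_def axis_def)
  qed
  ultimately show thesis by (rule that)
qed

text \<open>The columns of \<open>1 + e\<close> and \<open>1 - e\<close> are eigenvectors of \<open>e\<close> with entries in the field, and they span
  the space because the two matrices add up to twice the identity. A basis chosen among them gives the columns of
  \<open>Q\<close>.\<close>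

lemma involution_eigenbasis:
  fixes e :: "complex^'n::finite^'n"
  assumes "quad_field_matrix D e" "e ** e = mat 1"
  obtains Q S where "quad_field_matrix D Q" "det Q \<noteq> 0" "e ** Q = Q ** sign_mat S"
proof -
  define V where "V = columns (mat 1 + e) \<union> columns (mat 1 - e)"
  have V_span: "vec.span V = UNIV"
  proof -
    have "axis k 1 \<in> vec.span V" for k
    proof -
      have "column k (mat 1 + e) \<in> vec.span V" "column k (mat 1 - e) \<in> vec.span V"
        by (auto intro!: vec.span_base simp: V_def columns_def)
      hence "(1 / 2) *s (column k (mat 1 + e) + column k (mat 1 - e)) \<in> vec.span V"
        by (intro vec.span_scale vec.span_add)
      moreover have "(1 / 2) *s (column k (mat 1 + e) + column k (mat 1 - e)) = axis k 1"
        by (simp add: vec_eq_iff column_def mat_def axis_def flip: add_divide_distrib)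
      ultimately show ?thesis by simp
    qed
    hence "cart_basis \<subseteq> vec.span V" by (auto simp: cart_basis_def)
    thus ?thesis
      by (metis span_cart_basis top.extremum_uniqueI vec.span_mono vec.span_span)
  qed
  have V_eigen: "\<forall>v\<in>V. e *v v = v \<or> e *v v = - v"
  proof -
    have "e *v column k (mat 1 + e) = column k (mat 1 + e)"
      "e *v column k (mat 1 - e) = - column k (mat 1 - e)" for k
    proof -
      have col: "e *v column k M = column k (e ** M)" for M
        by (simp add: vec_eq_iff column_def matrix_vector_mult_def matrix_matrix_mult_def)
      show "e *v column k (mat 1 + e) = column k (mat 1 + e)"
        "e *v column k (mat 1 - e) = - column k (mat 1 - e)"
        unfolding col matrix_add_distrib assms(2) by (simp_all add: vec_eq_iff column_def)
    qed
    thus ?thesis by (auto simp: V_def columns_def)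
  qed
  have V_field: "v $ i \<in> imag_quad_field D" if "v \<in> V" for v i
  proof -
    have *: "quad_field_matrix D (mat 1 + e)" "quad_field_matrix D (mat 1 - e)"
      using assms(1) quad_field_matrix_add[of D "mat 1" "- e"]
      by (simp_all add: quad_field_matrix_add quad_field_matrix_uminus quad_field_matrix_mat imag_quad_field_1)
    thus ?thesis
      using that by (auto simp: V_def columns_def column_def quad_field_matrix_def)
  qed
  obtain B where B: "B \<subseteq> V" "vec.independent B" "V \<subseteq> vec.span B" "card B = vec.dim V"
    by (rule vec.basis_exists)
  have B_span: "vec.span B = UNIV"
    using B(3) V_span by (metis top.extremum_uniqueI vec.span_mono vec.span_span)
  have "card B = CARD('n)"
    unfolding B(4) using V_span by (metis vec.dim_span vec_dim_card)
  moreover have "finite B"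
    using B(2) by (rule vec.finiteI_independent)
  ultimately obtain f where f: "bij_betw f (UNIV :: 'n set) B"
    by (metis finite_class.finite_UNIV finite_same_card_bij)
  define Q :: "complex^'n^'n" where "Q = (\<chi> i j. f j $ i)"
  define S where "S = {j. e *v f j = f j}"
  have fB: "f j \<in> V" for j using f B(1) by (auto simp: bij_betw_def)
  have colQ: "column j Q = f j" for j by (simp add: Q_def column_def vec_eq_iff)
  have "columns Q = B"
    using f by (auto simp: columns_def colQ bij_betw_def)
  hence "invertible Q"
    using B_span by (metis invertible_right_inverse matrix_right_invertible_span_columns)
  hence "det Q \<noteq> 0" by (simp add: invertible_det_nz)
  moreover have "quad_field_matrix D Q"
    using V_field fB by (simp add: quad_field_matrix_def Q_def)
  moreover have "(e ** Q) $ i $ j = (Q ** sign_mat S) $ i $ j" for i j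
  proof -
    have "(e ** Q) $ i $ j = (e *v f j) $ i"
      by (simp add: Q_def matrix_vector_mult_def matrix_matrix_mult_def)
    also have "\<dots> = (if j \<in> S then 1 else - 1) * f j $ i"
      using V_eigen fB[of j] by (auto simp: S_def)
    also have "\<dots> = (Q ** sign_mat S) $ i $ j"
      by (simp add: Q_def matrix_matrix_mult_def sign_mat_nth if_distrib cong: if_cong)
    finally show ?thesis .
  qed
  ultimately show thesis using that[of Q S] by (simp add: vec_eq_iff)
qed

lemma sign_mat_mult_nth:
  fixes A :: "'a::comm_ring_1^'n::finite^'m::finite"
  shows "(sign_mat S ** A) $ i $ j = (if i \<in> S then A $ i $ j else - A $ i $ j)"
  by (simp add: matrix_matrix_mult_def sign_mat_nth if_distrib[of "\<lambda>x. x * _"] cong: if_cong)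

lemma mult_sign_mat_nth:
  fixes A :: "'a::comm_ring_1^'n::finite^'m::finite"
  shows "(A ** sign_mat S) $ i $ j = (if j \<in> S then A $ i $ j else - A $ i $ j)"
  by (simp add: matrix_matrix_mult_def sign_mat_nth if_distrib cong: if_cong)

text \<open>In block form, for the index set \<open>S\<close> and its complement, the claim is
  \<open>det (F\<^sub>1 \<oplus> - F\<^sub>2\<^sup>t) = \<plusminus> det (F\<^sub>1 \<oplus> F\<^sub>2)\<close>.\<close>

lemma det_partial_transpose:
  fixes F G :: "complex^'n::finite^'n"
  assumes mixed: "\<And>j k. (j \<in> S) \<noteq> (k \<in> S) \<Longrightarrow> F $ j $ k = 0 \<and> G $ j $ k = 0"
    and S: "\<And>j k. j \<in> S \<Longrightarrow> k \<in> S \<Longrightarrow> G $ j $ k = F $ j $ k"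
    and not_S: "\<And>j k. j \<notin> S \<Longrightarrow> k \<notin> S \<Longrightarrow> G $ j $ k = - F $ k $ j"
  shows "det G = det F \<or> det G = - det F"
proof -
  define F1 :: "complex^'n^'n" where
    "F1 = (\<chi> j k. if j \<in> S then F $ j $ k else if j = k then 1 else 0)"
  define F2 :: "complex^'n^'n" where
    "F2 = (\<chi> j k. if j \<in> S then if j = k then 1 else 0 else F $ j $ k)"
  have "F1 $ j $ k * F2 $ k $ l = (if k = (if j \<in> S then l else j) then F $ j $ l else 0)" for j k l
    using mixed[of j k] mixed[of j l] by (auto simp: F1_def F2_def)
  hence "F = F1 ** F2"
    by (simp add: vec_eq_iff matrix_matrix_mult_def)
  moreover have "F1 $ j $ k * (sign_mat S ** transpose F2) $ k $ l
      = (if k = (if j \<in> S then l else j) then G $ j $ l else 0)" for j k l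
    using mixed[of j k] mixed[of j l] mixed[of l k] S[of j l] not_S[of j l]
    by (auto simp: F1_def F2_def sign_mat_mult_nth transpose_def)
  hence "G = F1 ** (sign_mat S ** transpose F2)"
    by (simp add: vec_eq_iff matrix_matrix_mult_def[of F1])
  moreover have "det (sign_mat S :: complex^'n^'n) = 1 \<or> det (sign_mat S :: complex^'n^'n) = - 1"
    using det_sign_mat_square[of S, where ?'a = complex] by (simp add: square_eq_1_iff)
  ultimately show ?thesis by (auto simp: det_mul det_transpose)
qed

lemma transpose_sign_mat_mult_nth:
  fixes A B :: "'a::comm_ring_1^'n::finite^'n"
  shows "(transpose A ** sign_mat P ** B) $ j $ k
    = (\<Sum>i\<in>UNIV. (if i \<in> P then 1 else - 1) * (A $ i $ j * B $ i $ k))"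
  unfolding matrix_mul_assoc[symmetric]
  by (subst matrix_matrix_mult_def, rule trans[OF vec_lambda_beta[THEN fun_cong[OF arg_cong[where f = vec_nth]]]])
    (auto simp: sign_mat_mult_nth transpose_def intro!: sum.cong)

text \<open>Here \<open>e = E Z\<close> is an involution over the field, selfadjoint for the hermitian form \<open>H\<close>. Let the
  columns of \<open>Q\<close> be eigenvectors of \<open>e\<close>, and let \<open>Q'\<close> arise from \<open>Q\<close> by conjugating the columns with
  eigenvalue \<open>-1\<close>. In the basis \<open>Q\<close> the form \<open>H\<close> is block diagonal, with blocks \<open>F\<^sub>1\<close> and \<open>F\<^sub>2\<close> say. In the
  basis \<open>Q'\<close> the form \<open>E\<close> is block diagonal with blocks \<open>F\<^sub>1\<close> and \<open>- F\<^sub>2\<^sup>t\<close>; the mixed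
  entries vanish because \<open>Z = E e\<close> is symmetric. Comparing determinants, \<open>det H\<close> and \<open>det E = \<plusminus>1\<close>
  differ by a sign and a norm.\<close>

lemma hermitian_determinant_norm:
  fixes Z H :: "complex^'n::finite^'n"
  assumes Z: "quad_field_matrix D Z" "transpose Z = Z" "sign_mat P ** Z ** (sign_mat P ** Z) = mat 1"
    and H: "mat 2 ** H = Z + map_matrix cnj Z" "det H \<noteq> 0"
  obtains a b where "a \<in> imag_quad_field D" "b \<in> imag_quad_field D" "a \<noteq> 0" "b \<noteq> 0"
    "a * cnj a * det H = b * cnj b \<or> a * cnj a * det H = - (b * cnj b)"
proof -
  define E :: "complex^'n^'n" where "E = sign_mat P"
  define e where "e = E ** Z"
  have "quad_field_matrix D e" "e ** e = mat 1"
    using Z by (simp_all add: e_def E_def quad_field_matrix_mult quad_field_matrix_sign_mat)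
  then obtain Q S where Q: "quad_field_matrix D Q" "det Q \<noteq> 0" "e ** Q = Q ** sign_mat S"
    by (rule involution_eigenbasis)
  let ?c = "map_matrix cnj" and ?s = "sign_mat S :: complex^'n^'n"
  have ring: "ring_hom_type cnj" by (simp add: ring_hom_type_def)
  have Ee: "E ** e = Z"
    by (simp add: e_def E_def matrix_mul_assoc sign_mat_square mat_mult_mat)
  have ZQ: "Z ** Q = E ** Q ** ?s"
    using Q(3) by (metis Ee matrix_mul_assoc)
  define N where "N = transpose Q ** E ** Q"
  define F0 where "F0 = transpose (?c Q) ** E ** Q"
  define F where "F = transpose (?c Q) ** H ** Q"
  have E_props: "transpose E = E" "?c E = E"
    by (simp_all add: E_def transpose_sign_mat map_matrix_simps[OF ring])
  have Nsym: "transpose N = N"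
    by (simp add: N_def matrix_transpose_mul matrix_mul_assoc E_props)
  have "N ** ?s = transpose Q ** Z ** Q"
    by (simp add: N_def ZQ flip: matrix_mul_assoc)
  hence "transpose (N ** ?s) = N ** ?s"
    by (simp add: matrix_transpose_mul matrix_mul_assoc Z)
  hence Ncom: "?s ** N = N ** ?s"
    by (simp add: matrix_transpose_mul transpose_sign_mat Nsym)
  have N0: "N $ j $ k = 0" if "(j \<in> S) \<noteq> (k \<in> S)" for j k
    using arg_cong[OF Ncom, of "\<lambda>A. A $ j $ k"] that
    by (auto simp: sign_mat_mult_nth mult_sign_mat_nth split: if_splits)
  have cZ: "?c Z = transpose (?c Z)"
    using Z(2) by (metis map_matrix_simps(5)[OF ring])
  have "transpose (?c Q) ** Z ** Q = F0 ** ?s"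
    by (simp add: F0_def ZQ flip: matrix_mul_assoc)
  moreover have "transpose (?c Q) ** ?c Z ** Q = ?s ** F0"
  proof -
    have "?c Z ** ?c Q = E ** ?c Q ** ?s"
      using arg_cong[OF ZQ, of ?c]
      by (simp add: map_matrix_mult[OF ring] map_matrix_simps[OF ring] E_props)
    hence "transpose (?c Z ** ?c Q) = ?s ** (transpose (?c Q) ** E)"
      by (simp add: matrix_transpose_mul transpose_sign_mat E_props)
    hence "transpose (?c Q) ** ?c Z = ?s ** (transpose (?c Q) ** E)"
      by (simp add: matrix_transpose_mul flip: cZ)
    thus ?thesis by (simp add: F0_def matrix_mul_assoc)
  qed
  ultimately have F_eq: "mat 2 ** F = F0 ** ?s + ?s ** F0"
    by (simp add: F_def H(1) matrix_add_distrib flip: mat_mult_assoc(1)[of "transpose (?c Q)"]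
        mat_mult_assoc(2)[of 2 "transpose (?c Q) ** H"] mat_mult_assoc(2)[of 2 H])
  have F_nth: "F $ j $ k = (if (j \<in> S) = (k \<in> S) then if j \<in> S then F0 $ j $ k else - F0 $ j $ k else 0)" for j k
    using arg_cong[OF F_eq, of "\<lambda>A. A $ j $ k"]
    by (auto simp: sign_mat_mult_nth mult_sign_mat_nth split: if_splits)
  have F0_herm: "cnj (F0 $ j $ k) = F0 $ k $ j" for j k
  proof -
    have "?c (?c Q) = Q" by (simp add: vec_eq_iff)
    hence "?c F0 = transpose F0"
      by (simp add: F0_def map_matrix_mult[OF ring] map_matrix_simps[OF ring] matrix_transpose_mul
          matrix_mul_assoc E_props)
    from arg_cong[OF this, of "\<lambda>A. A $ j $ k"] show ?thesis by (simp add: transpose_def)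
  qed
  define Q' :: "complex^'n^'n" where "Q' = (\<chi> i j. if j \<in> S then Q $ i $ j else cnj (Q $ i $ j))"
  define G where "G = transpose (?c Q') ** E ** Q'"
  have nth: "G $ j $ k = (\<Sum>i\<in>UNIV. (if i \<in> P then 1 else - 1) * (cnj (Q' $ i $ j) * Q' $ i $ k))"
    "F0 $ j $ k = (\<Sum>i\<in>UNIV. (if i \<in> P then 1 else - 1) * (cnj (Q $ i $ j) * Q $ i $ k))"
    "N $ j $ k = (\<Sum>i\<in>UNIV. (if i \<in> P then 1 else - 1) * (Q $ i $ j * Q $ i $ k))" for j k
    unfolding G_def F0_def N_def E_def transpose_sign_mat_mult_nth by simp_all
  have G_nth: "G $ j $ k = (if j \<in> S then if k \<in> S then F0 $ j $ k else cnj (N $ j $ k)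
      else if k \<in> S then N $ j $ k else cnj (F0 $ j $ k))" for j k
    unfolding nth by (auto simp: Q'_def cnj_sum intro!: sum.cong)
  have "det G = det F \<or> det G = - det F"
  proof (rule det_partial_transpose)
    show "F $ j $ k = 0 \<and> G $ j $ k = 0" if "(j \<in> S) \<noteq> (k \<in> S)" for j k
      using that N0[OF that] by (auto simp: F_nth G_nth)
  qed (simp_all add: F_nth G_nth F0_herm)
  moreover have "det (?c A) = cnj (det A)" for A :: "complex^'n^'n"
    by (rule det_map_matrix[OF ring])
  moreover have "quad_field_matrix D Q'"
    using Q(1) by (simp add: Q'_def quad_field_matrix_def imag_quad_field_cnj)
  moreover have "det E = 1 \<or> det E = - 1"
    using det_sign_mat_square[of P, where ?'a = complex] by (simp add: E_def square_eq_1_iff)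
  ultimately have "det Q * cnj (det Q) * det H = det Q' * cnj (det Q')
      \<or> det Q * cnj (det Q) * det H = - (det Q' * cnj (det Q'))"
    unfolding F_def G_def by (auto simp: det_mul det_transpose algebra_simps)
  moreover from this have "det Q' \<noteq> 0" using Q(2) H(2) by auto
  ultimately show thesis
    using that[of "det Q" "det Q'"] Q(1,2) \<open>quad_field_matrix D Q'\<close> det_quad_field_matrix by blast
qed

section \<open>Periods\<close>

text \<open>On the columns of \<open>(\<tau>; 1)\<close> the group acts linearly, and the action on \<open>\<tau>\<close> by fractional linear
  transformations is the effect of renormalizing the lower block.\<close>

abbreviation period_matrix :: "complex^'g::finite^'g \<Rightarrow> complex^'g^('g + 'g)" where
  "period_matrix \<tau> \<equiv> stack \<tau> (mat 1)"

abbreviation adjoint_matrix :: "complex^'n^'m \<Rightarrow> complex^'m^'n" where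
  "adjoint_matrix A \<equiv> transpose (map_matrix cnj A)"

lemma ring_hom_type_cnj: "ring_hom_type cnj"
  and ring_hom_type_of_real: "ring_hom_type complex_of_real"
  and ring_hom_type_complex_of_rat: "ring_hom_type complex_of_rat"
  by (simp_all add: ring_hom_type_def of_rat_add of_rat_mult)

lemma adjoint_matrix_mult:
  fixes A :: "complex^'n::finite^'m" and B :: "complex^'k^'n"
  shows "adjoint_matrix (A ** B) = adjoint_matrix B ** adjoint_matrix A"
  by (simp add: map_matrix_mult[OF ring_hom_type_cnj] matrix_transpose_mul)

lemma adjoint_matrix_stack_form:
  fixes X Y :: "complex^'n::finite^'g::finite"
  shows "adjoint_matrix (stack X Y) ** (sympl_form ** stack X Y) = adjoint_matrix X ** Y - adjoint_matrix Y ** X"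
  by (simp add: sympl_form_mult_stack map_matrix_stack transpose_stack_mult_stack matrix_uminus_mult)

text \<open>This is \<open>M\<^sup>t \<Omega> M = l \<Omega>\<close>, where \<open>M\<^sup>t\<close> is also the conjugate transpose of \<open>M\<close>.\<close>

lemma adjoint_matrix_similitude_form:
  fixes M :: "complex^('g::finite + 'g)^('g + 'g)" and A :: "complex^'n::finite^('g + 'g)"
  assumes "similitude M l" "l \<noteq> 0" "map_matrix cnj M = M"
  shows "adjoint_matrix (M ** A) ** (sympl_form ** (M ** A)) = mat l ** (adjoint_matrix A ** (sympl_form ** A))"
proof -
  obtain M' where "transpose M ** sympl_form ** M = mat l ** sympl_form"
    using similitude_inverse[OF assms(1,2)] .
  hence "adjoint_matrix A ** (transpose M ** sympl_form ** M) ** A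
      = adjoint_matrix A ** (mat l ** sympl_form) ** A"
    by simp
  thus ?thesis
    unfolding adjoint_matrix_mult assms(3)
    by (simp add: mat_mult_assoc(1)[of "adjoint_matrix A"] mat_mult_assoc(2)
        flip: matrix_mul_assoc)
qed

lemma transpose_similitude_form:
  fixes M :: "complex^('g::finite + 'g)^('g + 'g)" and A :: "complex^'n::finite^('g + 'g)"
  assumes "similitude M l" "l \<noteq> 0"
  shows "transpose (M ** A) ** (sympl_form ** (M ** A)) = mat l ** (transpose A ** (sympl_form ** A))"
proof -
  obtain M' where "transpose M ** sympl_form ** M = mat l ** sympl_form"
    using similitude_inverse[OF assms] .
  hence "transpose A ** (transpose M ** sympl_form ** M) ** A
      = transpose A ** (mat l ** sympl_form) ** A"
    by simp
  thus ?thesis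
    unfolding matrix_transpose_mul
    by (simp add: mat_mult_assoc(1)[of "transpose A"] mat_mult_assoc(2) flip: matrix_mul_assoc)
qed

text \<open>The matrix \<open>block 0 (mat a) (- mat (1 / a)) 0\<close> is the complex structure with period \<open>i a\<close>: its
  eigenspace for \<open>-i\<close> is spanned by the columns of \<open>(i a; 1)\<close>. Conjugation by \<open>x\<close> moves this eigenspace by
  \<open>x\<close>. The base points of the Siegel domain (\<open>a = 1\<close>) and of the unitary domain (\<open>a = 1 / sqrt D\<close>) are
  both of this form.\<close>

lemma conjugate_period_matrix:
  fixes x :: "real^('g::finite + 'g)^('g + 'g)" and \<tau> :: "complex^'g^'g"
  assumes "invertible x" "a > 0"
    and M: "M = map_matrix complex_of_real (x ** block 0 (mat a) (- mat (1 / a)) 0 ** matrix_inv x)"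
    and eigen: "blockA M ** \<tau> + blockB M = mat (- \<i>) ** \<tau>" "blockC M ** \<tau> + blockD M = mat (- \<i>)"
  obtains Y where "invertible Y"
    "period_matrix \<tau> = map_matrix complex_of_real x ** stack (mat (\<i> * of_real a)) (mat 1) ** Y"
proof -
  let ?x = "map_matrix complex_of_real x" and ?x' = "map_matrix complex_of_real (matrix_inv x)"
  let ?J = "block 0 (mat (of_real a)) (- mat (1 / of_real a)) 0 :: complex^('g + 'g)^('g + 'g)"
  note hom = map_matrix_mult[OF ring_hom_type_of_real] map_matrix_simps[OF ring_hom_type_of_real]
  have inv: "x ** matrix_inv x = mat 1" "matrix_inv x ** x = mat 1"
    using assms(1) by (simp_all add: matrix_inv_inverse)
  hence cinv: "?x ** ?x' = mat 1" "?x' ** ?x = mat 1"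
    by (simp_all flip: hom(1) add: hom(2))
  have MJ: "M = ?x ** ?J ** ?x'"
    unfolding M hom(1) map_matrix_block by (simp add: hom)
  have ev: "M ** period_matrix \<tau> = mat (- \<i>) ** period_matrix \<tau>"
    using eigen by (simp add: matrix_mult_stack[of M] mat_mult_stack mat_mult_mat_mat)
  obtain X Y where XY: "?x' ** period_matrix \<tau> = stack X Y"
    by (metis matrix_mult_stack)
  have "?J ** (?x' ** period_matrix \<tau>) = ?x' ** (M ** period_matrix \<tau>)"
    by (simp add: MJ matrix_mul_assoc cinv mat_mult_mat)
  also have "\<dots> = mat (- \<i>) ** (?x' ** period_matrix \<tau>)"
    unfolding ev by (rule mat_mult_assoc(1))
  finally have "mat (of_real a) ** Y = mat (- \<i>) ** X"
    by (simp add: XY block_mult_stack mat_mult_stack stack_eq_iff)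
  hence "mat \<i> ** (mat (of_real a) ** Y) = mat \<i> ** (mat (- \<i>) ** X)" by simp
  hence X: "X = mat (\<i> * of_real a) ** Y"
    by (simp add: mat_mult_mat)
  have L: "period_matrix \<tau> = ?x ** stack (mat (\<i> * of_real a)) (mat 1) ** Y"
  proof -
    have "period_matrix \<tau> = ?x ** (?x' ** period_matrix \<tau>)"
      by (simp add: matrix_mul_assoc cinv mat_mult_mat)
    also have "?x' ** period_matrix \<tau> = stack (mat (\<i> * of_real a)) (mat 1) ** Y"
      by (simp add: XY X stack_mult)
    finally show ?thesis by (simp add: matrix_mul_assoc)
  qed
  obtain U W where "?x ** stack (mat (\<i> * of_real a)) (mat 1) = stack U W"
    by (metis matrix_mult_stack)
  hence "W ** Y = mat 1"
    using L by (simp add: stack_mult stack_eq_iff)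
  hence "invertible Y" by (metis invertible_left_inverse)
  from that[OF this L] show thesis .
qed

lemma period_domainE:
  assumes "\<tau> \<in> period_domain (conj_class H h)"
  obtains x M where "x \<in> H" "M = map_matrix complex_of_real (x ** h \<i> ** matrix_inv x)"
    "blockA M ** \<tau> + blockB M = mat (- \<i>) ** \<tau>" "blockC M ** \<tau> + blockD M = mat (- \<i>)"
proof -
  obtain h' where h': "h' \<in> conj_class H h"
    and eigen: "\<And>z. z \<noteq> 0 \<Longrightarrow> let M = map_matrix complex_of_real (h' z) in
      blockA M ** \<tau> + blockB M = mat (cnj z) ** \<tau> \<and> blockC M ** \<tau> + blockD M = mat (cnj z)"
    using assms unfolding period_domain_def by blast
  obtain x where "x \<in> H" "h' = (\<lambda>z. x ** h z ** matrix_inv x)"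
    using h' unfolding conj_class_def by blast
  thus thesis
    using that eigen[OF complex_i_not_zero] by (simp add: Let_def)
qed

lemma siegel_domain_period_matrix:
  fixes \<tau> :: "complex^'g::finite^'g"
  assumes "\<tau> \<in> siegel_domain"
  obtains x l Y where "similitude x l" "l \<noteq> (0::real)" "invertible Y"
    "period_matrix \<tau> = map_matrix complex_of_real x ** stack (mat \<i>) (mat 1) ** Y"
proof -
  obtain x M where x: "x \<in> GSp"
    and M: "M = map_matrix complex_of_real (x ** h_Siegel \<i> ** matrix_inv x)"
      "blockA M ** \<tau> + blockB M = mat (- \<i>) ** \<tau>" "blockC M ** \<tau> + blockD M = mat (- \<i>)"
    using assms unfolding siegel_domain_def by (rule period_domainE)
  obtain l where l: "similitude x l" "l \<noteq> 0" using x by (rule GSp_field)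
  have h: "h_Siegel \<i> = block 0 (mat 1) (- mat (1 / 1)) (0 :: real^'g^'g)"
    by (simp add: h_Siegel_def mat_arith)
  obtain Y where "invertible Y"
    "period_matrix \<tau> = map_matrix complex_of_real x ** stack (mat (\<i> * of_real 1)) (mat 1) ** Y"
    by (rule conjugate_period_matrix[OF similitude_invertible[OF l] zero_less_one M(1)[unfolded h] M(2,3)])
  with that l show thesis by simp
qed

lemma adjoint_mult_eq_0:
  fixes A :: "complex^'n::finite^'m::finite"
  assumes "adjoint_matrix A ** A = 0"
  shows "A = 0"
proof -
  have "A $ i $ j = 0" for i j
  proof -
    have "0 = (adjoint_matrix A ** A) $ j $ j" by (simp add: assms)
    also have "\<dots> = (\<Sum>k\<in>UNIV. of_real ((cmod (A $ k $ j))\<^sup>2))"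
      by (simp add: matrix_matrix_mult_def transpose_def complex_norm_square mult.commute
          del: of_real_power)
    also have "\<dots> = of_real (\<Sum>k\<in>UNIV. (cmod (A $ k $ j))\<^sup>2)" by simp
    finally have "(\<Sum>k\<in>UNIV. (cmod (A $ k $ j))\<^sup>2) = 0"
      by (metis of_real_eq_0_iff)
    thus ?thesis by (subst (asm) sum_nonneg_eq_0_iff) auto
  qed
  thus ?thesis by (simp add: vec_eq_iff)
qed

text \<open>Writing \<open>(\<tau>; 1) = x (i; 1) Y\<close> turns the form into \<open>- 2 i l (Y V)\<^sup>* (Y V)\<close>.\<close>

lemma siegel_domain_form_definite:
  fixes \<tau> :: "complex^'g::finite^'g" and V :: "complex^'n::finite^'g"
  assumes "\<tau> \<in> siegel_domain"
    and "adjoint_matrix (period_matrix \<tau> ** V) ** (sympl_form ** (period_matrix \<tau> ** V)) = 0"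
  shows "V = 0"
proof -
  obtain x l Y where x: "similitude x l" "l \<noteq> (0::real)" "invertible Y"
    and L: "period_matrix \<tau> = map_matrix complex_of_real x ** stack (mat \<i>) (mat 1) ** Y"
    using siegel_domain_period_matrix[OF assms(1)] .
  let ?x = "map_matrix complex_of_real x"
  let ?V = "Y ** V"
  have sim: "similitude ?x (of_real l)" "map_matrix cnj ?x = ?x"
    using similitude_map_matrix[OF ring_hom_type_of_real x(1)] by (simp_all add: vec_eq_iff)
  have st: "stack (mat \<i>) (mat 1) ** ?V = stack (mat \<i> ** ?V) ?V"
    by (simp add: stack_mult mat_mult_mat)
  have LV: "period_matrix \<tau> ** V = ?x ** stack (mat \<i> ** ?V) ?V"
    unfolding L st[symmetric] by (simp only: matrix_mul_assoc)
  have adj: "adjoint_matrix (mat \<i> ** ?V) = mat (- \<i>) ** adjoint_matrix ?V"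
    by (simp add: vec_eq_iff transpose_def)
  have "mat (of_real l) ** (adjoint_matrix (mat \<i> ** ?V) ** ?V - adjoint_matrix ?V ** (mat \<i> ** ?V)) = 0"
    using assms(2) x(2) unfolding LV
    by (simp add: adjoint_matrix_similitude_form[OF sim(1) _ sim(2)] adjoint_matrix_stack_form)
  moreover have "adjoint_matrix (mat \<i> ** ?V) ** ?V - adjoint_matrix ?V ** (mat \<i> ** ?V)
      = mat (- 2 * \<i>) ** (adjoint_matrix ?V ** ?V)"
    unfolding adj mat_mult_assoc by (simp add: vec_eq_iff algebra_simps)
  ultimately have "mat (of_real l * (- 2 * \<i>)) ** (adjoint_matrix ?V ** ?V) = 0"
    by (simp only: mat_mult_mat(1))
  hence "adjoint_matrix ?V ** ?V = 0"
    using x(2) by (simp add: vec_eq_iff)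
  hence YV: "Y ** V = 0" by (rule adjoint_mult_eq_0)
  obtain Y' where Y': "Y' ** Y = mat 1" using x(3) by (metis invertible_left_inverse)
  have "V = (Y' ** Y) ** V" by (simp add: Y' mat_mult_mat)
  also have "\<dots> = Y' ** (Y ** V)" by (simp only: matrix_mul_assoc)
  finally show "V = 0" by (simp add: YV)
qed

text \<open>The point is that the lower block \<open>q = C \<tau> + D\<close> is invertible. If \<open>q v = 0\<close>, then the vector
  \<open>x (\<tau>; 1) v\<close> has no lower half, so the hermitian form vanishes on it; but the form is definite on the columns of
  \<open>(\<tau>; 1)\<close>.\<close>

lemma moebius_period_matrix:
  fixes \<tau> :: "complex^'g::finite^'g" and x :: "rat^('g + 'g)^('g + 'g)"
  assumes "\<tau> \<in> siegel_domain" "x \<in> GSp"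
  obtains q where "invertible q"
    "map_matrix of_rat x ** period_matrix \<tau> = period_matrix (moebius (map_matrix of_rat x) \<tau>) ** q"
proof -
  let ?x = "map_matrix complex_of_rat x"
  obtain l where l: "similitude x l" "l \<noteq> 0" using assms(2) by (rule GSp_field)
  have sim: "similitude ?x (of_rat l)" "map_matrix cnj ?x = ?x" "complex_of_rat l \<noteq> 0"
    using similitude_map_matrix[OF ring_hom_type_complex_of_rat l(1)] l(2) by (simp_all add: vec_eq_iff)
  define q where "q = blockC ?x ** \<tau> + blockD ?x"
  have xL: "?x ** period_matrix \<tau> = stack (blockA ?x ** \<tau> + blockB ?x) q"
    by (simp add: matrix_mult_stack q_def)
  have "v = 0" if "q *v v = 0" for v
  proof -
    define V :: "complex^'g^'g" where "V = (\<chi> i j. v $ i)"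
    have "(q ** V) $ i $ j = (q *v v) $ i" for i j
      by (simp add: matrix_matrix_mult_def matrix_vector_mult_def V_def)
    hence "q ** V = 0" using that by (simp add: vec_eq_iff)
    hence xLV: "?x ** (period_matrix \<tau> ** V) = stack ((blockA ?x ** \<tau> + blockB ?x) ** V) 0"
      unfolding matrix_mul_assoc xL by (simp add: stack_mult)
    have z: "adjoint_matrix (0 :: complex^'g^'g) = 0" by (simp add: vec_eq_iff transpose_def)
    have "mat (of_rat l) ** (adjoint_matrix (period_matrix \<tau> ** V) ** (sympl_form ** (period_matrix \<tau> ** V))) = 0"
      unfolding adjoint_matrix_similitude_form[OF sim(1,3,2), symmetric] xLV
      by (simp add: adjoint_matrix_stack_form z)
    hence "adjoint_matrix (period_matrix \<tau> ** V) ** (sympl_form ** (period_matrix \<tau> ** V)) = 0"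
      using sim(3) by (simp add: vec_eq_iff)
    hence "V = 0" using siegel_domain_form_definite[OF assms(1)] by blast
    thus "v = 0" by (simp add: V_def vec_eq_iff)
  qed
  hence q: "invertible q"
    by (metis invertible_left_inverse matrix_left_invertible_ker)
  have "moebius ?x \<tau> ** q = blockA ?x ** \<tau> + blockB ?x"
    unfolding moebius_def q_def[symmetric]
    using matrix_inv_inverse(2)[OF q] by (simp flip: matrix_mul_assoc)
  hence "?x ** period_matrix \<tau> = period_matrix (moebius ?x \<tau>) ** q"
    unfolding xL by (simp add: stack_mult mat_mult_mat)
  with q show thesis by (rule that)
qed

text \<open>The matrix \<open>I\<close> is the image of \<open>sqrt(-D)\<close> under the embedding.\<close>

lemma unitary_embed_commute:
  fixes h k :: "real^'g::finite^'g" and D :: nat and P :: "'g set"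
  defines "I \<equiv> block 0 (sign_mat P) (- (mat (of_nat D) ** sign_mat P)) 0 :: complex^('g + 'g)^('g + 'g)"
  shows "I ** map_matrix complex_of_real (unitary_embed D P (h, k))
    = map_matrix complex_of_real (unitary_embed D P (h, k)) ** I"
proof -
  let ?c = "map_matrix complex_of_real" and ?E = "sign_mat P :: complex^'g^'g"
  have E: "?E ** (?E ** A) = A" "?E ** ?E = mat 1" for A
    by (simp_all add: matrix_mul_assoc sign_mat_square mat_mult_mat)
  have embed: "?c (unitary_embed D P (h, k)) = block (?c h) (?c k ** ?E)
      (- (mat (of_nat D) ** (?E ** ?c k))) (?E ** (?c h ** ?E))"
    by (simp add: unitary_embed_def map_matrix_block map_matrix_mult[OF ring_hom_type_of_real]
        map_matrix_simps[OF ring_hom_type_of_real] flip: matrix_mul_assoc)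
  show ?thesis
    unfolding I_def embed block_mult
    by (simp add: block_eq_iff matrix_uminus_mult mat_mult_assoc(1)[of ?E] mat_mult_assoc(1)[of "?c k"]
        mat_mult_assoc(1)[of "?c h"] mat_mult_assoc(2) mat_mult_mat(2)[of "?c k"]
        mat_mult_mat(2)[of "?c h"] E flip: matrix_mul_assoc)
qed

text \<open>The image \<open>I\<close> of \<open>sqrt(-D)\<close> commutes with the complex structure of \<open>\<tau>\<close>, so it maps the columns of
  \<open>(\<tau>; 1)\<close> into their span: \<open>(E; - D E \<tau>) = (\<tau>; 1) T\<close>. The lower half determines \<open>T\<close>, and the
  upper half is the claim.\<close>

lemma unitary_domain_complex_multiplication:
  fixes \<tau> :: "complex^'g::finite^'g"
  assumes "D > 0" "\<tau> \<in> unitary_domain D P"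
  shows "mat (of_nat D) ** (\<tau> ** sign_mat P ** \<tau>) = - sign_mat P"
proof -
  obtain x M where x: "x \<in> unitary_embed D P ` GU D P"
    and M: "M = map_matrix complex_of_real (x ** unitary_embed D P (h_unitary D P \<i>) ** matrix_inv x)"
      "blockA M ** \<tau> + blockB M = mat (- \<i>) ** \<tau>" "blockC M ** \<tau> + blockD M = mat (- \<i>)"
    using assms(2) unfolding unitary_domain_def by (rule period_domainE)
  obtain h k l where x_def: "x = unitary_embed D P (h, k)" and l: "l dvd 1"
    and eqs: "h ** sign_mat P ** transpose h + mat (of_nat D) ** (k ** sign_mat P ** transpose k)
        = mat l ** sign_mat P" "k ** sign_mat P ** transpose h - h ** sign_mat P ** transpose k = 0"
    by (rule unitary_groupE[OF x])
  define a where "a = 1 / sqrt (of_nat D)"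
  have a: "a > 0" "of_nat D * a = 1 / a" using assms(1) by (simp_all add: a_def real_div_sqrt)
  have "l \<noteq> 0" using l by auto
  hence inv: "invertible x"
    unfolding x_def by (rule similitude_invertible[OF similitude_unitary_embed[OF eqs]])
  have hi: "unitary_embed D P (h_unitary D P \<i>) = block 0 (mat a) (- mat (1 / a)) 0"
  proof -
    have "mat a ** sign_mat P ** sign_mat P = (mat a :: real^'g^'g)"
      by (simp add: sign_mat_square flip: matrix_mul_assoc)
    moreover have "mat (of_nat D) ** sign_mat P ** (mat a ** sign_mat P) = (mat (1 / a) :: real^'g^'g)"
      by (simp add: mat_mult_assoc(1)[of "sign_mat P"] mat_mult_mat(1) mat_mult_mat_mat sign_mat_square a(2)
          flip: matrix_mul_assoc)
    moreover have "h_unitary D P \<i> = (0, mat a ** sign_mat P)"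
      by (simp add: h_unitary_def a_def mat_arith)
    ultimately show ?thesis
      by (simp add: unitary_embed_def)
  qed
  define I :: "complex^('g + 'g)^('g + 'g)" where
    "I = block 0 (sign_mat P) (- (mat (of_nat D) ** sign_mat P)) 0"
  let ?x = "map_matrix complex_of_real x"
  obtain Y where Y: "invertible Y" "period_matrix \<tau> = ?x ** stack (mat (\<i> * of_real a)) (mat 1) ** Y"
    by (rule conjugate_period_matrix[OF inv a(1) M(1)[unfolded hi] M(2,3)])
  have comm: "I ** ?x = ?x ** I"
    unfolding x_def I_def by (rule unitary_embed_commute)
  have base: "I ** stack (mat (\<i> * of_real a)) (mat 1)
      = stack (mat (\<i> * of_real a)) (mat 1) ** (mat (- \<i> / of_real a) ** sign_mat P)"
  proof -
    have "complex_of_real (of_nat D * a) = of_real (1 / a)" by (simp only: a(2))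
    hence Da: "\<i> * of_real a * of_nat D = \<i> / of_real a"
      by (simp add: mult_ac)
    thus ?thesis
      using a(1) by (simp add: I_def block_mult_stack stack_mult stack_eq_iff matrix_uminus_mult
          mat_mult_mat) (simp add: vec_eq_iff Da)
  qed
  obtain Y' where Y': "Y ** Y' = mat 1" using Y(1) by (metis invertible_right_inverse)
  define T where "T = Y' ** (mat (- \<i> / of_real a) ** sign_mat P) ** Y"
  have "I ** period_matrix \<tau> = ?x ** (I ** stack (mat (\<i> * of_real a)) (mat 1)) ** Y"
    unfolding Y(2) by (simp add: matrix_mul_assoc comm)
  also have "\<dots> = period_matrix \<tau> ** T"
  proof -
    let ?S = "stack (mat (\<i> * of_real a)) (mat 1 :: complex^'g^'g)"
    let ?K = "mat (- \<i> / of_real a) ** sign_mat P :: complex^'g^'g"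
    have "period_matrix \<tau> ** T = ?x ** ?S ** (Y ** Y') ** ?K ** Y"
      unfolding Y(2) T_def by (simp only: matrix_mul_assoc)
    also have "\<dots> = ?x ** (?S ** ?K) ** Y"
      unfolding Y' by (simp only: matrix_mul_rid matrix_mul_assoc)
    finally show ?thesis unfolding base ..
  qed
  finally have "stack (sign_mat P) (- (mat (of_nat D) ** sign_mat P ** \<tau>)) = stack (\<tau> ** T) T"
    by (simp add: I_def block_mult_stack stack_mult mat_mult_mat matrix_uminus_mult)
  hence "sign_mat P = \<tau> ** T \<and> - (mat (of_nat D) ** sign_mat P ** \<tau>) = T"
    unfolding stack_eq_iff .
  hence T: "\<tau> ** T = sign_mat P" "mat (of_nat D) ** sign_mat P ** \<tau> = - T"
    by (rule conjunct1[THEN sym], metis minus_minus)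
  have "mat (of_nat D) ** (\<tau> ** sign_mat P ** \<tau>) = \<tau> ** (mat (of_nat D) ** sign_mat P ** \<tau>)"
    by (simp only: mat_mult_assoc(1)[of \<tau>] mat_mult_assoc(2) matrix_mul_assoc[symmetric])
  also have "\<dots> = - sign_mat P"
    unfolding T(2) matrix_uminus_mult(2) T(1) ..
  finally show ?thesis .
qed

lemma unitary_embed_h_unitary:
  fixes P :: "'g::finite set"
  assumes "D > 0" and a: "a = 1 / sqrt (of_nat D)"
  shows "unitary_embed D P (h_unitary D P z)
    = block (mat (Re z)) (mat (Im z * a)) (- mat (Im z / a)) (mat (Re z))"
proof -
  let ?E = "sign_mat P :: real^'g^'g"
  have D: "of_nat D * a = 1 / a" using assms by (simp add: real_div_sqrt)
  have "mat (Im z * a) ** ?E ** ?E = mat (Im z * a)"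
    by (simp add: sign_mat_square flip: matrix_mul_assoc)
  moreover have "of_nat D * (Im z * a) = Im z / a"
    using D by (simp add: mult.left_commute)
  hence "mat (of_nat D) ** ?E ** (mat (Im z * a) ** ?E) = mat (Im z / a)"
    by (simp add: mat_mult_assoc(1)[of ?E] mat_mult_mat(1) mat_mult_mat_mat sign_mat_square
        flip: matrix_mul_assoc)
  moreover have "?E ** mat (Re z) ** ?E = mat (Re z)"
    by (simp add: mat_mult_mat(2)[of ?E] sign_mat_square flip: matrix_mul_assoc)
  moreover have "h_unitary D P z = (mat (Re z), mat (Im z * a) ** ?E)"
    by (simp add: h_unitary_def a)
  ultimately show ?thesis
    by (simp add: unitary_embed_def)
qed

text \<open>This is the period of \<open>h_unitary\<close> itself.\<close>

lemma base_point_unitary_domain: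
  fixes P :: "'g::finite set"
  assumes "D > 0" and a: "a = 1 / sqrt (of_nat D)"
  shows "(mat (\<i> * of_real a) :: complex^'g^'g) \<in> unitary_domain D P"
proof -
  have one: "unitary_embed D P (mat 1 :: real^'g^'g, 0) = mat 1"
    by (simp add: unitary_embed_def mat_block[of 1] block_eq_iff sign_mat_square)
  have "(mat 1 :: real^'g^'g, 0) \<in> GU D P"
    unfolding GU_def by (auto intro!: exI[of _ 1] simp: transpose_mat transpose_zero)
  hence "(mat 1 :: real^('g + 'g)^('g + 'g)) \<in> unitary_embed D P ` GU D P"
    using one by (metis imageI)
  hence "(\<lambda>z. (mat 1 :: real^('g + 'g)^('g + 'g)) ** unitary_embed D P (h_unitary D P z) ** matrix_inv (mat 1))
      \<in> conj_class (unitary_embed D P ` GU D P) (\<lambda>z. unitary_embed D P (h_unitary D P z))"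
    unfolding conj_class_def by blast
  moreover have "mat 1 ** unitary_embed D P (h_unitary D P z) ** matrix_inv (mat 1)
      = unitary_embed D P (h_unitary D P z)" for z
    by (simp add: matrix_inv_one)
  ultimately have mem: "(\<lambda>z. unitary_embed D P (h_unitary D P z))
      \<in> conj_class (unitary_embed D P ` GU D P) (\<lambda>z. unitary_embed D P (h_unitary D P z))"
    by simp
  have a0: "a > 0" using assms by simp
  show ?thesis
    unfolding unitary_domain_def period_domain_def mem_Collect_eq
  proof (rule bexI[OF _ mem], intro allI impI)
    fix z :: complex
    have z: "cnj z = of_real (Re z) - \<i> * of_real (Im z)"
      by (simp add: complex_eq_iff)
    have "mat (of_real (Re z)) ** mat (\<i> * of_real a) + mat (of_real (Im z * a))
        = (mat (cnj z) ** mat (\<i> * of_real a) :: complex^'g^'g)"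
      unfolding mat_mult_mat_mat z by (simp add: vec_eq_iff mat_def algebra_simps)
    moreover have "- mat (of_real (Im z / a)) ** mat (\<i> * of_real a) + mat (of_real (Re z))
        = (mat (cnj z) :: complex^'g^'g)"
      unfolding matrix_uminus_mult mat_mult_mat_mat z using a0
      by (simp add: vec_eq_iff mat_def)
    ultimately show "let M = map_matrix complex_of_real (unitary_embed D P (h_unitary D P z)) in
        blockA M ** mat (\<i> * of_real a) + blockB M = mat (cnj z) ** mat (\<i> * of_real a) \<and>
        blockC M ** mat (\<i> * of_real a) + blockD M = mat (cnj z)"
      unfolding unitary_embed_h_unitary[OF assms] map_matrix_block
        map_matrix_simps[OF ring_hom_type_of_real] Let_def blocks_block by blast
  qed
qed

section \<open>Multipliers of isogenies\<close>

lemma quad_field_norm_val: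
  assumes "inert_prime D p" "z \<in> imag_quad_field D" "z \<noteq> 0"
  obtains q where "z * cnj z = of_rat q" "q \<noteq> 0" "even (rat_val p q)"
proof -
  obtain a b where z: "z = of_rat a + of_rat b * sqrt_neg D"
    using assms(2) by (rule imag_quad_fieldE)
  let ?q = "a * a + of_nat D * (b * b)"
  have n: "z * cnj z = of_rat ?q" unfolding z by (rule imag_quad_field_norm)
  have "?q \<noteq> 0"
  proof
    assume q: "?q = 0"
    have "z * cnj z = 0" unfolding n q by (rule of_rat_0)
    thus False using assms(3) by simp
  qed
  from that[OF n this inert_norm_val_even[OF assms(1) this]] show thesis .
qed

text \<open>The base point \<open>t = i / sqrt D\<close> lies in the quadratic field, hence so do the entries of \<open>m\<close> and
  \<open>\<tau>\<close>. Comparing the hermitian forms of the two periods gives \<open>m\<^sup>* H m = l 1\<close> for the form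
  \<open>H = (\<tau> - cnj(\<tau>)) / 2t\<close>, so \<open>l\<^sup>g\<close> is \<open>det H\<close> times a norm. Multiplication by
  \<open>sqrt(-D)\<close> makes \<open>E \<tau> / t\<close> an involution, so \<open>det H\<close> is up to sign a quotient of norms. Hence \<open>l\<^sup>g\<close> has
  even valuation, and \<open>g\<close> is odd.\<close>

lemma isogeny_multiplier_val_even:
  fixes \<tau> m :: "complex^'g::finite^'g" and \<gamma> :: "rat^('g + 'g)^('g + 'g)"
  assumes "inert_prime D p" "odd CARD('g)" "D > 0"
    and \<gamma>: "similitude \<gamma> l" "l \<noteq> 0"
    and \<tau>: "mat (of_nat D) ** (\<tau> ** sign_mat P ** \<tau>) = - sign_mat P"
    and m: "invertible m" "map_matrix of_rat \<gamma> ** period_matrix (mat (\<i> * of_real (1 / sqrt (of_nat D))))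
      = period_matrix \<tau> ** m"
  shows "even (rat_val p l)"
proof -
  have p: "prime p" using assms(1) by (simp add: inert_prime_def)
  define t where "t = sqrt_neg D * inverse (of_nat D)"
  have t0: "\<i> * of_real (1 / sqrt (of_nat D)) = t"
  proof -
    have "1 / sqrt (of_nat D) = sqrt (of_nat D) * inverse (of_nat D)"
      using sqrt_divide_self_eq[of "of_nat D"] by (simp add: field_simps)
    thus ?thesis by (simp add: t_def sqrt_neg_eq)
  qed
  have tt: "t * t = - inverse (of_nat D)"
  proof -
    have "t * t = (sqrt_neg D * sqrt_neg D) * inverse (of_nat D) * inverse (of_nat D)"
      by (simp add: t_def)
    thus ?thesis using assms(3) unfolding sqrt_neg_square by simp
  qed
  have t: "t \<noteq> 0" "cnj t = - t" "t \<in> imag_quad_field D"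
    using tt assms(3) imag_quad_field_of_rat[of "of_nat D" D]
    by (auto simp: t_def cnj_sqrt_neg intro!: imag_quad_field_mult imag_quad_field_sqrt_neg
        imag_quad_field_inverse)
  let ?g = "map_matrix complex_of_rat \<gamma>"
  have sim: "similitude ?g (of_rat l)" "of_rat l \<noteq> (0::complex)" "map_matrix cnj ?g = ?g"
    using similitude_map_matrix[OF ring_hom_type_complex_of_rat \<gamma>(1)] \<gamma>(2) by (simp_all add: vec_eq_iff)
  have gt: "?g ** stack (mat t) (mat 1) = stack (\<tau> ** m) m"
    using m(2) unfolding t0 by (simp add: stack_mult mat_mult_mat)

  \<comment> \<open>The entries of \<open>(\<tau> m; m)\<close>, the image of \<open>(t; 1)\<close> under a rational matrix, lie in the field.\<close>
  have K: "quad_field_matrix D m" "quad_field_matrix D \<tau>"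
  proof -
    have "quad_field_matrix D (stack (mat t) (mat 1 :: complex^'g^'g))"
      by (simp add: quad_field_matrix_stack quad_field_matrix_mat imag_quad_field_1 t(3))
    hence st: "quad_field_matrix D (stack (\<tau> ** m) m)"
      unfolding gt[symmetric] by (intro quad_field_matrix_mult quad_field_matrix_of_rat)
    thus Km: "quad_field_matrix D m"
      by (simp add: quad_field_matrix_stack)
    have Ktm: "quad_field_matrix D (\<tau> ** m)"
      using st by (simp add: quad_field_matrix_stack)
    obtain B where "quad_field_matrix D B" "m ** B = mat 1"
      using quad_field_matrix_right_inverse[OF Km] m(1) by (auto simp: invertible_det_nz)
    moreover from this have "\<tau> = (\<tau> ** m) ** B" by (simp flip: matrix_mul_assoc)
    ultimately show "quad_field_matrix D \<tau>" using quad_field_matrix_mult[OF Ktm] by metis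
  qed
  obtain B where B: "m ** B = mat 1" "B ** m = mat 1"
    using m(1) by (auto simp: invertible_def)
  have tform: "transpose (stack X Y) ** (sympl_form ** stack X Y) = transpose X ** Y - transpose Y ** X"
    for X Y :: "complex^'g^'g"
    by (simp add: sympl_form_mult_stack transpose_stack_mult_stack matrix_uminus_mult)
  have sym: "transpose \<tau> = \<tau>"
  proof -
    have "transpose (\<tau> ** m) ** m - transpose m ** (\<tau> ** m)
        = mat (of_rat l) ** (transpose (mat t) ** mat 1 - transpose (mat 1) ** mat t)"
      using transpose_similitude_form[OF sim(1,2), of "stack (mat t) (mat 1)"]
      unfolding gt tform .
    hence "transpose m ** (transpose \<tau> - \<tau>) ** m = 0"
      by (simp add: transpose_mat matrix_transpose_mul matrix_add_distrib flip: matrix_mul_assoc)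
    hence "transpose B ** (transpose m ** (transpose \<tau> - \<tau>) ** m) ** B = 0" by simp
    moreover have "transpose B ** transpose m = mat 1"
      using B by (simp flip: matrix_transpose_mul add: transpose_mat)
    ultimately have "transpose \<tau> - \<tau> = 0"
      using B(1) by (metis matrix_mul_assoc matrix_mul_lid matrix_mul_rid)
    thus ?thesis by simp
  qed
  have herm: "adjoint_matrix m ** (map_matrix cnj \<tau> - \<tau>) ** m = mat (- 2 * t * of_rat l)"
  proof -
    have adj: "adjoint_matrix \<tau> = map_matrix cnj \<tau>"
      using sym by (metis map_matrix_simps(5)[OF ring_hom_type_cnj])
    have "adjoint_matrix (\<tau> ** m) ** m - adjoint_matrix m ** (\<tau> ** m)
        = mat (of_rat l) ** (adjoint_matrix (mat t) ** mat 1 - adjoint_matrix (mat 1) ** mat t)"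
      using adjoint_matrix_similitude_form[OF sim, of "stack (mat t) (mat 1)"]
      unfolding gt adjoint_matrix_stack_form .
    moreover have "mat (of_rat l) ** (adjoint_matrix (mat t) ** mat 1 - adjoint_matrix (mat 1) ** mat t)
        = (mat (- 2 * t * of_rat l) :: complex^'g^'g)"
      by (simp add: map_matrix_simps[OF ring_hom_type_cnj] transpose_mat t(2) mat_mult_mat(3)
          vec_eq_iff) (simp add: mat_def)
    moreover have "adjoint_matrix (\<tau> ** m) ** m - adjoint_matrix m ** (\<tau> ** m)
        = adjoint_matrix m ** (map_matrix cnj \<tau> - \<tau>) ** m"
      unfolding adjoint_matrix_mult adj by (simp add: matrix_add_distrib matrix_mul_assoc)
    ultimately show ?thesis by simp
  qed

  \<comment> \<open>\<open>E Z\<close> compares the complex structure of \<open>\<tau>\<close>, made rational by the factor \<open>1 / t\<close>, with the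
    multiplication by \<open>sqrt(-D)\<close>; it is the involution to be diagonalized.\<close>
  define Z where "Z = mat (inverse t) ** \<tau>"
  define H where "H = mat (inverse (2 * t)) ** (\<tau> - map_matrix cnj \<tau>)"
  have Z_K: "quad_field_matrix D Z"
    unfolding Z_def by (intro quad_field_matrix_mult quad_field_matrix_mat imag_quad_field_inverse t K)
  have Z_sym: "transpose Z = Z"
    using sym by (simp add: Z_def vec_eq_iff transpose_def)
  have Z_inv: "sign_mat P ** Z ** (sign_mat P ** Z) = mat 1"
  proof -
    have "inverse t * inverse t = - of_nat D"
      using tt by (metis inverse_inverse_eq inverse_minus_eq inverse_mult_distrib)
    hence "sign_mat P ** Z ** (sign_mat P ** Z)
        = mat (- of_nat D) ** (sign_mat P ** (\<tau> ** sign_mat P ** \<tau>))"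
      by (simp add: Z_def mat_mult_assoc(1)[of "sign_mat P"] mat_mult_assoc(1)[of \<tau>] mat_mult_assoc(2)
          mat_mult_mat(1) flip: matrix_mul_assoc)
    also have "\<dots> = - (sign_mat P ** (mat (of_nat D) ** (\<tau> ** sign_mat P ** \<tau>)))"
      by (simp add: mat_mult_assoc(1)[of "sign_mat P"] mat_arith matrix_uminus_mult)
    also have "\<dots> = mat 1"
      unfolding \<tau> by (simp add: matrix_uminus_mult sign_mat_square)
    finally show ?thesis .
  qed
  have HZ: "mat 2 ** H = Z + map_matrix cnj Z"
    using t by (simp add: H_def Z_def vec_eq_iff field_simps)
  have mHm: "adjoint_matrix m ** H ** m = mat (of_rat l)"
  proof -
    have "H = mat (- inverse (2 * t)) ** (map_matrix cnj \<tau> - \<tau>)"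
      by (simp add: H_def vec_eq_iff algebra_simps)
    hence "adjoint_matrix m ** H ** m
        = mat (- inverse (2 * t)) ** (adjoint_matrix m ** (map_matrix cnj \<tau> - \<tau>) ** m)"
      by (simp only: mat_mult_assoc(1)[of "adjoint_matrix m"] mat_mult_assoc(2))
    also have "\<dots> = mat (of_rat l)"
      unfolding herm mat_mult_mat_mat using t(1) by (simp add: field_simps)
    finally show ?thesis .
  qed
  have "det (adjoint_matrix m ** H ** m) = of_rat l ^ CARD('g)"
    unfolding mHm by (rule det_mat)
  hence dets: "cnj (det m) * det H * det m = of_rat l ^ CARD('g)"
    by (simp add: det_mul det_transpose det_map_matrix[OF ring_hom_type_cnj])
  hence nz: "det H \<noteq> 0" "det m \<noteq> 0" using sim(2) by auto
  obtain a b where ab: "a \<in> imag_quad_field D" "b \<in> imag_quad_field D" "a \<noteq> 0" "b \<noteq> 0"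
    "a * cnj a * det H = b * cnj b \<or> a * cnj a * det H = - (b * cnj b)"
    using hermitian_determinant_norm[OF Z_K Z_sym Z_inv HZ nz(1)] .
  obtain na where na: "a * cnj a = of_rat na" "na \<noteq> 0" "even (rat_val p na)"
    using quad_field_norm_val[OF assms(1) ab(1,3)] .
  obtain nb where nb: "b * cnj b = of_rat nb" "nb \<noteq> 0" "even (rat_val p nb)"
    using quad_field_norm_val[OF assms(1) ab(2,4)] .
  obtain nm where nm: "det m * cnj (det m) = of_rat nm" "nm \<noteq> 0" "even (rat_val p nm)"
    using quad_field_norm_val[OF assms(1) det_quad_field_matrix[OF K(1)] nz(2)] .
  have "of_rat (l ^ CARD('g) * na) = (det m * cnj (det m)) * (a * cnj a * det H)"
    by (simp add: of_rat_mult of_rat_power dets[symmetric] na(1)[symmetric] algebra_simps)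
  hence "of_rat (l ^ CARD('g) * na) = complex_of_rat (nm * nb)
      \<or> of_rat (l ^ CARD('g) * na) = complex_of_rat (- (nm * nb))"
    using ab(5) unfolding nm(1) nb(1) by (auto simp: of_rat_mult of_rat_minus)
  hence "l ^ CARD('g) * na = nm * nb \<or> l ^ CARD('g) * na = - (nm * nb)"
    by (simp only: of_rat_eq_iff)
  hence "rat_val p (l ^ CARD('g) * na) = rat_val p (nm * nb)"
    by (auto simp: rat_val_uminus[OF p])
  hence "int CARD('g) * rat_val p l + rat_val p na = rat_val p nm + rat_val p nb"
    using p \<gamma>(2) na nb nm by (simp add: rat_val_mult rat_val_power)
  hence "even (int CARD('g) * rat_val p l)"
    using na(3) nb(3) nm(3) by (metis even_add)
  thus ?thesis using assms(2) by simp
qed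

section \<open>The Hecke translate\<close>

lemma siegel_relE:
  fixes \<tau> \<tau>' :: "complex^'g::finite^'g"
  assumes "((\<tau>, a), (\<tau>', a')) \<in> siegel_rel N"
  obtains \<gamma> l u q where "similitude \<gamma> l" "l \<noteq> 0" "u \<in> level_group N"
    "a' = map_matrix adele_of_rat \<gamma> ** a ** u" "invertible q"
    "map_matrix of_rat \<gamma> ** period_matrix \<tau> = period_matrix \<tau>' ** q"
proof -
  obtain \<gamma> u where g: "\<tau> \<in> siegel_domain" "\<gamma> \<in> GSp" "u \<in> level_group N"
    "\<tau>' = moebius (map_matrix of_rat \<gamma>) \<tau>" "a' = map_matrix adele_of_rat \<gamma> ** a ** u"
    using assms unfolding siegel_rel_def shimura_rel_def by blast
  obtain l where "similitude \<gamma> l" "l \<noteq> 0" using g(2) by (rule GSp_field)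
  moreover obtain q where "invertible q"
    "map_matrix of_rat \<gamma> ** period_matrix \<tau> = period_matrix \<tau>' ** q"
    using moebius_period_matrix[OF g(1,2)] g(4) by metis
  ultimately show thesis using that[OF _ _ g(3,5)] by blast
qed

text \<open>It follows that no point of the Siegel modular variety is the empty class.\<close>

lemma siegel_rel_refl:
  fixes \<tau> :: "complex^'g::finite^'g"
  assumes "\<tau> \<in> siegel_domain" "a \<in> GSp"
  shows "((\<tau>, a), (\<tau>, a)) \<in> siegel_rel N"
proof -
  have "mat 1 \<in> (GSp :: (rat^('g + 'g)^('g + 'g)) set)" "mat 1 \<in> (GSp :: 'g adelic_group set)"
    unfolding GSp_iff by (rule exI[of _ 1], simp add: similitude_one)+
  moreover have int: "adele_integral 0" "adele_integral 1"
    using adele_integral_of_int[of 0] adele_integral_of_int[of 1]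
    by (simp_all add: ring_hom_typeD[OF ring_hom_type_adele_of_rat])
  hence "adele_integral ((mat 1 :: 'g adelic_group) $ i $ j)" for i j
    by (simp add: mat_def)
  moreover have "\<exists>c. adele_integral c \<and> blockC (mat 1 :: 'g adelic_group) $ i $ j = of_nat N * c" for i j
    using int(1) by (intro exI[of _ 0]) (simp add: blockC_def mat_def)
  ultimately have level: "mat 1 \<in> (level_group N :: 'g adelic_group set)"
    unfolding level_group_def by (auto intro!: exI[of _ "mat 1"])
  have "moebius (mat 1) \<tau> = \<tau>"
  proof -
    have "blockA (mat 1 :: complex^('g + 'g)^('g + 'g)) = mat 1"
      "blockB (mat 1 :: complex^('g + 'g)^('g + 'g)) = 0"
      "blockC (mat 1 :: complex^('g + 'g)^('g + 'g)) = 0" "blockD (mat 1 :: complex^('g + 'g)^('g + 'g)) = mat 1"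
      unfolding mat_block[of 1] by simp_all
    thus ?thesis by (simp add: moebius_def matrix_inv_one)
  qed
  thus ?thesis
    unfolding siegel_rel_def shimura_rel_def mem_Collect_eq case_prod_conv
    using assms \<open>mat 1 \<in> (GSp :: (rat^('g + 'g)^('g + 'g)) set)\<close> level
    by (auto intro!: bexI[of _ "mat 1"] simp: map_matrix_simps[OF ring_hom_type_complex_of_rat]
        map_matrix_simps[OF ring_hom_type_adele_of_rat]
        ring_hom_typeD(2)[OF ring_hom_type_adele_of_rat] mat_mult_mat(3))
qed

lemma shimura_variety_subset: "s \<in> shimura_variety HQ \<D> HA U \<Longrightarrow> s \<subseteq> \<D> \<times> HA"
  by (auto simp: shimura_variety_def quotient_def shimura_rel_def)

lemma topspace_siegel_zariski: "topspace (siegel_zariski N) \<subseteq> siegel_variety N"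
  unfolding siegel_zariski_def topology_generated_by_topspace
  by (auto simp: nonvanishing_locus_def)

theorem theorem3p3p5:
  fixes P :: "'g::finite set" and V :: "'g shimura_point set" and D N p r s :: nat
  assumes "D > 0" and "class_number D = 1"
    and "odd p" and "inert_prime D p"
    and "N > 0" and "coprime N p" and "\<forall>q. prime q \<and> q dvd N \<longrightarrow> split_prime D q"
    and "CARD('g) = r + s" and "card P = r"
    and "V \<in> unitary_subvarieties D P N"
    and "odd (r + s)"
  shows "V \<notin> irreducible_components (siegel_zariski N) (hecke_image N p V)"
proof
  assume "V \<in> irreducible_components (siegel_zariski N) (hecke_image N p V)"
  hence V_hecke: "V \<subseteq> hecke_image N p V" and "irreducible_in (siegel_zariski N) V"
    by (simp_all add: irreducible_components_def)
  hence V_siegel: "V \<subseteq> siegel_variety N"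
    using topspace_siegel_zariski by (metis irreducible_in_def order_trans)
  have V_locus: "V \<subseteq> unitary_locus D P N"
    using assms(10) by (auto simp: unitary_subvarieties_def irreducible_components_def)
  obtain x where x: "x \<in> GU D P"
    "\<And>\<tau>. \<tau> \<in> unitary_domain D P \<Longrightarrow> siegel_rel N `` {(\<tau>, unitary_embed D P x)} \<in> V"
    using assms(10) by (auto simp: unitary_subvarieties_def)
  have p: "prime p" and odd: "odd CARD('g)"
    using assms by (simp_all add: inert_prime_def)
  define \<tau>0 :: "complex^'g^'g" where "\<tau>0 = mat (\<i> * of_real (1 / sqrt (of_nat D)))"
  define t0 where "t0 = siegel_rel N `` {(\<tau>0, unitary_embed D P x)}"
  let ?\<delta> = "block (mat 1) 0 0 (mat (of_nat p)) :: 'g adelic_group"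
  have "t0 \<in> V"
    unfolding t0_def \<tau>0_def by (intro x(2) base_point_unitary_domain[OF assms(1)] refl)
  then obtain t where t: "t \<in> V" "t0 \<in> hecke_point N p t"
    using V_hecke by (auto simp: hecke_image_def)
  then obtain \<tau> a u where tau: "(\<tau>, a) \<in> t" "u \<in> level_group N"
    and t0: "t0 = siegel_rel N `` {(\<tau>, a ** u ** ?\<delta>)}"
    unfolding hecke_point_def by blast
  obtain c where c: "c \<in> unitary_shimura_variety D P N" "t = siegel_rel N `` c"
    using t(1) V_locus unfolding unitary_locus_def by blast
  then obtain \<tau>1 a1 where "(\<tau>1, a1) \<in> c" and rel: "((\<tau>1, a1), (\<tau>, a)) \<in> siegel_rel N"
    using tau(1) by auto
  hence ta1: "\<tau>1 \<in> unitary_domain D P" "a1 \<in> unitary_embed D P ` GU D P"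
    using shimura_variety_subset[OF c(1)[unfolded unitary_shimura_variety_def]] by auto
  \<comment> \<open>\<open>t0\<close> is the class of two points; an element of it is related to both.\<close>
  obtain \<sigma> b where sb: "(\<sigma>, b) \<in> t0"
  proof -
    have "t0 \<in> siegel_variety N" using \<open>t0 \<in> V\<close> V_siegel by blast
    then obtain \<tau>2 a2 where "\<tau>2 \<in> siegel_domain" "a2 \<in> GSp" "t0 = siegel_rel N `` {(\<tau>2, a2)}"
      unfolding siegel_variety_def shimura_variety_def quotient_def siegel_rel_def by auto
    hence "(\<tau>2, a2) \<in> t0" using siegel_rel_refl by blast
    thus thesis by (rule that)
  qed
  obtain \<gamma>1 l1 u1 q1 where g1: "similitude \<gamma>1 l1" "l1 \<noteq> 0" "u1 \<in> level_group N"
    "a = map_matrix adele_of_rat \<gamma>1 ** a1 ** u1" "invertible q1"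
    "map_matrix of_rat \<gamma>1 ** period_matrix \<tau>1 = period_matrix \<tau> ** q1"
    using rel by (rule siegel_relE)
  have "((\<tau>, a ** u ** ?\<delta>), (\<sigma>, b)) \<in> siegel_rel N"
    using sb unfolding t0 by blast
  then obtain \<gamma>2 l2 u2 q2 where g2: "similitude \<gamma>2 l2" "l2 \<noteq> 0" "u2 \<in> level_group N"
    "b = map_matrix adele_of_rat \<gamma>2 ** (a ** u ** ?\<delta>) ** u2" "invertible q2"
    "map_matrix of_rat \<gamma>2 ** period_matrix \<tau> = period_matrix \<sigma> ** q2"
    by (rule siegel_relE)
  have "((\<tau>0, unitary_embed D P x), (\<sigma>, b)) \<in> siegel_rel N"
    using sb unfolding t0_def by blast
  then obtain \<gamma>3 l3 u3 q3 where g3: "similitude \<gamma>3 l3" "l3 \<noteq> 0" "u3 \<in> level_group N"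
    "b = map_matrix adele_of_rat \<gamma>3 ** unitary_embed D P x ** u3" "invertible q3"
    "map_matrix of_rat \<gamma>3 ** period_matrix \<tau>0 = period_matrix \<sigma> ** q3"
    by (rule siegel_relE)

  \<comment> \<open>The rational matrix \<open>?\<gamma>\<close> below maps the base point to \<open>\<tau>1\<close>.\<close>
  have rational: "even (rat_val p (1 / l1 * (1 / l2) * l3))"
  proof -
    obtain \<eta>1 where e1: "\<eta>1 ** \<gamma>1 = mat 1" "similitude \<eta>1 (1 / l1)"
      using similitude_inverse[OF g1(1,2)] by metis
    obtain \<eta>2 where e2: "\<eta>2 ** \<gamma>2 = mat 1" "similitude \<eta>2 (1 / l2)"
      using similitude_inverse[OF g2(1,2)] by metis
    obtain r1 where r1: "q1 ** r1 = mat 1" "r1 ** q1 = mat 1" using g1(5) by (auto simp: invertible_def)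
    obtain r2 where r2: "q2 ** r2 = mat 1" "r2 ** q2 = mat 1" using g2(5) by (auto simp: invertible_def)
    note hom = map_matrix_mult[OF ring_hom_type_complex_of_rat]
      map_matrix_simps[OF ring_hom_type_complex_of_rat]
    have pull_back: "map_matrix of_rat \<eta> ** period_matrix \<rho>' = period_matrix \<rho> ** r"
      if "\<eta> ** \<gamma> = mat 1" "q ** r = mat 1"
        "map_matrix of_rat \<gamma> ** period_matrix \<rho> = period_matrix \<rho>' ** q"
      for \<eta> \<gamma> :: "rat^('g + 'g)^('g + 'g)" and q r \<rho> \<rho>' :: "complex^'g^'g"
    proof -
      have "map_matrix of_rat \<eta> ** period_matrix \<rho>'
          = map_matrix of_rat \<eta> ** (period_matrix \<rho>' ** q) ** r"
        by (simp add: that(2) flip: matrix_mul_assoc)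
      also have "\<dots> = map_matrix of_rat (\<eta> ** \<gamma>) ** period_matrix \<rho> ** r"
        unfolding that(3)[symmetric] hom(1) by (simp only: matrix_mul_assoc)
      also have "\<dots> = period_matrix \<rho> ** r"
        by (simp add: that(1) hom(2))
      finally show ?thesis .
    qed
    let ?\<gamma> = "\<eta>1 ** \<eta>2 ** \<gamma>3" and ?m = "r1 ** r2 ** q3"
    have "map_matrix of_rat ?\<gamma> ** period_matrix \<tau>0 = period_matrix \<tau>1 ** ?m"
      using pull_back[OF e1(1) r1(1) g1(6)] pull_back[OF e2(1) r2(1) g2(6)] g3(6)
      by (simp add: hom(1) flip: matrix_mul_assoc) (simp add: matrix_mul_assoc)
    moreover have "invertible ?m"
      using r1 r2 g3(5) by (intro invertible_mult) (auto simp: invertible_def)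
    moreover have "similitude ?\<gamma> (1 / l1 * (1 / l2) * l3)"
      by (intro similitude_mult e1 e2 g3)
    ultimately show ?thesis
      using isogeny_multiplier_val_even[OF assms(4) odd assms(1) _ _
          unitary_domain_complex_multiplication[OF assms(1) ta1(1)]] g1(2) g2(2) g3(2)
      unfolding \<tau>0_def by simp
  qed

  \<comment> \<open>The two expressions for \<open>b\<close> have the same multiplier; the factor \<open>p\<close> occurs in one of them only.\<close>
  obtain k1 n1 where k1: "similitude a1 k1" "adele_val p k1 n1" "even n1"
    using unitary_multiplier_val_even[OF assms(4) odd ta1(2)] .
  obtain k3 n3 where k3: "similitude (unitary_embed D P x) k3" "adele_val p k3 n3" "even n3"
    using unitary_multiplier_val_even[OF assms(4) odd imageI[OF x(1)]] .
  obtain v where v: "similitude u v" "adele_val p v 0" using level_group_multiplier[OF p tau(2)] .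
  obtain v1 where v1: "similitude u1 v1" "adele_val p v1 0" using level_group_multiplier[OF p g1(3)] .
  obtain v2 where v2: "similitude u2 v2" "adele_val p v2 0" using level_group_multiplier[OF p g2(3)] .
  obtain v3 where v3: "similitude u3 v3" "adele_val p v3 0" using level_group_multiplier[OF p g3(3)] .
  note hom = similitude_map_matrix[OF ring_hom_type_adele_of_rat]
  have val_p: "adele_val p (of_nat p) 1"
    using adele_val_of_rat[of "of_nat p" p] prime_gt_0_nat[OF p] by (simp add: adele_of_nat rat_val_prime[OF p])
  have "similitude b (adele_of_rat l2 * (adele_of_rat l1 * k1 * v1 * v * of_nat p) * v2)"
    unfolding g2(4) g1(4) by (intro similitude_mult hom g1 g2 k1 v v1 v2 similitude_diag)
  moreover have "similitude b (adele_of_rat l3 * k3 * v3)"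
    unfolding g3(4) by (intro similitude_mult hom g3 k3 v3)
  ultimately have "adele_of_rat l2 * (adele_of_rat l1 * k1 * v1 * v * of_nat p) * v2
      = adele_of_rat l3 * k3 * v3"
    by (rule similitude_unique)
  moreover have "adele_val p (adele_of_rat l2 * (adele_of_rat l1 * k1 * v1 * v * of_nat p) * v2)
      (rat_val p l2 + (rat_val p l1 + n1 + 0 + 0 + 1) + 0)"
    by (intro adele_val_mult p adele_val_of_rat g1(2) g2(2) k1 v v1 v2 val_p)
  moreover have "adele_val p (adele_of_rat l3 * k3 * v3) (rat_val p l3 + n3 + 0)"
    by (intro adele_val_mult p adele_val_of_rat g3(2) k3 v3)
  ultimately have "rat_val p l2 + (rat_val p l1 + n1 + 0 + 0 + 1) + 0 = rat_val p l3 + n3 + 0"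
    using adele_val_unique[OF p] by metis
  moreover have "rat_val p (1 / l1 * (1 / l2) * l3) = rat_val p l3 - rat_val p l1 - rat_val p l2"
    using p g1(2) g2(2) g3(2) by (simp add: rat_val_mult rat_val_divide rat_val_1)
  ultimately have "rat_val p (1 / l1 * (1 / l2) * l3) = n1 + 1 - n3" by linarith
  thus False using rational k1(3) k3(3) by simp
qed

end
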